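(* Let $s>-1/4$, let $a,b\in\mathbb{R}$, and suppose that one of the following two cases holds: (i) $s\ge 0$, $b>1/2$ and $1/4<a<1/2$; (ii) $-1/4<s<0$, $b>1/2$ and $1/4<a<1/2$ with $|s|<a/2$. Then there exists a constant $c>0$, depending only on $a$, $b$ and $s$, such that for all $u,v\in X_{s,b}$, $$\left\|\left(\frac{|n|^2\,\widetilde{uv}(\tau,n)}{2i\gamma(n)}\right)^{\sim^{-1}}\right\|_{X_{s,-a}}\le c\,\|u\|_{X_{s,b}}\,\|v\|_{X_{s,b}}.$$
   Context: $\mathbb{T}$ is the one-dimensional torus (periodic functions of $x$, with spatial frequency $n\in\mathbb{Z}$), $\langle y\rangle = 1+|y|$, and $\gamma(n)=\sqrt{n^2+n^4}$ for $n\in\mathbb{Z}$. The symbol $\sim$ denotes the space-time Fourier transform in $(x,t)\in\mathbb{T}\times\mathbb{R}$, with dual variables $n\in\mathbb{Z}$ and $\tau\in\mathbb{R}$, and $\sim^{-1}$ denotes the inverse space-time Fourier transform. The multiplier $|n|^2/\gamma(n)$ is taken to be $0$ at $n=0$. Let $\mathcal{Y}$ be the space of functions $F:\mathbb{T}\times\mathbb{R}\to\mathbb{C}$ such that $F(x,\cdot)$ belongs to the Schwartz space $S(\mathbb{R})$ for each $x\in\mathbb{T}$ and $F(\cdot,t)\in C^\infty(\mathbb{T})$ for each $t\in\mathbb{R}$. For $s,b\in\mathbb{R}$, $X_{s,b}$ is the completion of $\mathcal{Y}$ with respect to the norm $$\|F\|_{X_{s,b}}=\left\|\langle|\tau|-\gamma(n)\rangle^{b}\langle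 n\rangle^{s}\widetilde{F}(\tau,n)\right\|_{\ell^2_nL^2_\tau}.$$ $\widetilde{uv}$ is understood as the convolution of $\widetilde u$ and $\widetilde v$ in $(\tau,n)\in\mathbb{R}\times\mathbb{Z}$. *)

theory Defs
  imports "HOL-Analysis.Analysis"
begin

definition vderiv_iter :: "nat \<Rightarrow> (real \<Rightarrow> complex) \<Rightarrow> real \<Rightarrow> complex" where
  "vderiv_iter k f = ((\<lambda>g t. vector_derivative g (at t)) ^^ k) f"

definition smooth :: "(real \<Rightarrow> complex) \<Rightarrow> bool" where
  "smooth f \<longleftrightarrow> (\<forall>k t. vderiv_iter k f differentiable (at t))"

definition schwartz :: "(real \<Rightarrow> complex) \<Rightarrow> bool" where
  "schwartz f \<longleftrightarrow> smooth f \<and>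
     (\<forall>j k. \<exists>C. \<forall>t. \<bar>t\<bar> ^ j * norm (vderiv_iter k f t) \<le> C)"

text \<open>Functions on the torus are \<open>2\<pi>\<close>-periodic functions of \<open>x\<close>, so that the frequencies
  are exactly the integers. The argument order is \<open>F x t\<close>.\<close>

definition Y_space :: "(real \<Rightarrow> real \<Rightarrow> complex) set" where
  "Y_space = {F. (\<forall>x t. F (x + 2 * pi) t = F x t) \<and>
                 (\<forall>x. schwartz (\<lambda>t. F x t)) \<and> (\<forall>t. smooth (\<lambda>x. F x t))}"

text \<open>Membership in \<open>Y_space\<close> gives no control that is uniform in \<open>x\<close>, so it does not imply
  integrability over the torus times the line; the completion below only uses those elements for
  which the Fourier integral converges absolutely.\<close>

definition xt_integrable :: "(real \<Rightarrow> real \<Rightarrow> complex) \<Rightarrow> bool" where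
  "xt_integrable F \<longleftrightarrow>
     set_integrable (lborel :: (real \<times> real) measure) ({0..2 * pi} \<times> UNIV) (\<lambda>(x, t). F x t)"

definition xt_fourier :: "(real \<Rightarrow> real \<Rightarrow> complex) \<Rightarrow> real \<times> int \<Rightarrow> complex" where
  "xt_fourier F = (\<lambda>(\<tau>, n).
     (LINT (x, t) : {0..2 * pi} \<times> UNIV | lborel. cis (- (t * \<tau> + x * of_int n)) * F x t))"

definition jbr :: "real \<Rightarrow> real" where
  "jbr y = 1 + \<bar>y\<bar>"

definition gam :: "int \<Rightarrow> real" where
  "gam n = sqrt ((of_int n)\<^sup>2 + (of_int n) ^ 4)"

definition freq :: "(real \<times> int) measure" where
  "freq = lborel \<Otimes>\<^sub>M count_space UNIV"

text \<open>Square of the \<open>X\<^sub>s\<^sub>,\<^sub>b\<close> norm, possibly infinite, as a function of the space-time Fourier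
  transform \<open>f\<close>; by Tonelli the integral over \<open>freq\<close> is the squared \<open>\<ell>\<^sup>2\<close> norm in \<open>n\<close> of the
  \<open>L\<^sup>2\<close> norms in \<open>\<tau>\<close>.\<close>

definition Xnorm_sq :: "real \<Rightarrow> real \<Rightarrow> (real \<times> int \<Rightarrow> complex) \<Rightarrow> ennreal" where
  "Xnorm_sq s b f = (\<integral>\<^sup>+ (\<tau>, n).
     ennreal ((jbr (\<bar>\<tau>\<bar> - gam n) powr b * jbr (of_int n) powr s * norm (f (\<tau>, n)))\<^sup>2) \<partial>freq)"

definition Xnorm :: "real \<Rightarrow> real \<Rightarrow> (real \<times> int \<Rightarrow> complex) \<Rightarrow> real" where
  "Xnorm s b f = sqrt (enn2real (Xnorm_sq s b f))"

text \<open>The completion of \<open>Y_space\<close>. The Fourier transform is an isometry from \<open>Y_space\<close> (with the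
  \<open>X\<^sub>s\<^sub>,\<^sub>b\<close> norm, where finite) into a weighted \<open>L\<^sup>2\<close> space over \<open>freq\<close>, which is complete. Hence
  the completion is realised as the closure of the image: an element \<open>u\<close> is represented by its
  space-time Fourier transform, determined almost everywhere. In particular the element
  whose Fourier transform is \<open>g\<close>, i.e. the inverse transform of \<open>g\<close>, is represented by \<open>g\<close>.\<close>

definition X_space :: "real \<Rightarrow> real \<Rightarrow> (real \<times> int \<Rightarrow> complex) set" where
  "X_space s b = {f \<in> borel_measurable freq.
     \<exists>F. (\<forall>k::nat. F k \<in> Y_space \<and> xt_integrable (F k) \<and> Xnorm_sq s b (xt_fourier (F k)) < \<infinity>) \<and>
         (\<lambda>k. Xnorm_sq s b (\<lambda>p. xt_fourier (F k) p - f p)) \<longlonglongrightarrow> 0}"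

definition conv_integrand ::
    "(real \<times> int \<Rightarrow> complex) \<Rightarrow> (real \<times> int \<Rightarrow> complex) \<Rightarrow> real \<times> int \<Rightarrow> real \<times> int \<Rightarrow> complex" where
  "conv_integrand f g = (\<lambda>(\<tau>, n) (\<tau>', n'). f (\<tau> - \<tau>', n - n') * g (\<tau>', n'))"

definition conv ::
    "(real \<times> int \<Rightarrow> complex) \<Rightarrow> (real \<times> int \<Rightarrow> complex) \<Rightarrow> real \<times> int \<Rightarrow> complex" where
  "conv f g p = (LINT q | freq. conv_integrand f g p q)"

text \<open>Fourier transform of the bilinear expression. At \<open>n = 0\<close> we have \<open>gam 0 = 0\<close>, and division
  by zero yields the required value \<open>0\<close> of the multiplier.\<close>

definition bilin ::
    "(real \<times> int \<Rightarrow> complex) \<Rightarrow> (real \<times> int \<Rightarrow> complex) \<Rightarrow> real \<times> int \<Rightarrow> complex" where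
  "bilin f g = (\<lambda>(\<tau>, n).
     of_real (\<bar>of_int n\<bar>\<^sup>2) * conv f g (\<tau>, n) / (2 * \<i> * of_real (gam n)))"

end

theory Submission
  imports Defs "HOL-Probability.Characteristic_Functions"
begin

text \<open>The estimate is a weighted bilinear \<open>L\<^sup>2\<close> inequality on the Fourier side. Write
  \<open>A(p) = 1 + |  |\<tau>| - \<gamma>(n)  |\<close> for the modulation of a frequency \<open>p = (\<tau>, n)\<close>. After absorbing the
  weights of the two inputs into their norms, the convolution acts on two functions of
  \<open>L\<^sup>2\<close> through a kernel built from powers of \<open>1 + |n|\<close> and of \<open>A\<close> at the output \<open>p\<close> and at the two
  inputs \<open>p - q\<close> and \<open>q\<close>.

  For \<open>s \<ge> 0\<close> the powers of \<open>1 + |n|\<close> multiply to at most one. For \<open>s < 0\<close> they lose derivatives, and the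
  dispersion pays for them when all three spatial frequencies are nonzero (lemma \<open>resonance\<close>).
  Up to a bounded error \<open>\<gamma>(n)\<close> is \<open>n\<^sup>2\<close>, and among \<open>|\<tau>\<^sub>1 + \<tau>\<^sub>2|\<close>, \<open>|\<tau>\<^sub>1|\<close>, \<open>|\<tau>\<^sub>2|\<close> one is the sum of the
  two others. Hence the three modulations cannot all be small: their maximum \<open>M\<close> dominates the product
  of two of the three spatial frequencies, so that \<open>(1+|n\<^sub>1|)(1+|n\<^sub>2|)\<close> is at most a multiple of
  \<open>(1+|n|) M\<^sup>2\<close>. Spending \<open>M\<^bsup>2|s|\<^esup>\<close> costs less than the power \<open>a\<close> of the output modulation,
  because \<open>2|s| < a\<close>. If the largest modulation is the one of an input, the exponents are moved from
  that input to the output. In all cases (lemma \<open>kernel_bound\<close>) the kernel is at most a constant times a sum of three terms, each of them the product of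
  \<open>A\<^bsup>-b\<^esup>\<close> over two of the three points, supported where the third point has nonzero
  spatial frequency.

  Each of these three terms gives a bounded operator by the Cauchy-Schwarz inequality, applied with
  the two factors split so that the point left out becomes the fixed point of the inner integral. All that is
  needed is that \<open>\<integral> A(q)\<^bsup>-2b\<^esup> A(p - q)\<^bsup>-2b\<^esup> dq\<close> is bounded uniformly in \<open>p\<close> with \<open>n \<noteq> 0\<close> (lemma
  \<open>interaction_bounded\<close>). Integrating in time, this is a sum over \<open>k \<in> \<int>\<close> of \<open>(1 + |P(k)|)\<^bsup>-2b\<^esup>\<close>, with
  \<open>P\<close> either quadratic with leading coefficient \<open>\<plusminus>2\<close> or affine with slope \<open>\<plusminus>2n\<close>, and \<open>2b > 1\<close> suffices.
  The exclusion of \<open>n = 0\<close> is what makes the affine case summable.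

  The bilinear expression must also belong to the completion of the smooth functions. Since the
  completion is a closure of Fourier transforms in a weighted \<open>L\<^sup>2\<close> space, this means that every
  measurable function of finite norm is approximable (theorem \<open>X_space_of_finite_norm\<close>, for
  nonpositive exponents of the modulation). The Fourier transforms of the wave packets
  \<open>exp(imx) exp(-(t-c)\<^sup>2/2)\<close> are, on the single mode \<open>m\<close>, a fixed Gaussian times arbitrary characters in \<open>\<tau>\<close>.
  The functions \<open>h\<close> for which Gaussian times \<open>h\<close> is approximable therefore contain the trigonometric
  polynomials and are closed under bounded almost everywhere limits; they contain indicators of
  half-lines, then of Borel sets by Dynkin's lemma, and finally all bounded Borel functions.\<close>

section \<open>Resonance and the pointwise kernel bound\<close>

lemma jbr_ge_1: "1 \<le> jbr y" by (simp add: jbr_def)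
lemma jbr_pos [simp]: "0 < jbr y" by (simp add: jbr_def add_pos_nonneg)
lemma jbr_nonzero [simp]: "jbr y \<noteq> 0" using jbr_pos[of y] by linarith
lemma jbr_nonneg [simp]: "0 \<le> jbr y" by (simp add: jbr_def)
lemma jbr_minus [simp]: "jbr (- y) = jbr y" by (simp add: jbr_def)
lemma jbr_add_le: "jbr (x + y) \<le> jbr x * jbr y"
proof -
  have "\<bar>x + y\<bar> \<le> \<bar>x\<bar> + \<bar>y\<bar> + \<bar>x\<bar> * \<bar>y\<bar>" using abs_triangle_ineq[of x y] by (simp add: add_increasing2)
  thus ?thesis by (simp add: jbr_def algebra_simps)
qed

lemma gam_bounds: "(of_int n)\<^sup>2 \<le> gam n" "gam n \<le> (of_int n)\<^sup>2 + 1/2"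
proof -
  show "(of_int n)\<^sup>2 \<le> gam n" unfolding gam_def
    by (rule real_le_rsqrt) (simp add: power2_eq_square power4_eq_xxxx)
  have "(real_of_int n)\<^sup>2 + (real_of_int n) ^ 4 \<le> ((of_int n)\<^sup>2 + 1/2)\<^sup>2"
    by (simp add: power2_eq_square power4_eq_xxxx algebra_simps)
  then show "gam n \<le> (of_int n)\<^sup>2 + 1/2" unfolding gam_def
    by (intro real_le_lsqrt) auto
qed

text \<open>The weight \<open>\<langle>|\<tau>| - \<gamma>(n)\<rangle>\<close>, the modulation of a space-time frequency.\<close>
definition modul :: "real \<times> int \<Rightarrow> real" where
  "modul p = jbr (\<bar>fst p\<bar> - gam (snd p))"

definition freqsize :: "real \<times> int \<Rightarrow> real" where
  "freqsize p = jbr (of_int (snd p))"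

lemma modul_ge_1: "1 \<le> modul p" by (simp add: modul_def jbr_ge_1)
lemma modul_pos [simp]: "0 < modul p" by (simp add: modul_def)
lemma freqsize_ge_1: "1 \<le> freqsize p" by (simp add: freqsize_def jbr_ge_1)
lemma freqsize_pos [simp]: "0 < freqsize p" by (simp add: freqsize_def)

lemma modul_nonzero [simp]: "modul p \<noteq> 0" using modul_pos[of p] by linarith
lemma freqsize_nonzero [simp]: "freqsize p \<noteq> 0" using freqsize_pos[of p] by linarith

lemma freqsize_add_le: "freqsize (p + q) \<le> freqsize p * freqsize q"
  using jbr_add_le[of "of_int (snd p)" "of_int (snd q)"] by (simp add: freqsize_def)

lemma freqsize_minus [simp]: "freqsize (- p) = freqsize p"
  by (simp add: freqsize_def)

text \<open>One of the numbers \<open>|\<tau>\<^sub>1 + \<tau>\<^sub>2|\<close>, \<open>|\<tau>\<^sub>1|\<close>, \<open>|\<tau>\<^sub>2|\<close> is the sum of the other two. Replacing each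
  of them by the square of the corresponding spatial frequency changes it by at most \<open>M\<close>, and
  \<open>n = n\<^sub>1 + n\<^sub>2\<close> turns the resulting combination of squares into twice the product of two of the
  frequencies, which is therefore at most \<open>3M\<close>. If these two are the inputs, the claim holds with \<open>M\<close> instead of
  \<open>M\<^sup>2\<close>. Otherwise one input is at most \<open>3M/2\<close>, since the output frequency is a nonzero integer, and the
  other input is bounded through the output and this one; that case produces \<open>M\<^sup>2\<close> and the constant 9.\<close>
lemma resonance:
  assumes nz: "snd p \<noteq> 0" "snd q \<noteq> 0" "snd (p + q) \<noteq> 0"
    and M: "modul p \<le> M" "modul q \<le> M" "modul (p + q) \<le> M"
  shows "freqsize p * freqsize q \<le> 9 * (freqsize (p + q) * M\<^sup>2)"
proof -
  obtain t1 m1 where p: "p = (t1, m1)" by (cases p)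
  obtain t2 m2 where q: "q = (t2, m2)" by (cases q)
  define x y z :: real where "x = of_int m1" "y = of_int m2" "z = of_int (m1 + m2)"
  note xyz = this
  have ge1: "1 \<le> \<bar>x\<bar>" "1 \<le> \<bar>y\<bar>" "1 \<le> \<bar>z\<bar>" using nz p q xyz by auto
  have zxy: "z = x + y" by (simp add: xyz)
  have M1: "1 \<le> M" using modul_ge_1[of p] M by linarith
  have MM: "M \<le> M\<^sup>2" using M1 by (simp add: power2_eq_square)
  have s1: "\<bar>\<bar>t1\<bar> - x\<^sup>2\<bar> \<le> M" using M(1) gam_bounds[of m1] by (auto simp: modul_def p jbr_def xyz)
  have s2: "\<bar>\<bar>t2\<bar> - y\<^sup>2\<bar> \<le> M" using M(2) gam_bounds[of m2] by (auto simp: modul_def q jbr_def xyz)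
  have s3: "\<bar>\<bar>t1 + t2\<bar> - z\<^sup>2\<bar> \<le> M" using M(3) gam_bounds[of "m1 + m2"]
    by (auto simp: modul_def p q jbr_def xyz)
  have jx: "freqsize p = 1 + \<bar>x\<bar>" and jy: "freqsize q = 1 + \<bar>y\<bar>" and jz: "freqsize (p + q) = 1 + \<bar>z\<bar>"
    by (simp_all add: freqsize_def p q jbr_def xyz)
  have sq: "(1 + \<bar>w\<bar>) * (1 + \<bar>w\<bar>) \<le> 9 * M\<^sup>2" if "\<bar>w\<bar> \<le> 3/2 * M" "1 \<le> \<bar>w\<bar>" for w :: real
  proof -
    have "(1 + \<bar>w\<bar>) \<le> 3 * M" using that by linarith
    hence "(1 + \<bar>w\<bar>) * (1 + \<bar>w\<bar>) \<le> (3 * M) * (3 * M)" by (intro mult_mono) auto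
    thus ?thesis by (simp add: power2_eq_square)
  qed
  consider "\<bar>t1 + t2\<bar> = \<bar>t1\<bar> + \<bar>t2\<bar>" | "\<bar>t1\<bar> = \<bar>t1 + t2\<bar> + \<bar>t2\<bar>" | "\<bar>t2\<bar> = \<bar>t1 + t2\<bar> + \<bar>t1\<bar>"
    by linarith
  then show ?thesis
  proof cases
    case 1
    have "\<bar>z\<^sup>2 - x\<^sup>2 - y\<^sup>2\<bar> \<le> 3 * M" using 1 s1 s2 s3 by linarith
    also have "z\<^sup>2 - x\<^sup>2 - y\<^sup>2 = 2 * (x * y)" by (simp add: zxy power2_eq_square algebra_simps)
    finally have h: "\<bar>x\<bar> * \<bar>y\<bar> \<le> 3/2 * M" by (simp add: abs_mult)
    have "freqsize p * freqsize q \<le> (2 * \<bar>x\<bar>) * (2 * \<bar>y\<bar>)"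
      unfolding jx jy using ge1 by (intro mult_mono) auto
    also have "\<dots> \<le> 6 * M" using h by simp
    also have "\<dots> \<le> 9 * (1 * M\<^sup>2)" using M1 MM by linarith
    also have "\<dots> \<le> 9 * (freqsize (p + q) * M\<^sup>2)"
      by (intro mult_left_mono mult_right_mono freqsize_ge_1) auto
    finally show ?thesis .
  next
    case 2
    have "\<bar>x\<^sup>2 - z\<^sup>2 - y\<^sup>2\<bar> \<le> 3 * M" using 2 s1 s2 s3 by linarith
    also have "x\<^sup>2 - z\<^sup>2 - y\<^sup>2 = - 2 * (z * y)" by (simp add: zxy power2_eq_square algebra_simps)
    finally have h: "\<bar>z\<bar> * \<bar>y\<bar> \<le> 3/2 * M" by (simp add: abs_mult)
    have "1 * \<bar>y\<bar> \<le> \<bar>z\<bar> * \<bar>y\<bar>" using ge1 by (intro mult_right_mono) auto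
    hence yM: "\<bar>y\<bar> \<le> 3/2 * M" using h by linarith
    have "freqsize p \<le> freqsize (p + q) * freqsize q" using freqsize_add_le[of "p + q" "- q"] by simp
    hence "freqsize p * freqsize q \<le> freqsize (p + q) * freqsize q * freqsize q"
      by (intro mult_right_mono) (auto intro: less_imp_le)
    also have "\<dots> \<le> freqsize (p + q) * (9 * M\<^sup>2)"
      unfolding mult.assoc jy by (intro mult_left_mono sq yM ge1) (auto intro: less_imp_le)
    finally show ?thesis by simp
  next
    case 3
    have "\<bar>y\<^sup>2 - z\<^sup>2 - x\<^sup>2\<bar> \<le> 3 * M" using 3 s1 s2 s3 by linarith
    also have "y\<^sup>2 - z\<^sup>2 - x\<^sup>2 = - 2 * (z * x)" by (simp add: zxy power2_eq_square algebra_simps)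
    finally have h: "\<bar>z\<bar> * \<bar>x\<bar> \<le> 3/2 * M" by (simp add: abs_mult)
    have "1 * \<bar>x\<bar> \<le> \<bar>z\<bar> * \<bar>x\<bar>" using ge1 by (intro mult_right_mono) auto
    hence yM: "\<bar>x\<bar> \<le> 3/2 * M" using h by linarith
    have "freqsize q \<le> freqsize (p + q) * freqsize p" using freqsize_add_le[of "p + q" "- p"] by simp
    hence "freqsize q * freqsize p \<le> freqsize (p + q) * freqsize p * freqsize p"
      by (intro mult_right_mono) (auto intro: less_imp_le)
    also have "\<dots> \<le> freqsize (p + q) * (9 * M\<^sup>2)"
      unfolding mult.assoc jx by (intro mult_left_mono sq yM ge1) (auto intro: less_imp_le)
    finally show ?thesis by (simp add: mult.commute)
  qed
qed

lemma powr_le_1: "1 \<le> x \<Longrightarrow> e \<le> 0 \<Longrightarrow> x powr e \<le> (1::real)"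
  using powr_mono[of e 0 x] by simp

text \<open>If the powers of the spatial frequencies multiply to at most 1, which happens for \<open>s \<ge> 0\<close> and also
  when an input has zero spatial frequency, the first of the three terms alone is enough. Otherwise
  the resonance bound converts these powers into \<open>9 M\<^bsup>2|s|\<^esup>\<close>, where \<open>M\<close> is the largest modulation. The term
  in which the modulation attaining \<open>M\<close> does not appear then dominates. For an input attaining \<open>M\<close> the
  leftover exponent \<open>2|s| - b\<close> is nonpositive, so \<open>M\<close> may be replaced there by the smaller output
  modulation, whose total exponent \<open>2|s| - a - b\<close> is at most \<open>-b\<close>.\<close>
lemma kernel_bound:
  assumes sab: "0 \<le> a" "0 \<le> s \<or> (-1/4 < s \<and> s < 0 \<and> 2 * \<bar>s\<bar> \<le> a)" "1/2 \<le> b"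
    and n: "snd (p + q) \<noteq> 0"
  shows "freqsize (p + q) powr s * modul (p + q) powr (-a)
           * (freqsize p powr (-s) * modul p powr (-b)) * (freqsize q powr (-s) * modul q powr (-b))
         \<le> 9 * (modul p powr (-b) * modul q powr (-b)
               + indicator {p. snd p \<noteq> 0} p * (modul (p + q) powr (-b) * modul q powr (-b))
               + indicator {p. snd p \<noteq> 0} q * (modul (p + q) powr (-b) * modul p powr (-b)))"
proof -
  define A A1 A2 where "A = modul (p + q)" "A1 = modul p" "A2 = modul q"
  define W where "W = freqsize (p + q) powr s * freqsize p powr (-s) * freqsize q powr (-s)"
  have A: "1 \<le> A" "1 \<le> A1" "1 \<le> A2" by (simp_all add: A_A1_A2_def modul_ge_1)
  have W0: "0 \<le> W" by (simp add: W_def)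
  have lhs: "freqsize (p + q) powr s * modul (p + q) powr (-a)
           * (freqsize p powr (-s) * modul p powr (-b)) * (freqsize q powr (-s) * modul q powr (-b))
      = W * (A powr (-a) * A1 powr (-b) * A2 powr (-b))" by (simp add: W_def A_A1_A2_def mult_ac)
  have easy: ?thesis if "W \<le> 1"
  proof -
    have "W * (A powr (-a) * A1 powr (-b) * A2 powr (-b)) \<le> 1 * (1 * A1 powr (-b) * A2 powr (-b))"
      using that sab(1) A by (intro mult_mono powr_le_1 mult_nonneg_nonneg) (auto simp: W0)
    also have "\<dots> \<le> 9 * (A1 powr (-b) * A2 powr (-b) + 
        indicator {p. snd p \<noteq> 0} p * (A powr (-b) * A2 powr (-b))
               + indicator {p. snd p \<noteq> 0} q * (A powr (-b) * A1 powr (-b)))"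
      by (simp add: algebra_simps add_increasing2)
    finally show ?thesis unfolding lhs by (simp add: A_A1_A2_def)
  qed
  show ?thesis
  proof (cases "0 \<le> s")
    case True
    have "freqsize (p + q) powr s \<le> (freqsize p * freqsize q) powr s"
      by (intro powr_mono2 True freqsize_add_le) (auto intro: less_imp_le)
    hence "W \<le> (freqsize p * freqsize q) powr s * freqsize p powr (-s) * freqsize q powr (-s)"
      unfolding W_def by (intro mult_right_mono) auto
    also have "\<dots> = 1" by (simp add: powr_mult powr_minus less_imp_le less_imp_neq[symmetric] field_simps)
    finally show ?thesis by (rule easy)
  next
    case False
    define r where "r = - s"
    have r: "0 < r" "r < 1/4" "2 * r \<le> a" "2 * r \<le> b" using sab False by (auto simp: r_def)
    show ?thesis
    proof (cases "snd p = 0 \<or> snd q = 0")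
      case True
      then have "W = 1"
        by (auto simp: W_def freqsize_def jbr_def powr_minus field_simps)
      then show ?thesis by (intro easy) simp
    next
      case nz: False
      have Wle: "W \<le> 9 * M powr (2 * r)" if "A \<le> M" "A1 \<le> M" "A2 \<le> M" for M
      proof -
        have M1: "1 \<le> M" using A that by linarith
        have "freqsize p * freqsize q \<le> 9 * (freqsize (p + q) * M\<^sup>2)"
          using nz n that by (intro resonance) (auto simp: A_A1_A2_def)
        hence "freqsize p * freqsize q / freqsize (p + q) \<le> 9 * M\<^sup>2"
          by (simp add: field_simps)
        hence "(freqsize p * freqsize q / freqsize (p + q)) powr r \<le> (9 * M\<^sup>2) powr r"
          using r by (intro powr_mono2) (auto intro: less_imp_le)
        also have "(freqsize p * freqsize q / freqsize (p + q)) powr r = W"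
          by (simp add: W_def r_def powr_mult powr_divide less_imp_le powr_minus field_simps)
        also have "(9 * M\<^sup>2) powr r = 9 powr r * M powr (2 * r)"
        proof -
          have "M\<^sup>2 powr r = M powr (2 * r)" using M1 powr_powr[of M 2 r] by (simp add: powr_numeral)
          thus ?thesis by (simp add: powr_mult)
        qed
        also have "\<dots> \<le> 9 powr 1 * M powr (2 * r)"
          using r by (intro mult_right_mono powr_mono) auto
        finally show ?thesis by simp
      qed
      have ind: "indicator {p. snd p \<noteq> 0} p = (1::real)" "indicator {p. snd p \<noteq> 0} q = (1::real)"
        using nz by auto
      have ap: "x powr e * x powr f = x powr (e + f)" for x e f :: real by (simp add: powr_add)
      consider "A1 \<le> A" "A2 \<le> A" | "A \<le> A1" "A2 \<le> A1" | "A \<le> A2" "A1 \<le> A2" by linarith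
      then have "W * (A powr (-a) * A1 powr (-b) * A2 powr (-b)) \<le> 
        9 * (A1 powr (-b) * A2 powr (-b) + A powr (-b) * A2 powr (-b) + A powr (-b) * A1 powr (-b))"
      proof cases
        case 1
        have "W * (A powr (-a) * A1 powr (-b) * A2 powr (-b))
            \<le> (9 * A powr (2 * r)) * (A powr (-a) * A1 powr (-b) * A2 powr (-b))"
          using 1 by (intro mult_right_mono Wle) auto
        also have "\<dots> = 9 * (A powr (2 * r - a) * (A1 powr (-b) * A2 powr (-b)))"
          using ap[of A "2 * r" "-a"] by (simp add: mult_ac)
        also have "\<dots> \<le> 9 * (1 * (A1 powr (-b) * A2 powr (-b)))"
          using r A by (intro mult_left_mono mult_right_mono powr_le_1) auto
        also have "\<dots> \<le> 9 * (A1 powr (-b) * A2 powr (-b) + A powr (-b) * A2 powr (-b) + A powr (-b) * A1 powr (-b))"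
          by (simp add: add_increasing2)
        finally show ?thesis .
      next
        case 2
        have "W * (A powr (-a) * A1 powr (-b) * A2 powr (-b))
            \<le> (9 * A1 powr (2 * r)) * (A powr (-a) * A1 powr (-b) * A2 powr (-b))"
          using 2 by (intro mult_right_mono Wle) auto
        also have "\<dots> = 9 * (A powr (-a) * A1 powr (2 * r - b) * A2 powr (-b))"
          using ap[of A1 "2 * r" "-b"] by (simp add: mult_ac)
        also have "\<dots> \<le> 9 * (A powr (-a) * A powr (2 * r - b) * A2 powr (-b))"
          using r A 2 by (intro mult_left_mono mult_right_mono powr_mono2') auto
        also have "\<dots> = 9 * (A powr (- a + (2 * r - b)) * A2 powr (-b))"
          using ap[of A "-a" "2 * r - b"] by (simp add: mult_ac)
        also have "\<dots> \<le> 9 * (A powr (-b) * A2 powr (-b))"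
          using r A by (intro mult_left_mono mult_right_mono powr_mono) auto
        also have "\<dots> \<le> 9 * (A1 powr (-b) * A2 powr (-b) + A powr (-b) * A2 powr (-b) + A powr (-b) * A1 powr (-b))"
          by (simp add: add_increasing2)
        finally show ?thesis .
      next
        case 3
        have "W * (A powr (-a) * A1 powr (-b) * A2 powr (-b))
            \<le> (9 * A2 powr (2 * r)) * (A powr (-a) * A1 powr (-b) * A2 powr (-b))"
          using 3 by (intro mult_right_mono Wle) auto
        also have "\<dots> = 9 * (A powr (-a) * A2 powr (2 * r - b) * A1 powr (-b))"
          using ap[of A2 "2 * r" "-b"] by (simp add: mult_ac)
        also have "\<dots> \<le> 9 * (A powr (-a) * A powr (2 * r - b) * A1 powr (-b))"
          using r A 3 by (intro mult_left_mono mult_right_mono powr_mono2') auto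
        also have "\<dots> = 9 * (A powr (- a + (2 * r - b)) * A1 powr (-b))"
          using ap[of A "-a" "2 * r - b"] by (simp add: mult_ac)
        also have "\<dots> \<le> 9 * (A powr (-b) * A1 powr (-b))"
          using r A by (intro mult_left_mono mult_right_mono powr_mono) auto
        also have "\<dots> \<le> 9 * (A1 powr (-b) * A2 powr (-b) + A powr (-b) * A2 powr (-b) + A powr (-b) * A1 powr (-b))"
          by (simp add: add_increasing2)
        finally show ?thesis .
      qed
      then show ?thesis unfolding lhs ind by (simp add: A_A1_A2_def)
    qed
  qed
qed

section \<open>Cauchy-Schwarz and sums of decaying weights\<close>

lemma ennreal_power2_measurable [measurable (raw)]:
  fixes f :: "'a \<Rightarrow> ennreal"
  shows "f \<in> borel_measurable M \<Longrightarrow> (\<lambda>x. (f x)\<^sup>2) \<in> borel_measurable M"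
  unfolding power2_eq_square by measurable

lemma nn_integral_Cauchy_Schwarz:
  fixes f g :: "'a \<Rightarrow> ennreal"
  assumes [measurable]: "f \<in> borel_measurable M" "g \<in> borel_measurable M"
  shows "(\<integral>\<^sup>+x. f x * g x \<partial>M)\<^sup>2 \<le> (\<integral>\<^sup>+x. (f x)\<^sup>2 \<partial>M) * (\<integral>\<^sup>+x. (g x)\<^sup>2 \<partial>M)"
proof -
  define A B where "A = (\<integral>\<^sup>+x. (f x)\<^sup>2 \<partial>M)" "B = (\<integral>\<^sup>+x. (g x)\<^sup>2 \<partial>M)"
  consider "A = 0 \<or> B = 0" | "A \<noteq> 0" "B \<noteq> 0" "A = top \<or> B = top" | x y where "A = ennreal x" "0 < x" "B = ennreal y" "0 < y"
    by (cases A; cases B) (force simp: ennreal_eq_0_iff top_unique)+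
  then show ?thesis
  proof cases
    case 1
    have "AE x in M. f x * g x = 0"
    proof (cases "A = 0")
      case True
      then have "AE x in M. (f x)\<^sup>2 = 0" unfolding A_B_def by (subst (asm) nn_integral_0_iff_AE) auto
      then show ?thesis by eventually_elim simp
    next
      case False
      with 1 have "AE x in M. (g x)\<^sup>2 = 0" unfolding A_B_def by (subst (asm) (2) nn_integral_0_iff_AE) auto
      then show ?thesis by eventually_elim simp
    qed
    then have "(\<integral>\<^sup>+x. f x * g x \<partial>M) = 0" by (subst nn_integral_0_iff_AE) auto
    then show ?thesis by simp
  next
    case 2
    then have "A * B = top" by (auto simp: ennreal_mult_eq_top_iff)
    then show ?thesis by (simp add: A_B_def)
  next
    case 3
    \<comment> \<open>the weight in the elementary inequality that balances the two integrals\<close>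
    define c where "c = sqrt (y / x)"
    have c: "0 < c" using 3 by (simp add: c_def)
    have pw: "u * v \<le> ennreal (c / 2) * u\<^sup>2 + ennreal (1 / (2 * c)) * v\<^sup>2" for u v :: ennreal
    proof (cases "u = top \<or> v = top")
      case True
      then show ?thesis using c by (auto simp: ennreal_mult_top power2_eq_square top_unique)
    next
      case False
      then obtain r t where uv: "u = ennreal r" "0 \<le> r" "v = ennreal t" "0 \<le> t"
        by (cases u; cases v) auto
      have "0 \<le> (c * r - t)\<^sup>2 / (2 * c)" using c by simp
      also have "\<dots> = c / 2 * r\<^sup>2 + 1 / (2 * c) * t\<^sup>2 - r * t"
        using c by (simp add: power2_eq_square field_simps)
      finally have "r * t \<le> c / 2 * r\<^sup>2 + 1 / (2 * c) * t\<^sup>2" by simp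
      then have "ennreal (r * t) \<le> ennreal (c / 2 * r\<^sup>2 + 1 / (2 * c) * t\<^sup>2)" by (rule ennreal_leI)
      also have "\<dots> = ennreal (c / 2) * u\<^sup>2 + ennreal (1 / (2 * c)) * v\<^sup>2"
        using uv c by (subst ennreal_plus) (auto simp: ennreal_mult[symmetric] ennreal_power)
      finally show ?thesis using uv by (simp add: ennreal_mult)
    qed
    have "(\<integral>\<^sup>+x. f x * g x \<partial>M) \<le> (\<integral>\<^sup>+x. ennreal (c / 2) * (f x)\<^sup>2 + ennreal (1 / (2 * c)) * (g x)\<^sup>2 \<partial>M)"
      by (intro nn_integral_mono pw)
    also have "\<dots> = ennreal (c / 2) * A + ennreal (1 / (2 * c)) * B"
      unfolding A_B_def by (subst nn_integral_add) (auto simp: nn_integral_cmult)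
    also have "\<dots> = ennreal (c / 2 * x + 1 / (2 * c) * y)"
      using 3 c by (subst ennreal_plus) (auto simp: ennreal_mult[symmetric])
    also have "c / 2 * x + 1 / (2 * c) * y = sqrt (x * y)"
    proof -
      have "sqrt y * sqrt y = y" "sqrt x * sqrt x = x" using 3 by auto
      moreover have "sqrt x > 0" "sqrt y > 0" using 3 by auto
      ultimately have "c * x = sqrt x * sqrt y" "y / c = sqrt x * sqrt y"
        by (auto simp: c_def real_sqrt_divide field_simps)
      then show ?thesis by (simp add: real_sqrt_mult)
    qed
    finally have "(\<integral>\<^sup>+x. f x * g x \<partial>M)\<^sup>2 \<le> (ennreal (sqrt (x * y)))\<^sup>2"
      by (intro power_mono) auto
    also have "\<dots> = A * B" using 3 by (simp add: ennreal_power ennreal_mult)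
    finally show ?thesis by (simp add: A_B_def)
  qed
qed

text \<open>Valued in the extended nonnegative reals because all sums and integrals of it are taken there.\<close>
definition decay :: "real \<Rightarrow> real \<Rightarrow> ennreal" where
  "decay \<beta> y = ennreal (jbr y powr (- \<beta>))"

definition decay_mass :: "real \<Rightarrow> ennreal" where
  "decay_mass \<beta> = (\<integral>\<^sup>+t. decay \<beta> t \<partial>lborel)"

lemma jbr_measurable [measurable]: "jbr \<in> borel_measurable borel"
  unfolding jbr_def[abs_def] by measurable

lemma decay_measurable [measurable]: "decay \<beta> \<in> borel_measurable borel"
  unfolding decay_def[abs_def] by measurable

lemma decay_minus [simp]: "decay \<beta> (- y) = decay \<beta> y"
  by (simp add: decay_def)

lemma decay_le:
  assumes "0 \<le> \<beta>" "0 < c" "jbr x \<le> c * jbr y"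
  shows "decay \<beta> y \<le> ennreal (c powr \<beta>) * decay \<beta> x"
proof -
  have "jbr x powr \<beta> \<le> c powr \<beta> * jbr y powr \<beta>"
    using powr_mono2[of \<beta> "jbr x" "c * jbr y"] assms by (simp add: powr_mult less_imp_le)
  then have "jbr y powr (- \<beta>) \<le> c powr \<beta> * jbr x powr (- \<beta>)"
    by (simp add: powr_minus field_simps)
  then show ?thesis
    by (simp add: decay_def ennreal_mult[symmetric] ennreal_leI)
qed

lemma decay_mass_finite:
  assumes "1 < \<beta>"
  shows "decay_mass \<beta> < \<infinity>"
proof -
  \<comment> \<open>the half-line has an explicit primitive, and the other half follows by reflection\<close>
  have half: "(\<integral>\<^sup>+t. ennreal ((1 + t) powr (- \<beta>)) * indicator {0..} t \<partial>lborel)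
      = ennreal (0 - (- ((1 + 0) powr (1 - \<beta>) / (\<beta> - 1))))"
  proof (rule nn_integral_FTC_atLeast)
    show "(\<lambda>t. (1 + t) powr - \<beta>) \<in> borel_measurable borel" by measurable
    show "((\<lambda>t. - ((1 + t) powr (1 - \<beta>) / (\<beta> - 1))) has_real_derivative (1 + t) powr - \<beta>) (at t)"
      if "0 \<le> t" for t
    proof -
      have "((\<lambda>t. (1 + t) powr (1 - \<beta>)) has_real_derivative (1 - \<beta>) * (1 + t) powr (- \<beta>)) (at t)"
        using that by (auto intro!: derivative_eq_intros)
      then have "((\<lambda>t. (1 + t) powr (1 - \<beta>) / (1 - \<beta>)) has_real_derivative
          (1 - \<beta>) * (1 + t) powr (- \<beta>) / (1 - \<beta>)) (at t)"
        by (rule DERIV_cdivide)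
      moreover have "(\<lambda>t. - ((1 + t) powr (1 - \<beta>) / (\<beta> - 1))) = (\<lambda>t. (1 + t) powr (1 - \<beta>) / (1 - \<beta>))"
        using assms by (auto simp: fun_eq_iff field_simps)
      ultimately show ?thesis using assms by simp
    qed
    show "0 \<le> (1 + t) powr - \<beta>" if "0 \<le> t" for t using that by simp
    have "((\<lambda>t::real. (1 + t) powr (1 - \<beta>)) \<longlongrightarrow> 0) at_top"
      using assms by (intro tendsto_neg_powr filterlim_tendsto_add_at_top[OF tendsto_const] filterlim_ident) auto
    from tendsto_minus[OF tendsto_divide[OF this tendsto_const[of "\<beta> - 1"]]] assms
    show "((\<lambda>t. - ((1 + t) powr (1 - \<beta>) / (\<beta> - 1))) \<longlongrightarrow> 0) at_top"
      by simp
  qed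
  have "decay_mass \<beta> \<le> (\<integral>\<^sup>+t. ennreal ((1 + t) powr (- \<beta>)) * indicator {0..} t
      + ennreal ((1 + (0 + -1 * t)) powr (- \<beta>)) * indicator {0..} (0 + -1 * t) \<partial>lborel)"
    unfolding decay_mass_def
    by (intro nn_integral_mono) (auto simp: decay_def jbr_def indicator_def)
  also have "\<dots> = (\<integral>\<^sup>+t. ennreal ((1 + t) powr (- \<beta>)) * indicator {0..} t \<partial>lborel)
     + (\<integral>\<^sup>+t. ennreal ((1 + (0 + -1 * t)) powr (- \<beta>)) * indicator {0..} (0 + -1 * t) \<partial>lborel)"
    by (intro nn_integral_add) auto
  also have "(\<integral>\<^sup>+t. ennreal ((1 + (0 + -1 * t)) powr (- \<beta>)) * indicator {0..} (0 + -1 * t) \<partial>lborel)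
     = (\<integral>\<^sup>+t. ennreal ((1 + t) powr (- \<beta>)) * indicator {0..} t \<partial>lborel)"
    using nn_integral_real_affine[of "\<lambda>t. ennreal ((1 + t) powr (- \<beta>)) * indicator {0..} t" "-1" 0]
    by simp
  finally show ?thesis unfolding half by (rule le_less_trans) (simp add: less_top[symmetric])
qed

lemma decay_mass_shift: "(\<integral>\<^sup>+t. decay \<beta> (t - c) \<partial>lborel) = decay_mass \<beta>"
  using nn_integral_real_affine[of "decay \<beta>" 1 "-c"] by (simp add: decay_mass_def)

lemma decay_mass_reflect: "(\<integral>\<^sup>+t. decay \<beta> (c - t) \<partial>lborel) = decay_mass \<beta>"
  using nn_integral_real_affine[of "decay \<beta>" "-1" c] by (simp add: decay_mass_def)

lemma sigma_finite_count_int: "sigma_finite_measure (count_space (UNIV :: int set))"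
  by (rule sigma_finite_measure_count_space_countable) auto

interpretation real_int: pair_sigma_finite "lborel :: real measure" "count_space (UNIV :: int set)"
  by (intro pair_sigma_finite.intro sigma_finite_count_int lborel.sigma_finite_measure_axioms)

text \<open>Uniformity in the centre \<open>c\<close> comes from comparing each term with the integral of the same weight
  over \<open>[k, k + 1)\<close>, where the weight varies by a factor 2 at most in its base; the integral over the
  line is invariant under translation.\<close>
lemma sum_decay_le:
  assumes "0 \<le> \<beta>"
  shows "(\<integral>\<^sup>+k. decay \<beta> (of_int k - c) \<partial>count_space UNIV) \<le> ennreal (2 powr \<beta>) * decay_mass \<beta>"
proof -
  have "decay \<beta> (of_int k - c) \<le> (\<integral>\<^sup>+t. ennreal (2 powr \<beta>) * decay \<beta> (t - c) * indicator {of_int k..<of_int k + 1} t \<partial>lborel)"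
    for k :: int
  proof -
    have "decay \<beta> (of_int k - c) = (\<integral>\<^sup>+t. decay \<beta> (of_int k - c) * indicator {of_int k..<of_int k + 1 :: real} t \<partial>lborel)"
      by (simp add: nn_integral_cmult_indicator)
    also have "\<dots> \<le> (\<integral>\<^sup>+t. ennreal (2 powr \<beta>) * decay \<beta> (t - c) * indicator {of_int k..<of_int k + 1} t \<partial>lborel)"
    proof (intro nn_integral_mono)
      fix t :: real
      show "decay \<beta> (of_int k - c) * indicator {of_int k..<of_int k + 1} t
        \<le> ennreal (2 powr \<beta>) * decay \<beta> (t - c) * indicator {of_int k..<of_int k + 1} t"
      proof (cases "t \<in> {of_int k..<of_int k + 1}")
        case True
        then have "of_int k \<le> t" "t < of_int k + 1" by auto
        then have "jbr (t - of_int k) \<le> 2" by (simp add: jbr_def)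
        then have "jbr (t - of_int k) * jbr (of_int k - c) \<le> 2 * jbr (of_int k - c)"
          by (rule mult_right_mono) simp
        moreover have "jbr (t - c) \<le> jbr (t - of_int k) * jbr (of_int k - c)"
          using jbr_add_le[of "t - of_int k" "of_int k - c"] by simp
        ultimately have "jbr (t - c) \<le> 2 * jbr (of_int k - c)" by (rule order_trans[rotated])
        then show ?thesis using True decay_le[OF assms, of 2] by simp
      qed simp
    qed
    finally show ?thesis .
  qed
  then have "(\<integral>\<^sup>+k. decay \<beta> (of_int k - c) \<partial>count_space UNIV) \<le>
     (\<integral>\<^sup>+k. (\<integral>\<^sup>+t. ennreal (2 powr \<beta>) * decay \<beta> (t - c) * indicator {of_int k..<of_int k + 1} t \<partial>lborel) \<partial>count_space UNIV)"
    by (intro nn_integral_mono)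
  also have "\<dots> = (\<integral>\<^sup>+t. (\<integral>\<^sup>+k. ennreal (2 powr \<beta>) * decay \<beta> (t - c) * indicator {of_int k..<of_int k + 1} t \<partial>count_space UNIV) \<partial>lborel)"
    by (intro real_int.Fubini') measurable
  also have "\<dots> = (\<integral>\<^sup>+t. ennreal (2 powr \<beta>) * decay \<beta> (t - c) \<partial>lborel)"
  proof (intro nn_integral_cong)
    fix t :: real
    have "indicator {of_int k..<of_int k + 1} t = (indicator {\<lfloor>t\<rfloor>} k :: ennreal)" for k :: int
      by (auto simp: indicator_def) linarith+
    then show "(\<integral>\<^sup>+k. ennreal (2 powr \<beta>) * decay \<beta> (t - c) * indicator {of_int k..<of_int k + 1} t \<partial>count_space UNIV)
       = ennreal (2 powr \<beta>) * decay \<beta> (t - c)"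
      by (simp add: nn_integral_cmult_indicator)
  qed
  also have "\<dots> = ennreal (2 powr \<beta>) * decay_mass \<beta>"
    by (simp add: nn_integral_cmult decay_mass_shift)
  finally show ?thesis .
qed

section \<open>Interaction of two dispersive weights\<close>

text \<open>With \<open>w = -2z\<^sup>2\<close>, the quadratic factorizes as \<open>2(|y| - z)(|y| + z)\<close>, which is at least \<open>2(|y| - z)\<^sup>2\<close> in
  absolute value; for \<open>w \<ge> 0\<close> the same lower bound holds with \<open>z = 0\<close>. The values are thus as spread out as
  those of two shifted copies of the integers.\<close>
lemma sum_decay_quadratic_le:
  assumes "0 \<le> \<beta>"
  shows "(\<integral>\<^sup>+k. decay \<beta> (2 * (of_int k - h)\<^sup>2 + w) \<partial>count_space UNIV)
     \<le> 2 * ennreal (4 powr \<beta>) * decay_mass \<beta>"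
proof -
  define z where "z = sqrt (max 0 (- w / 2))"
  have z0: "0 \<le> z" by (simp add: z_def)
  have jb: "jbr (\<bar>y\<bar> - z) \<le> 2 * jbr (2 * y\<^sup>2 + w)" for y
  proof -
    have "2 * (\<bar>y\<bar> - z)\<^sup>2 \<le> \<bar>2 * y\<^sup>2 + w\<bar>"
    proof (cases "0 \<le> w")
      case True
      then show ?thesis by (simp add: z_def max_def)
    next
      case False
      then have "w = - 2 * z\<^sup>2" by (simp add: z_def max_def)
      then have "\<bar>2 * y\<^sup>2 + w\<bar> = 2 * \<bar>(\<bar>y\<bar> - z) * (\<bar>y\<bar> + z)\<bar>"
        by (simp add: power2_eq_square algebra_simps abs_if)
      also have "\<dots> = 2 * (\<bar>\<bar>y\<bar> - z\<bar> * \<bar>\<bar>y\<bar> + z\<bar>)" by (simp add: abs_mult)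
      also have "\<dots> \<ge> 2 * (\<bar>\<bar>y\<bar> - z\<bar> * \<bar>\<bar>y\<bar> - z\<bar>)"
        using z0 by (intro mult_left_mono) auto
      finally show ?thesis by (simp add: power2_eq_square)
    qed
    moreover have "\<bar>d\<bar> \<le> 1 + 4 * d\<^sup>2" for d :: real
    proof -
      have "0 \<le> (2 * \<bar>d\<bar> - 1)\<^sup>2" by simp
      then show ?thesis by (simp add: power2_diff power_mult_distrib)
    qed
    from this[of "\<bar>y\<bar> - z"] calculation
    show ?thesis unfolding jbr_def[of "\<bar>y\<bar> - z"] jbr_def[of "2 * y\<^sup>2 + w"] by simp
  qed
  have pw: "decay \<beta> (2 * y\<^sup>2 + w) \<le> ennreal (2 powr \<beta>) * (decay \<beta> (y - z) + decay \<beta> (y + z))" for y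
  proof -
    have "decay \<beta> (2 * y\<^sup>2 + w) \<le> ennreal (2 powr \<beta>) * decay \<beta> (\<bar>y\<bar> - z)"
      by (rule decay_le[OF assms _ jb]) simp
    also have "decay \<beta> (\<bar>y\<bar> - z) \<le> decay \<beta> (y - z) + decay \<beta> (y + z)"
    proof (cases "0 \<le> y")
      case False
      then have "decay \<beta> (\<bar>y\<bar> - z) = decay \<beta> (- (y + z))" by simp
      then show ?thesis by (simp only: decay_minus) simp
    qed simp
    finally show ?thesis by (simp add: mult_left_mono)
  qed
  have "(\<integral>\<^sup>+k. decay \<beta> (2 * (of_int k - h)\<^sup>2 + w) \<partial>count_space UNIV)
     \<le> (\<integral>\<^sup>+k. ennreal (2 powr \<beta>) * (decay \<beta> (of_int k - (h + z)) + decay \<beta> (of_int k - (h - z))) \<partial>count_space UNIV)"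
  proof (intro nn_integral_mono)
    fix k :: int
    show "decay \<beta> (2 * (of_int k - h)\<^sup>2 + w)
        \<le> ennreal (2 powr \<beta>) * (decay \<beta> (of_int k - (h + z)) + decay \<beta> (of_int k - (h - z)))"
      using pw[of "of_int k - h"] by (simp only: diff_diff_eq diff_diff_eq2 diff_add_eq)
  qed
  also have "\<dots> = ennreal (2 powr \<beta>) * ((\<integral>\<^sup>+k. decay \<beta> (of_int k - (h + z)) \<partial>count_space UNIV)
        + (\<integral>\<^sup>+k. decay \<beta> (of_int k - (h - z)) \<partial>count_space UNIV))"
    by (simp add: nn_integral_cmult nn_integral_add)
  also have "\<dots> \<le> ennreal (2 powr \<beta>) * (ennreal (2 powr \<beta>) * decay_mass \<beta> + ennreal (2 powr \<beta>) * decay_mass \<beta>)"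
    by (intro mult_left_mono add_mono sum_decay_le assms) auto
  also have "\<dots> = 2 * (ennreal (2 powr \<beta> * 2 powr \<beta>) * decay_mass \<beta>)"
    by (simp add: ennreal_mult mult_ac flip: mult_2)
  also have "(2::real) powr \<beta> * 2 powr \<beta> = 4 powr \<beta>" by (simp flip: powr_mult)
  finally show ?thesis by (simp add: mult.assoc)
qed

text \<open>An affine function of slope \<open>2n\<close> spreads the integers at least as much as a translation does, as long as \<open>n\<close> is nonzero.\<close>
lemma sum_decay_linear_le:
  fixes n :: int
  assumes "0 \<le> \<beta>" "n \<noteq> 0"
  shows "(\<integral>\<^sup>+k. decay \<beta> (w + 2 * of_int n * of_int k) \<partial>count_space UNIV) \<le> ennreal (2 powr \<beta>) * decay_mass \<beta>"
proof -
  define c where "c = - w / (2 * of_int n)"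
  have "decay \<beta> (w + 2 * of_int n * of_int k) \<le> decay \<beta> (of_int k - c)" for k :: int
  proof -
    have "w + 2 * of_int n * of_int k = 2 * of_int n * (of_int k - c)"
      using assms by (simp add: c_def field_simps)
    then have "\<bar>w + 2 * of_int n * of_int k\<bar> = 2 * \<bar>of_int n\<bar> * \<bar>of_int k - c\<bar>" by (simp add: abs_mult)
    moreover have "1 * \<bar>of_int k - c\<bar> \<le> (2 * \<bar>of_int n\<bar>) * \<bar>of_int k - c\<bar>"
      using assms by (intro mult_right_mono) auto
    ultimately have "jbr (of_int k - c) \<le> 1 * jbr (w + 2 * of_int n * of_int k)"
      by (simp add: jbr_def)
    from decay_le[OF assms(1) _ this] show ?thesis by simp
  qed
  then have "(\<integral>\<^sup>+k. decay \<beta> (w + 2 * of_int n * of_int k) \<partial>count_space UNIV)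
      \<le> (\<integral>\<^sup>+k. decay \<beta> (of_int k - c) \<partial>count_space UNIV)" by (intro nn_integral_mono)
  also have "\<dots> \<le> ennreal (2 powr \<beta>) * decay_mass \<beta>" by (rule sum_decay_le[OF assms(1)])
  finally show ?thesis .
qed

text \<open>One of the two arguments is at least half of \<open>y - x\<close> in absolute value; the corresponding factor leaves
  the integral and the other one is integrated.\<close>
lemma decay_convolution_le:
  assumes "0 \<le> \<beta>"
  shows "(\<integral>\<^sup>+t. decay \<beta> (t - x) * decay \<beta> (y - t) \<partial>lborel)
     \<le> 2 * ennreal (2 powr \<beta>) * decay_mass \<beta> * decay \<beta> (y - x)"
proof -
  have "decay \<beta> (t - x) * decay \<beta> (y - t)
     \<le> ennreal (2 powr \<beta>) * decay \<beta> (y - x) * (decay \<beta> (t - x) + decay \<beta> (y - t))" for t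
  proof (cases "\<bar>t - x\<bar> \<le> \<bar>y - t\<bar>")
    case True
    with abs_triangle_ineq[of "y - t" "t - x"]
    have "jbr (y - x) \<le> 2 * jbr (y - t)" by (simp add: jbr_def)
    then have "decay \<beta> (y - t) \<le> ennreal (2 powr \<beta>) * decay \<beta> (y - x)"
      by (intro decay_le assms) auto
    then have "decay \<beta> (y - t) * decay \<beta> (t - x)
       \<le> (ennreal (2 powr \<beta>) * decay \<beta> (y - x)) * (decay \<beta> (t - x) + decay \<beta> (y - t))"
      by (intro mult_mono) auto
    then show ?thesis by (simp add: mult.commute)
  next
    case False
    with abs_triangle_ineq[of "y - t" "t - x"]
    have "jbr (y - x) \<le> 2 * jbr (t - x)" by (simp add: jbr_def)
    then have "decay \<beta> (t - x) \<le> ennreal (2 powr \<beta>) * decay \<beta> (y - x)"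
      by (intro decay_le assms) auto
    then show ?thesis by (intro mult_mono) auto
  qed
  then have "(\<integral>\<^sup>+t. decay \<beta> (t - x) * decay \<beta> (y - t) \<partial>lborel)
     \<le> (\<integral>\<^sup>+t. ennreal (2 powr \<beta>) * decay \<beta> (y - x) * (decay \<beta> (t - x) + decay \<beta> (y - t)) \<partial>lborel)"
    by (intro nn_integral_mono)
  also have "\<dots> = ennreal (2 powr \<beta>) * decay \<beta> (y - x) * (decay_mass \<beta> + decay_mass \<beta>)"
    by (simp add: nn_integral_cmult nn_integral_add decay_mass_shift decay_mass_reflect)
  finally show ?thesis by (simp add: mult_ac flip: mult_2)
qed


text \<open>The sign of \<open>t\<close> decides which of the two parabolas \<open>t = \<plusminus>n\<^sup>2\<close> is the nearer one; keeping both removes the dependence on that sign.\<close>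
lemma decay_modulation_le:
  assumes "0 \<le> \<beta>"
  shows "decay \<beta> (\<bar>t\<bar> - gam n)
     \<le> ennreal ((3/2) powr \<beta>) * (\<Sum>e\<in>{1, -1}. decay \<beta> (t - e * (of_int n)\<^sup>2))"
proof -
  define e :: real where "e = (if 0 \<le> t then 1 else -1)"
  have "jbr (t - e * (of_int n)\<^sup>2) = jbr (\<bar>t\<bar> - (of_int n)\<^sup>2)"
    by (auto simp: e_def jbr_def)
  also have "\<dots> \<le> 3/2 * jbr (\<bar>t\<bar> - gam n)"
    using gam_bounds[of n] by (simp add: jbr_def abs_if)
  finally have "decay \<beta> (\<bar>t\<bar> - gam n) \<le> ennreal ((3/2) powr \<beta>) * decay \<beta> (t - e * (of_int n)\<^sup>2)"
    by (intro decay_le assms) auto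
  also have "\<dots> \<le> ennreal ((3/2) powr \<beta>) * (\<Sum>e\<in>{1, -1}. decay \<beta> (t - e * (of_int n)\<^sup>2))"
    by (intro mult_left_mono member_le_sum) (auto simp: e_def)
  finally show ?thesis .
qed

lemma nn_integral_freq:
  assumes "f \<in> borel_measurable freq"
  shows "(\<integral>\<^sup>+p. f p \<partial>freq) = (\<integral>\<^sup>+k. \<integral>\<^sup>+t. f (t, k) \<partial>lborel \<partial>count_space UNIV)"
  using assms unfolding freq_def by (rule real_int.nn_integral_snd[symmetric])

lemma sets_freq [measurable_cong]: "sets freq = sets (borel \<Otimes>\<^sub>M count_space UNIV)"
  unfolding freq_def by (intro sets_pair_measure_cong) auto

lemma space_freq [simp]: "space freq = UNIV"
  by (simp add: freq_def space_pair_measure)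

text \<open>The spatial frequency ranges over a countable discrete set, so measurability may be checked one frequency at a time.\<close>
lemma freq_measurable_split:
  assumes "\<And>k. (\<lambda>t. f (t, k)) \<in> borel \<rightarrow>\<^sub>M N"
  shows "f \<in> freq \<rightarrow>\<^sub>M N"
proof -
  have "(\<lambda>p. (\<lambda>k p. f (fst p, k)) (snd p) p) \<in> freq \<rightarrow>\<^sub>M N"
  proof (rule measurable_compose_countable)
    show "(\<lambda>p. f (fst p, k)) \<in> freq \<rightarrow>\<^sub>M N" for k
      using assms[of k] by (rule measurable_compose[rotated]) (simp add: measurable_fst' measurable_cong_sets[OF sets_freq refl])
    show "snd \<in> freq \<rightarrow>\<^sub>M count_space UNIV"
      by (simp add: measurable_cong_sets[OF sets_freq refl])
  qed
  then show ?thesis by simp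
qed

lemma modul_measurable [measurable]: "modul \<in> borel_measurable freq"
  unfolding modul_def[abs_def] by (rule freq_measurable_split) simp

lemma freqsize_measurable [measurable]: "freqsize \<in> borel_measurable freq"
  unfolding freqsize_def[abs_def] by (rule freq_measurable_split) simp

lemma decay_sign: "e \<in> {1, -1} \<Longrightarrow> decay \<beta> (e * y) = decay \<beta> y"
  by (auto simp: decay_def jbr_def)

text \<open>The time integral is a convolution of decaying weights and leaves \<open>\<tau> - e k\<^sup>2 - e' (n - k)\<^sup>2\<close>. For equal signs this
  is quadratic in \<open>k\<close> after completing the square; for opposite signs the squares cancel and an affine function of
  slope \<open>\<plusminus>2n\<close> remains, which is not constant.\<close>
lemma signed_interaction_le:
  fixes n :: int
  assumes \<beta>: "0 \<le> \<beta>" and n: "n \<noteq> 0" and e: "e \<in> {1, -1}" "e' \<in> {1, -1::real}"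
  shows "(\<integral>\<^sup>+k. \<integral>\<^sup>+t. decay \<beta> (t - e * (of_int k)\<^sup>2) * decay \<beta> (\<tau> - t - e' * (of_int (n - k))\<^sup>2) \<partial>lborel \<partial>count_space UNIV)
    \<le> 2 * ennreal (2 powr \<beta>) * decay_mass \<beta> * (2 * ennreal (4 powr \<beta>) * decay_mass \<beta>)"
proof -
  have "(\<integral>\<^sup>+k. \<integral>\<^sup>+t. decay \<beta> (t - e * (of_int k)\<^sup>2) * decay \<beta> (\<tau> - t - e' * (of_int (n - k))\<^sup>2) \<partial>lborel \<partial>count_space UNIV)
     \<le> (\<integral>\<^sup>+k. 2 * ennreal (2 powr \<beta>) * decay_mass \<beta> * decay \<beta> ((\<tau> - e' * (of_int (n - k))\<^sup>2) - e * (of_int k)\<^sup>2) \<partial>count_space UNIV)"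
  proof (intro nn_integral_mono)
    fix k :: int
    have "\<tau> - t - e' * (of_int (n - k))\<^sup>2 = \<tau> - e' * (of_int (n - k))\<^sup>2 - t" for t by simp
    then show "(\<integral>\<^sup>+t. decay \<beta> (t - e * (of_int k)\<^sup>2) * decay \<beta> (\<tau> - t - e' * (of_int (n - k))\<^sup>2) \<partial>lborel)
        \<le> 2 * ennreal (2 powr \<beta>) * decay_mass \<beta> * decay \<beta> ((\<tau> - e' * (of_int (n - k))\<^sup>2) - e * (of_int k)\<^sup>2)"
      using decay_convolution_le[OF \<beta>] by (simp only:)
  qed
  also have "\<dots> = 2 * ennreal (2 powr \<beta>) * decay_mass \<beta> * (\<integral>\<^sup>+k. decay \<beta> ((\<tau> - e' * (of_int (n - k))\<^sup>2) - e * (of_int k)\<^sup>2) \<partial>count_space UNIV)"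
    by (rule nn_integral_cmult) simp
  also have "\<dots> \<le> 2 * ennreal (2 powr \<beta>) * decay_mass \<beta> * (2 * ennreal (4 powr \<beta>) * decay_mass \<beta>)"
  proof (intro mult_left_mono)
    show "(\<integral>\<^sup>+k. decay \<beta> ((\<tau> - e' * (of_int (n - k))\<^sup>2) - e * (of_int k)\<^sup>2) \<partial>count_space UNIV)
      \<le> 2 * ennreal (4 powr \<beta>) * decay_mass \<beta>"
    proof (cases "e' = e")
      case True
      have "decay \<beta> ((\<tau> - e' * (of_int (n - k))\<^sup>2) - e * (of_int k)\<^sup>2)
        = decay \<beta> (2 * (of_int k - of_int n / 2)\<^sup>2 + ((of_int n)\<^sup>2 / 2 - e * \<tau>))" for k :: int
      proof -
        have "(\<tau> - e' * (of_int (n - k))\<^sup>2) - e * (of_int k)\<^sup>2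
          = (- e) * (2 * (of_int k - of_int n / 2)\<^sup>2 + ((of_int n)\<^sup>2 / 2 - e * \<tau>))"
          using e True by (auto simp: power2_eq_square field_simps)
        then show ?thesis using e decay_sign[of "- e"] by auto
      qed
      then show ?thesis using sum_decay_quadratic_le[OF \<beta>] by simp
    next
      case False
      have "decay \<beta> ((\<tau> - e' * (of_int (n - k))\<^sup>2) - e * (of_int k)\<^sup>2)
        = decay \<beta> ((e * \<tau> + (of_int n)\<^sup>2) + 2 * of_int (- n) * of_int k)" for k :: int
      proof -
        have "(\<tau> - e' * (of_int (n - k))\<^sup>2) - e * (of_int k)\<^sup>2
          = e * ((e * \<tau> + (of_int n)\<^sup>2) + 2 * of_int (- n) * of_int k)"
          using e False by (auto simp: power2_eq_square field_simps)
        then show ?thesis using e by (simp only: decay_sign)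
      qed
      then have "(\<integral>\<^sup>+k. decay \<beta> ((\<tau> - e' * (of_int (n - k))\<^sup>2) - e * (of_int k)\<^sup>2) \<partial>count_space UNIV)
          \<le> ennreal (2 powr \<beta>) * decay_mass \<beta>"
        using sum_decay_linear_le[OF \<beta>, of "- n" "e * \<tau> + (of_int n)\<^sup>2"] n by simp
      also have "\<dots> \<le> 2 * ennreal (4 powr \<beta>) * decay_mass \<beta>"
      proof (rule mult_right_mono)
        have "ennreal (2 powr \<beta>) \<le> 1 * ennreal (4 powr \<beta>)"
          using \<beta> by (auto intro!: ennreal_leI powr_mono2)
        also have "\<dots> \<le> 2 * ennreal (4 powr \<beta>)" by (intro mult_right_mono) auto
        finally show "ennreal (2 powr \<beta>) \<le> 2 * ennreal (4 powr \<beta>)" .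
      qed simp
      finally show ?thesis .
    qed
  qed simp
  finally show ?thesis .
qed

lemma interaction_bounded:
  assumes "1 < \<beta>"
  obtains C where "C < \<infinity>"
    and "\<And>p. snd p \<noteq> 0 \<Longrightarrow> (\<integral>\<^sup>+q. ennreal (modul q powr (-\<beta>)) * ennreal (modul (p - q) powr (-\<beta>)) \<partial>freq) \<le> C"
proof
  define D where "D = 2 * ennreal (2 powr \<beta>) * decay_mass \<beta> * (2 * ennreal (4 powr \<beta>) * decay_mass \<beta>)"
  define c where "c = ennreal ((3/2) powr \<beta>)"
  show "c * c * (4 * D) < \<infinity>"
    using decay_mass_finite[OF assms] by (auto simp: D_def c_def ennreal_mult_less_top)
  fix p :: "real \<times> int" assume "snd p \<noteq> 0"
  then obtain \<tau> n where p: "p = (\<tau>, n)" "n \<noteq> 0" by (cases p) auto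
  have \<beta>: "0 \<le> \<beta>" using assms by simp
  have [simp]: "ennreal (modul (t, k) powr (-\<beta>)) = decay \<beta> (\<bar>t\<bar> - gam k)" for t k
    by (simp add: modul_def decay_def)
  have "(\<integral>\<^sup>+q. ennreal (modul q powr (-\<beta>)) * ennreal (modul (p - q) powr (-\<beta>)) \<partial>freq)
    = (\<integral>\<^sup>+k. \<integral>\<^sup>+t. decay \<beta> (\<bar>t\<bar> - gam k) * decay \<beta> (\<bar>\<tau> - t\<bar> - gam (n - k)) \<partial>lborel \<partial>count_space UNIV)"
    by (subst nn_integral_freq) (auto simp: p intro!: freq_measurable_split)
  also have "\<dots> \<le> (\<integral>\<^sup>+k. \<integral>\<^sup>+t. (c * (\<Sum>e\<in>{1, -1}. decay \<beta> (t - e * (of_int k)\<^sup>2)))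
      * (c * (\<Sum>e'\<in>{1, -1}. decay \<beta> (\<tau> - t - e' * (of_int (n - k))\<^sup>2))) \<partial>lborel \<partial>count_space UNIV)"
    unfolding c_def by (intro nn_integral_mono mult_mono decay_modulation_le \<beta>) auto
  also have "\<dots> = (\<integral>\<^sup>+k. \<integral>\<^sup>+t. c * c * (\<Sum>e\<in>{1, -1}. \<Sum>e'\<in>{1, -1}. decay \<beta> (t - e * (of_int k)\<^sup>2)
      * decay \<beta> (\<tau> - t - e' * (of_int (n - k))\<^sup>2)) \<partial>lborel \<partial>count_space UNIV)"
    by (simp only: sum_product[symmetric] mult_ac)
  also have "\<dots> = c * c * (\<Sum>e\<in>{1, -1}. \<Sum>e'\<in>{1, -1}. \<integral>\<^sup>+k. \<integral>\<^sup>+t. decay \<beta> (t - e * (of_int k)\<^sup>2)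
      * decay \<beta> (\<tau> - t - e' * (of_int (n - k))\<^sup>2) \<partial>lborel \<partial>count_space UNIV)"
    by (simp add: nn_integral_cmult nn_integral_add)
  also have "\<dots> \<le> c * c * (\<Sum>e\<in>{1, -1::real}. \<Sum>e'\<in>{1, -1::real}. D)"
    unfolding D_def by (intro mult_left_mono sum_mono signed_interaction_le \<beta> p) auto
  also have "\<dots> = c * c * (4 * D)" by simp
  finally show "(\<integral>\<^sup>+q. ennreal (modul q powr (-\<beta>)) * ennreal (modul (p - q) powr (-\<beta>)) \<partial>freq) \<le> c * c * (4 * D)" .
qed

section \<open>The bilinear bound in weighted square-integrable spaces\<close>

text \<open>Subtraction of the discrete components is handled by fixing one of them at a time.\<close>
lemma freq_minus_measurable [measurable]: "(\<lambda>x. fst x - snd x) \<in> freq \<Otimes>\<^sub>M freq \<rightarrow>\<^sub>M freq"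
proof -
  have m: "snd \<in> freq \<rightarrow>\<^sub>M count_space UNIV" "fst \<in> freq \<rightarrow>\<^sub>M borel"
    by (simp_all add: measurable_cong_sets[OF sets_freq refl])
  have s: "(\<lambda>x. snd (fst x)) \<in> freq \<Otimes>\<^sub>M freq \<rightarrow>\<^sub>M count_space (UNIV :: int set)"
     "(\<lambda>x. snd (snd x)) \<in> freq \<Otimes>\<^sub>M freq \<rightarrow>\<^sub>M count_space (UNIV :: int set)"
    by (rule measurable_compose[OF measurable_fst m(1)] measurable_compose[OF measurable_snd m(1)])+
  have "(\<lambda>x. i - snd (snd x)) \<in> freq \<Otimes>\<^sub>M freq \<rightarrow>\<^sub>M count_space (UNIV :: int set)" for i
    by (rule measurable_compose[OF s(2)]) simp
  then have "(\<lambda>x. snd (fst x) - snd (snd x)) \<in> freq \<Otimes>\<^sub>M freq \<rightarrow>\<^sub>M count_space (UNIV :: int set)"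
    by (rule measurable_compose_countable[OF _ s(1)])
  moreover have "(\<lambda>x. fst (fst x) - fst (snd x)) \<in> freq \<Otimes>\<^sub>M freq \<rightarrow>\<^sub>M borel"
    by (intro borel_measurable_diff measurable_compose[OF measurable_fst m(2)] measurable_compose[OF measurable_snd m(2)])
  ultimately have "(\<lambda>x. (fst (fst x) - fst (snd x), snd (fst x) - snd (snd x)))
      \<in> freq \<Otimes>\<^sub>M freq \<rightarrow>\<^sub>M borel \<Otimes>\<^sub>M count_space UNIV"
    by (rule measurable_Pair[rotated])
  then show ?thesis
    by (simp add: measurable_cong_sets[OF refl sets_freq] minus_prod_def)
qed

lemma freq_minus_measurable' [measurable]:
  assumes "f \<in> M \<rightarrow>\<^sub>M freq" "g \<in> M \<rightarrow>\<^sub>M freq"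
  shows "(\<lambda>x. f x - g x) \<in> M \<rightarrow>\<^sub>M freq"
  using measurable_compose[OF measurable_Pair[OF assms] freq_minus_measurable] by simp

lemma nonzero_mode_measurable [measurable]: "{p. snd p \<noteq> 0} \<in> sets freq"
proof -
  have "{p \<in> space freq. snd p \<noteq> (0::int)} \<in> sets freq"
    by (intro predE freq_measurable_split) simp
  then show ?thesis by simp
qed

lemma sigma_finite_freq: "sigma_finite_measure freq"
  unfolding freq_def by (rule real_int.sigma_finite_measure_axioms)

interpretation freq_pair: pair_sigma_finite freq freq
  by (intro pair_sigma_finite.intro sigma_finite_freq)

text \<open>Invariance of the frequency measure under translations and reflections, the latter for \<open>c = -1\<close>.\<close>
lemma nn_integral_freq_affine:
  assumes [measurable]: "f \<in> borel_measurable freq" and c: "c = 1 \<or> c = (-1::int)"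
  shows "(\<integral>\<^sup>+p. f (fst r + of_int c * fst p, snd r + c * snd p) \<partial>freq) = (\<integral>\<^sup>+p. f p \<partial>freq)"
proof -
  have fk: "(\<lambda>t. f (t, k)) \<in> borel_measurable borel" for k
  proof -
    have "(\<lambda>t::real. (t, k)) \<in> borel \<rightarrow>\<^sub>M freq"
      by (simp add: measurable_cong_sets[OF refl sets_freq])
    then show ?thesis by measurable
  qed
  have c1: "\<bar>of_int c :: real\<bar> = 1" "of_int c \<noteq> (0::real)" using c by auto
  have "(\<integral>\<^sup>+p. f (fst r + of_int c * fst p, snd r + c * snd p) \<partial>freq)
     = (\<integral>\<^sup>+k. \<integral>\<^sup>+t. f (fst r + of_int c * t, snd r + c * k) \<partial>lborel \<partial>count_space UNIV)"
  proof (subst nn_integral_freq)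
    show "(\<lambda>p. f (fst r + of_int c * fst p, snd r + c * snd p)) \<in> borel_measurable freq"
    proof (rule freq_measurable_split)
      fix k
      have "(\<lambda>t. fst r + of_int c * t) \<in> borel_measurable borel" by measurable
      from measurable_compose[OF this fk[of "snd r + c * k"]]
      show "(\<lambda>t. f (fst r + of_int c * fst (t, k), snd r + c * snd (t, k))) \<in> borel_measurable borel"
        unfolding fst_conv snd_conv .
    qed
  qed simp
  also have "\<dots> = (\<integral>\<^sup>+k. \<integral>\<^sup>+t. f (t, snd r + c * k) \<partial>lborel \<partial>count_space UNIV)"
  proof (rule nn_integral_cong)
    fix k
    show "(\<integral>\<^sup>+t. f (fst r + of_int c * t, snd r + c * k) \<partial>lborel) = (\<integral>\<^sup>+t. f (t, snd r + c * k) \<partial>lborel)"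
      unfolding nn_integral_real_affine[OF fk c1(2), of "snd r + c * k" "fst r"] c1 ennreal_1 mult_1 ..
  qed
  also have "\<dots> = (\<integral>\<^sup>+k. \<integral>\<^sup>+t. f (t, k) \<partial>lborel \<partial>count_space UNIV)"
  proof (rule nn_integral_bij_count_space)
    show "bij_betw (\<lambda>k. snd r + c * k) UNIV UNIV"
      by (rule bij_betwI[where g="\<lambda>k. c * (k - snd r)"]) (use c in auto)
  qed
  finally show ?thesis by (simp only: nn_integral_freq[OF assms(1)])
qed

lemma nn_integral_freq_reflect:
  assumes "f \<in> borel_measurable freq"
  shows "(\<integral>\<^sup>+q. f (p - q) \<partial>freq) = (\<integral>\<^sup>+q. f q \<partial>freq)"
proof -
  have "p - q = (fst p + of_int (-1) * fst q, snd p + (-1) * snd q)" for q by (simp add: minus_prod_def)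
  then show ?thesis by (simp only: nn_integral_freq_affine[OF assms, of "-1" p] refl simp_thms)
qed

lemma nn_integral_freq_shift:
  assumes "f \<in> borel_measurable freq"
  shows "(\<integral>\<^sup>+p. f (p - q) \<partial>freq) = (\<integral>\<^sup>+p. f p \<partial>freq)"
proof -
  have "p - q = (fst (- q) + of_int 1 * fst p, snd (- q) + 1 * snd p)" for p by (simp add: minus_prod_def)
  then show ?thesis by (simp only: nn_integral_freq_affine[OF assms, of 1 "- q"] refl simp_thms)
qed

text \<open>This is the case in which the modulation of the output is the largest. The weights at the two inputs are
  separated from \<open>F\<close> and \<open>G\<close> by Cauchy-Schwarz in \<open>q\<close>, and their integral is bounded by \<open>C\<close> for each
  output \<open>p\<close>.\<close>
lemma output_dominated_L2_le:
  fixes F G A :: "real \<times> int \<Rightarrow> ennreal"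
  assumes [measurable]: "F \<in> borel_measurable freq" "G \<in> borel_measurable freq" "A \<in> borel_measurable freq"
    and C: "\<And>p. snd p \<noteq> 0 \<Longrightarrow> (\<integral>\<^sup>+q. (A q)\<^sup>2 * (A (p - q))\<^sup>2 \<partial>freq) \<le> C"
  shows "(\<integral>\<^sup>+p. (indicator {p. snd p \<noteq> 0} p * (\<integral>\<^sup>+q. A q * A (p - q) * (F (p - q) * G q) \<partial>freq))\<^sup>2 \<partial>freq)
    \<le> C * ((\<integral>\<^sup>+p. (F p)\<^sup>2 \<partial>freq) * (\<integral>\<^sup>+p. (G p)\<^sup>2 \<partial>freq))"
proof -
  have "(indicator {p. snd p \<noteq> 0} p * (\<integral>\<^sup>+q. A q * A (p - q) * (F (p - q) * G q) \<partial>freq))\<^sup>2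
     \<le> C * (\<integral>\<^sup>+q. (F (p - q))\<^sup>2 * (G q)\<^sup>2 \<partial>freq)" for p
  proof (cases "snd p = 0")
    case False
    have "(\<integral>\<^sup>+q. A q * A (p - q) * (F (p - q) * G q) \<partial>freq)\<^sup>2
      \<le> (\<integral>\<^sup>+q. (A q * A (p - q))\<^sup>2 \<partial>freq) * (\<integral>\<^sup>+q. (F (p - q) * G q)\<^sup>2 \<partial>freq)"
      by (rule nn_integral_Cauchy_Schwarz) measurable
    also have "\<dots> \<le> C * (\<integral>\<^sup>+q. (F (p - q) * G q)\<^sup>2 \<partial>freq)"
      using C[OF False] by (intro mult_right_mono) (simp_all add: power_mult_distrib)
    finally show ?thesis using False by (simp add: power_mult_distrib)
  qed simp
  then have "(\<integral>\<^sup>+p. (indicator {p. snd p \<noteq> 0} p * (\<integral>\<^sup>+q. A q * A (p - q) * (F (p - q) * G q) \<partial>freq))\<^sup>2 \<partial>freq)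
     \<le> (\<integral>\<^sup>+p. C * (\<integral>\<^sup>+q. (F (p - q))\<^sup>2 * (G q)\<^sup>2 \<partial>freq) \<partial>freq)"
    by (intro nn_integral_mono)
  also have "\<dots> = C * (\<integral>\<^sup>+p. \<integral>\<^sup>+q. (F (p - q))\<^sup>2 * (G q)\<^sup>2 \<partial>freq \<partial>freq)"
    by (rule nn_integral_cmult) measurable
  also have "(\<integral>\<^sup>+p. \<integral>\<^sup>+q. (F (p - q))\<^sup>2 * (G q)\<^sup>2 \<partial>freq \<partial>freq) = (\<integral>\<^sup>+q. \<integral>\<^sup>+p. (F (p - q))\<^sup>2 * (G q)\<^sup>2 \<partial>freq \<partial>freq)"
    by (intro freq_pair.Fubini'[symmetric]) measurable
  also have "\<dots> = (\<integral>\<^sup>+q. (\<integral>\<^sup>+p. (F p)\<^sup>2 \<partial>freq) * (G q)\<^sup>2 \<partial>freq)"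
    by (simp add: nn_integral_multc nn_integral_freq_shift[of "\<lambda>p. (F p)\<^sup>2"])
  also have "\<dots> = (\<integral>\<^sup>+p. (F p)\<^sup>2 \<partial>freq) * (\<integral>\<^sup>+p. (G p)\<^sup>2 \<partial>freq)"
    by (rule nn_integral_cmult) measurable
  finally show ?thesis .
qed

text \<open>The weights now sit at the output \<open>p\<close> and at the input \<open>q\<close>, and the third point \<open>p - q\<close> carries no
  weight. Cauchy-Schwarz isolates \<open>G\<close>; after the substitution that makes \<open>p - q\<close> the inner variable and an exchange of
  the integrals, the weights are integrated in \<open>p\<close> for fixed \<open>p - q\<close>. Evenness of \<open>A\<close> brings this
  integral into the form controlled by the hypothesis.\<close>
lemma input_dominated_L2_le:
  fixes F G A :: "real \<times> int \<Rightarrow> ennreal"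
  assumes [measurable]: "F \<in> borel_measurable freq" "G \<in> borel_measurable freq" "A \<in> borel_measurable freq"
    and even: "\<And>p. A (- p) = A p"
    and C: "\<And>p. snd p \<noteq> 0 \<Longrightarrow> (\<integral>\<^sup>+q. (A q)\<^sup>2 * (A (p - q))\<^sup>2 \<partial>freq) \<le> C"
  shows "(\<integral>\<^sup>+p. (A p * (\<integral>\<^sup>+q. A q * indicator {p. snd p \<noteq> 0} (p - q) * (F (p - q) * G q) \<partial>freq))\<^sup>2 \<partial>freq)
    \<le> C * ((\<integral>\<^sup>+p. (F p)\<^sup>2 \<partial>freq) * (\<integral>\<^sup>+p. (G p)\<^sup>2 \<partial>freq))"
proof -
  define I :: "real \<times> int \<Rightarrow> ennreal" where "I = indicator {p. snd p \<noteq> 0}"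
  have [measurable]: "I \<in> borel_measurable freq" unfolding I_def by measurable
  have II: "(I p)\<^sup>2 = I p" for p by (simp add: I_def indicator_def)
  define NG where "NG = (\<integral>\<^sup>+p. (G p)\<^sup>2 \<partial>freq)"
  have "(\<integral>\<^sup>+p. \<integral>\<^sup>+q. (A p)\<^sup>2 * ((A (p - q))\<^sup>2 * (I q * (F q)\<^sup>2)) \<partial>freq \<partial>freq)
     = (\<integral>\<^sup>+q. \<integral>\<^sup>+p. (A p)\<^sup>2 * ((A (p - q))\<^sup>2 * (I q * (F q)\<^sup>2)) \<partial>freq \<partial>freq)"
    by (intro freq_pair.Fubini'[symmetric]) measurable
  also have "\<dots> \<le> (\<integral>\<^sup>+q. C * (F q)\<^sup>2 \<partial>freq)"
  proof (intro nn_integral_mono)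
    fix q
    have "(\<integral>\<^sup>+p. (A p)\<^sup>2 * ((A (p - q))\<^sup>2 * (I q * (F q)\<^sup>2)) \<partial>freq)
       = (\<integral>\<^sup>+p. ((A p)\<^sup>2 * (A (q - p))\<^sup>2) * (I q * (F q)\<^sup>2) \<partial>freq)"
      using even[of "q - _"] by (simp add: mult.assoc)
    also have "\<dots> = (\<integral>\<^sup>+p. (A p)\<^sup>2 * (A (q - p))\<^sup>2 \<partial>freq) * (I q * (F q)\<^sup>2)"
      by (rule nn_integral_multc) measurable
    also have "\<dots> \<le> C * (F q)\<^sup>2"
      using C[of q] by (cases "snd q = 0") (auto simp: I_def intro: mult_right_mono)
    finally show "(\<integral>\<^sup>+p. (A p)\<^sup>2 * ((A (p - q))\<^sup>2 * (I q * (F q)\<^sup>2)) \<partial>freq) \<le> C * (F q)\<^sup>2" .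
  qed
  also have "\<dots> = C * (\<integral>\<^sup>+q. (F q)\<^sup>2 \<partial>freq)" by (rule nn_integral_cmult) measurable
  finally have inner: "(\<integral>\<^sup>+p. \<integral>\<^sup>+q. (A p)\<^sup>2 * ((A (p - q))\<^sup>2 * (I q * (F q)\<^sup>2)) \<partial>freq \<partial>freq)
      \<le> C * (\<integral>\<^sup>+q. (F q)\<^sup>2 \<partial>freq)" .
  have "(A p * (\<integral>\<^sup>+q. A q * I (p - q) * (F (p - q) * G q) \<partial>freq))\<^sup>2
      \<le> NG * (\<integral>\<^sup>+q. (A p)\<^sup>2 * ((A (p - q))\<^sup>2 * (I q * (F q)\<^sup>2)) \<partial>freq)" for p
  proof -
    have "(\<integral>\<^sup>+q. A q * I (p - q) * (F (p - q) * G q) \<partial>freq)\<^sup>2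
      = (\<integral>\<^sup>+q. (A q * I (p - q) * F (p - q)) * G q \<partial>freq)\<^sup>2" by (simp add: mult.assoc)
    also have "\<dots> \<le> (\<integral>\<^sup>+q. (A q * I (p - q) * F (p - q))\<^sup>2 \<partial>freq) * NG"
      unfolding NG_def by (rule nn_integral_Cauchy_Schwarz) measurable
    also have "(\<integral>\<^sup>+q. (A q * I (p - q) * F (p - q))\<^sup>2 \<partial>freq)
       = (\<integral>\<^sup>+q. (A (p - (p - q)))\<^sup>2 * (I (p - q) * (F (p - q))\<^sup>2) \<partial>freq)"
      by (simp add: power_mult_distrib II mult.assoc)
    also have "\<dots> = (\<integral>\<^sup>+q. (A (p - q))\<^sup>2 * (I q * (F q)\<^sup>2) \<partial>freq)"
      by (rule nn_integral_freq_reflect[of "\<lambda>q. (A (p - q))\<^sup>2 * (I q * (F q)\<^sup>2)"]) measurable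
    finally have "(A p)\<^sup>2 * (\<integral>\<^sup>+q. A q * I (p - q) * (F (p - q) * G q) \<partial>freq)\<^sup>2
       \<le> (A p)\<^sup>2 * ((\<integral>\<^sup>+q. (A (p - q))\<^sup>2 * (I q * (F q)\<^sup>2) \<partial>freq) * NG)"
      by (intro mult_left_mono) auto
    also have "\<dots> = NG * (\<integral>\<^sup>+q. (A p)\<^sup>2 * ((A (p - q))\<^sup>2 * (I q * (F q)\<^sup>2)) \<partial>freq)"
      by (subst nn_integral_cmult) (auto simp: mult_ac)
    finally show ?thesis by (simp add: power_mult_distrib)
  qed
  then have "(\<integral>\<^sup>+p. (A p * (\<integral>\<^sup>+q. A q * I (p - q) * (F (p - q) * G q) \<partial>freq))\<^sup>2 \<partial>freq)
     \<le> (\<integral>\<^sup>+p. NG * (\<integral>\<^sup>+q. (A p)\<^sup>2 * ((A (p - q))\<^sup>2 * (I q * (F q)\<^sup>2)) \<partial>freq) \<partial>freq)"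
    by (intro nn_integral_mono)
  also have "\<dots> = NG * (\<integral>\<^sup>+p. \<integral>\<^sup>+q. (A p)\<^sup>2 * ((A (p - q))\<^sup>2 * (I q * (F q)\<^sup>2)) \<partial>freq \<partial>freq)"
    by (rule nn_integral_cmult) measurable
  also have "\<dots> \<le> NG * (C * (\<integral>\<^sup>+q. (F q)\<^sup>2 \<partial>freq))"
    by (rule mult_left_mono[OF inner]) simp
  finally show ?thesis unfolding I_def NG_def by (simp only: mult_ac)
qed

lemma ennreal_power2_add_le: "(x + y)\<^sup>2 \<le> 2 * (x\<^sup>2 + y\<^sup>2)" for x y :: ennreal
proof (cases "x = top \<or> y = top")
  case True
  then show ?thesis by (auto simp: ennreal_mult_top power2_eq_square)
next
  case False
  then obtain r t where rt: "x = ennreal r" "0 \<le> r" "y = ennreal t" "0 \<le> t" by (cases x; cases y) auto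
  have "0 \<le> (r - t)\<^sup>2" by simp
  then have "(r + t)\<^sup>2 \<le> 2 * (r\<^sup>2 + t\<^sup>2)" by (simp add: power2_diff power2_sum)
  then have "ennreal ((r + t)\<^sup>2) \<le> ennreal (2 * (r\<^sup>2 + t\<^sup>2))" by (rule ennreal_leI)
  then show ?thesis using rt by (simp add: ennreal_mult ennreal_power[symmetric])
qed

text \<open>The weight of the output divided by the weights of the two inputs: the kernel that is left once both inputs are measured in their own norms.\<close>
definition interaction_kernel :: "real \<Rightarrow> real \<Rightarrow> real \<Rightarrow> real \<times> int \<Rightarrow> real \<times> int \<Rightarrow> real" where
  "interaction_kernel s a b p q = freqsize p powr s * modul p powr (-a)
     * (freqsize (p - q) powr (-s) * modul (p - q) powr (-b)) * (freqsize q powr (-s) * modul q powr (-b))"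

text \<open>The three terms of the kernel bound are \<open>X\<close>, \<open>Y\<close> and \<open>Z\<close>. The last one is the mirror image of \<open>Y\<close>
  under \<open>q \<mapsto> p - q\<close>, with \<open>F\<close> and \<open>G\<close> exchanged.\<close>
theorem bilinear_L2_bound:
  fixes s a b :: real
  assumes sab: "0 \<le> a" "1/2 < b" "0 \<le> s \<or> (-1/4 < s \<and> s < 0 \<and> 2 * \<bar>s\<bar> \<le> a)"
  obtains C where "C < \<infinity>" and
    "\<And>F G :: real \<times> int \<Rightarrow> ennreal. F \<in> borel_measurable freq \<Longrightarrow> G \<in> borel_measurable freq \<Longrightarrow>
      (\<integral>\<^sup>+p. (indicator {p. snd p \<noteq> 0} p * (\<integral>\<^sup>+q. ennreal (interaction_kernel s a b p q) * (F (p - q) * G q) \<partial>freq))\<^sup>2 \<partial>freq)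
      \<le> C * ((\<integral>\<^sup>+p. (F p)\<^sup>2 \<partial>freq) * (\<integral>\<^sup>+p. (G p)\<^sup>2 \<partial>freq))"
proof -
  define A where "A p = ennreal (modul p powr (-b))" for p
  have [measurable]: "A \<in> borel_measurable freq" unfolding A_def[abs_def] by measurable
  have even: "A (- p) = A p" for p
    by (simp add: A_def modul_def gam_def)
  have A2: "(A p)\<^sup>2 = ennreal (modul p powr (-(2 * b)))" for p
    by (simp add: A_def power2_eq_square flip: ennreal_mult powr_add)
  obtain C where Cfin: "C < \<infinity>" and "\<And>p. snd p \<noteq> 0 \<Longrightarrow>
      (\<integral>\<^sup>+q. ennreal (modul q powr (-(2*b))) * ennreal (modul (p - q) powr (-(2*b))) \<partial>freq) \<le> C"
    using interaction_bounded[of "2 * b"] sab by auto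
  then have C: "\<And>p. snd p \<noteq> 0 \<Longrightarrow> (\<integral>\<^sup>+q. (A q)\<^sup>2 * (A (p - q))\<^sup>2 \<partial>freq) \<le> C"
    by (simp add: A2)
  define I :: "real \<times> int \<Rightarrow> ennreal" where "I = indicator {p. snd p \<noteq> 0}"
  have [measurable]: "I \<in> borel_measurable freq" unfolding I_def by measurable
  show ?thesis
  proof
    show "81 * (2 * (C + 2 * (C + C))) < \<infinity>"
      using Cfin by (simp add: ennreal_mult_less_top)
    fix F G :: "real \<times> int \<Rightarrow> ennreal"
    assume [measurable]: "F \<in> borel_measurable freq" "G \<in> borel_measurable freq"
    define N where "N = (\<integral>\<^sup>+p. (F p)\<^sup>2 \<partial>freq) * (\<integral>\<^sup>+p. (G p)\<^sup>2 \<partial>freq)"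
    define X where "X p = I p * (\<integral>\<^sup>+q. A q * A (p - q) * (F (p - q) * G q) \<partial>freq)" for p
    define Y where "Y p = A p * (\<integral>\<^sup>+q. A q * I (p - q) * (F (p - q) * G q) \<partial>freq)" for p
    define Z where "Z p = A p * (\<integral>\<^sup>+q. A q * I (p - q) * (G (p - q) * F q) \<partial>freq)" for p
    have [measurable]: "X \<in> borel_measurable freq" "Y \<in> borel_measurable freq" "Z \<in> borel_measurable freq"
      unfolding X_def[abs_def] Y_def[abs_def] Z_def[abs_def] by measurable
    have XYZ: "(\<integral>\<^sup>+p. (X p)\<^sup>2 \<partial>freq) \<le> C * N" "(\<integral>\<^sup>+p. (Y p)\<^sup>2 \<partial>freq) \<le> C * N"
       "(\<integral>\<^sup>+p. (Z p)\<^sup>2 \<partial>freq) \<le> C * N"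
      using output_dominated_L2_le[of F G A C] input_dominated_L2_le[of F G A C] input_dominated_L2_le[of G F A C] C even
      by (simp_all add: X_def Y_def Z_def N_def I_def mult.commute)
    have Zalt: "Z p = A p * (\<integral>\<^sup>+q. A (p - q) * I q * (F (p - q) * G q) \<partial>freq)" for p
    proof -
      have "(\<integral>\<^sup>+q. A q * I (p - q) * (G (p - q) * F q) \<partial>freq)
          = (\<integral>\<^sup>+q. A (p - q) * I (p - (p - q)) * (G (p - (p - q)) * F (p - q)) \<partial>freq)"
        by (rule nn_integral_freq_reflect[symmetric]) measurable
      then show ?thesis by (simp add: Z_def mult.commute)
    qed
    have pw: "I p * (\<integral>\<^sup>+q. ennreal (interaction_kernel s a b p q) * (F (p - q) * G q) \<partial>freq)
       \<le> 9 * (X p + (Y p + Z p))" for p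
    proof (cases "snd p = 0")
      case True
      then show ?thesis by (simp add: I_def)
    next
      case False
      have "ennreal (interaction_kernel s a b p q)
         \<le> 9 * (A q * A (p - q) + (A p * (A q * I (p - q)) + A p * (A (p - q) * I q)))" for q
      proof -
        have "interaction_kernel s a b p q \<le> 9 * (modul (p - q) powr (-b) * modul q powr (-b)
               + indicator {p. snd p \<noteq> 0} (p - q) * (modul p powr (-b) * modul q powr (-b))
               + indicator {p. snd p \<noteq> 0} q * (modul p powr (-b) * modul (p - q) powr (-b)))"
          using kernel_bound[of a s b "p - q" q] sab False by (simp add: interaction_kernel_def)
        then have "ennreal (interaction_kernel s a b p q) \<le> ennreal (9 * (modul (p - q) powr (-b) * modul q powr (-b)
               + indicator {p. snd p \<noteq> 0} (p - q) * (modul p powr (-b) * modul q powr (-b))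
               + indicator {p. snd p \<noteq> 0} q * (modul p powr (-b) * modul (p - q) powr (-b))))"
          by (rule ennreal_leI)
        also have "\<dots> = 9 * (A q * A (p - q) + (A p * (A q * I (p - q)) + A p * (A (p - q) * I q)))"
          by (simp add: A_def I_def ennreal_mult ennreal_indicator[symmetric] mult_ac add.assoc)
        finally show ?thesis .
      qed
      then have "(\<integral>\<^sup>+q. ennreal (interaction_kernel s a b p q) * (F (p - q) * G q) \<partial>freq)
         \<le> (\<integral>\<^sup>+q. (9 * (A q * A (p - q) + (A p * (A q * I (p - q)) + A p * (A (p - q) * I q)))) * (F (p - q) * G q) \<partial>freq)"
        by (intro nn_integral_mono mult_right_mono) auto
      also have "\<dots> = (\<integral>\<^sup>+q. 9 * (A q * A (p - q) * (F (p - q) * G q)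
         + (A p * (A q * I (p - q) * (F (p - q) * G q)) + A p * (A (p - q) * I q * (F (p - q) * G q)))) \<partial>freq)"
        by (simp only: distrib_right mult.assoc)
      also have "\<dots> = 9 * ((\<integral>\<^sup>+q. A q * A (p - q) * (F (p - q) * G q) \<partial>freq) + (Y p + Z p))"
        by (simp add: nn_integral_cmult nn_integral_add Y_def Zalt)
      finally show ?thesis using False by (simp add: I_def X_def)
    qed
    have "(\<integral>\<^sup>+p. (I p * (\<integral>\<^sup>+q. ennreal (interaction_kernel s a b p q) * (F (p - q) * G q) \<partial>freq))\<^sup>2 \<partial>freq)
       \<le> (\<integral>\<^sup>+p. 81 * (2 * ((X p)\<^sup>2 + 2 * ((Y p)\<^sup>2 + (Z p)\<^sup>2))) \<partial>freq)"
    proof (intro nn_integral_mono)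
      fix p
      have "(I p * (\<integral>\<^sup>+q. ennreal (interaction_kernel s a b p q) * (F (p - q) * G q) \<partial>freq))\<^sup>2
         \<le> (9 * (X p + (Y p + Z p)))\<^sup>2" by (intro power_mono pw) simp
      also have "\<dots> = 81 * (X p + (Y p + Z p))\<^sup>2" unfolding power_mult_distrib by simp
      also have "\<dots> \<le> 81 * (2 * ((X p)\<^sup>2 + 2 * ((Y p)\<^sup>2 + (Z p)\<^sup>2)))"
        by (intro mult_left_mono order_trans[OF ennreal_power2_add_le] add_left_mono ennreal_power2_add_le) auto
      finally show "(I p * (\<integral>\<^sup>+q. ennreal (interaction_kernel s a b p q) * (F (p - q) * G q) \<partial>freq))\<^sup>2
         \<le> 81 * (2 * ((X p)\<^sup>2 + 2 * ((Y p)\<^sup>2 + (Z p)\<^sup>2)))" .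
    qed
    also have "\<dots> = 81 * (2 * ((\<integral>\<^sup>+p. (X p)\<^sup>2 \<partial>freq) + 2 * ((\<integral>\<^sup>+p. (Y p)\<^sup>2 \<partial>freq) + (\<integral>\<^sup>+p. (Z p)\<^sup>2 \<partial>freq))))"
      by (simp add: nn_integral_cmult nn_integral_add)
    also have "\<dots> \<le> 81 * (2 * (C * N + 2 * (C * N + C * N)))"
      by (intro mult_left_mono add_mono XYZ) auto
    also have "\<dots> = 81 * (2 * (C + 2 * (C + C))) * N"
      by (simp only: distrib_left distrib_right mult.assoc)
    finally show "(\<integral>\<^sup>+p. (indicator {p. snd p \<noteq> 0} p * (\<integral>\<^sup>+q. ennreal (interaction_kernel s a b p q) * (F (p - q) * G q) \<partial>freq))\<^sup>2 \<partial>freq)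
      \<le> 81 * (2 * (C + 2 * (C + C))) * ((\<integral>\<^sup>+p. (F p)\<^sup>2 \<partial>freq) * (\<integral>\<^sup>+p. (G p)\<^sup>2 \<partial>freq))"
      by (simp add: I_def N_def)
  qed
qed

section \<open>The completion as a closed linear space\<close>

definition Xweight :: "real \<Rightarrow> real \<Rightarrow> real \<times> int \<Rightarrow> real" where
  "Xweight s b p = modul p powr b * freqsize p powr s"

lemma Xweight_nonneg [simp]: "0 \<le> Xweight s b p" by (simp add: Xweight_def)
lemma Xweight_pos [simp]: "0 < Xweight s b p"
  unfolding Xweight_def by (intro mult_pos_pos) simp_all

lemma Xweight_measurable [measurable]: "Xweight s b \<in> borel_measurable freq"
  unfolding Xweight_def[abs_def] by measurable

lemma Xnorm_sq_weight:
  "Xnorm_sq s b f = (\<integral>\<^sup>+p. (ennreal (Xweight s b p * norm (f p)))\<^sup>2 \<partial>freq)"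
  unfolding Xnorm_sq_def
  by (intro nn_integral_cong) (auto simp: Xweight_def modul_def freqsize_def ennreal_power split: prod.split)

lemma Xnorm_sq_add_le:
  assumes [measurable]: "f \<in> borel_measurable freq" "g \<in> borel_measurable freq"
  shows "Xnorm_sq s b (\<lambda>p. f p + g p) \<le> 2 * (Xnorm_sq s b f + Xnorm_sq s b g)"
proof -
  have "Xnorm_sq s b (\<lambda>p. f p + g p)
      \<le> (\<integral>\<^sup>+p. 2 * ((ennreal (Xweight s b p * norm (f p)))\<^sup>2 + (ennreal (Xweight s b p * norm (g p)))\<^sup>2) \<partial>freq)"
    unfolding Xnorm_sq_weight
  proof (intro nn_integral_mono)
    fix p
    have "Xweight s b p * norm (f p + g p) \<le> Xweight s b p * norm (f p) + Xweight s b p * norm (g p)"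
      using mult_left_mono[OF norm_triangle_ineq, of "Xweight s b p" "f p" "g p"] by (simp add: distrib_left)
    then have "ennreal (Xweight s b p * norm (f p + g p)) \<le> ennreal (Xweight s b p * norm (f p)) + ennreal (Xweight s b p * norm (g p))"
      by (simp add: ennreal_leI flip: ennreal_plus)
    then have "(ennreal (Xweight s b p * norm (f p + g p)))\<^sup>2 \<le> (ennreal (Xweight s b p * norm (f p)) + ennreal (Xweight s b p * norm (g p)))\<^sup>2"
      by (intro power_mono) auto
    then show "(ennreal (Xweight s b p * norm (f p + g p)))\<^sup>2
       \<le> 2 * ((ennreal (Xweight s b p * norm (f p)))\<^sup>2 + (ennreal (Xweight s b p * norm (g p)))\<^sup>2)"
      using ennreal_power2_add_le by (rule order_trans)
  qed
  also have "\<dots> = 2 * (Xnorm_sq s b f + Xnorm_sq s b g)"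
    unfolding Xnorm_sq_weight by (subst nn_integral_cmult) (simp_all add: nn_integral_add)
  finally show ?thesis .
qed

lemma Xnorm_sq_cmult:
  assumes [measurable]: "f \<in> borel_measurable freq"
  shows "Xnorm_sq s b (\<lambda>p. c * f p) = (ennreal (norm c))\<^sup>2 * Xnorm_sq s b f"
proof -
  have "Xnorm_sq s b (\<lambda>p. c * f p) = (\<integral>\<^sup>+p. (ennreal (norm c))\<^sup>2 * (ennreal (Xweight s b p * norm (f p)))\<^sup>2 \<partial>freq)"
    unfolding Xnorm_sq_weight
    by (intro nn_integral_cong) (simp add: norm_mult ennreal_mult power_mult_distrib mult_ac)
  also have "\<dots> = (ennreal (norm c))\<^sup>2 * Xnorm_sq s b f"
    unfolding Xnorm_sq_weight by (rule nn_integral_cmult) measurable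
  finally show ?thesis .
qed

text \<open>An integral depending on a parameter is measurable in the parameter as soon as the integrand is jointly measurable.\<close>
lemma xt_fourier_measurable [measurable]:
  assumes "xt_integrable F"
  shows "xt_fourier F \<in> borel_measurable freq"
proof (rule freq_measurable_split)
  fix n :: int
  define h where "h q = indicator ({0..2 * pi} \<times> UNIV) q *\<^sub>R (case q of (x, t) \<Rightarrow> F x t)" for q :: "real \<times> real"
  have [measurable]: "h \<in> borel_measurable (borel :: (real \<times> real) measure)"
    using assms unfolding xt_integrable_def set_integrable_def h_def[abs_def]
    by (auto dest: borel_measurable_integrable)
  have "(\<lambda>z :: real \<times> (real \<times> real). cis (- (snd (snd z) * fst z + fst (snd z) * of_int n))) \<in> borel_measurable borel"
    by (intro borel_measurable_continuous_onI continuous_intros)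
  then have "(\<lambda>z :: real \<times> (real \<times> real). cis (- (snd (snd z) * fst z + fst (snd z) * of_int n))) \<in> borel_measurable (borel \<Otimes>\<^sub>M lborel)"
    by (simp only: measurable_cong_sets[OF sets_pair_measure_cong[OF refl sets_lborel] refl] borel_prod)
  moreover have "(\<lambda>z :: real \<times> (real \<times> real). h (snd z)) \<in> borel_measurable (borel \<Otimes>\<^sub>M lborel)"
    by measurable
  ultimately have "(\<lambda>z :: real \<times> (real \<times> real). cis (- (snd (snd z) * fst z + fst (snd z) * of_int n)) * h (snd z))
    \<in> borel_measurable (borel \<Otimes>\<^sub>M lborel)"
    by (rule borel_measurable_times)
  then have "(\<lambda>\<tau>. LINT q|lborel. cis (- (snd q * \<tau> + fst q * of_int n)) * h q) \<in> borel_measurable borel"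
    by (intro lborel.borel_measurable_lebesgue_integral) (simp add: case_prod_beta)
  also have "(\<lambda>\<tau>. LINT q|lborel. cis (- (snd q * \<tau> + fst q * of_int n)) * h q) = (\<lambda>\<tau>. xt_fourier F (\<tau>, n))"
    unfolding xt_fourier_def set_lebesgue_integral_def h_def
    by (auto simp: case_prod_beta intro!: ext Bochner_Integration.integral_cong)
  finally show "(\<lambda>\<tau>. xt_fourier F (\<tau>, n)) \<in> borel_measurable borel" .
qed

lemma X_space_measurable: "f \<in> X_space s b \<Longrightarrow> f \<in> borel_measurable freq"
  by (simp add: X_space_def)

text \<open>Together with the next lemma this replaces approximating sequences by a condition for each tolerance, which is easier to combine.\<close>
lemma X_spaceI:
  assumes f: "f \<in> borel_measurable freq"
    and approx: "\<And>e. 0 < e \<Longrightarrow> \<exists>F. F \<in> Y_space \<and> xt_integrable F \<and> Xnorm_sq s b (xt_fourier F) < \<infinity>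
        \<and> Xnorm_sq s b (\<lambda>p. xt_fourier F p - f p) \<le> ennreal e"
  shows "f \<in> X_space s b"
proof -
  have "\<forall>k::nat. \<exists>F. F \<in> Y_space \<and> xt_integrable F \<and> Xnorm_sq s b (xt_fourier F) < \<infinity>
        \<and> Xnorm_sq s b (\<lambda>p. xt_fourier F p - f p) \<le> ennreal (inverse (real (Suc k)))"
    by (intro allI approx) simp
  then obtain F where F: "\<And>k::nat. F k \<in> Y_space \<and> xt_integrable (F k) \<and> Xnorm_sq s b (xt_fourier (F k)) < \<infinity>
        \<and> Xnorm_sq s b (\<lambda>p. xt_fourier (F k) p - f p) \<le> ennreal (inverse (real (Suc k)))"
    by metis
  have "(\<lambda>k. ennreal (inverse (real (Suc k)))) \<longlonglongrightarrow> ennreal 0"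
    by (intro tendsto_ennrealI LIMSEQ_inverse_real_of_nat)
  then have lim: "(\<lambda>k. ennreal (inverse (real (Suc k)))) \<longlonglongrightarrow> 0" by simp
  have "\<forall>\<^sub>F k in sequentially. Xnorm_sq s b (\<lambda>p. xt_fourier (F k) p - f p) \<le> ennreal (inverse (real (Suc k)))"
    using F by (intro always_eventually allI) blast
  then have "(\<lambda>k. Xnorm_sq s b (\<lambda>p. xt_fourier (F k) p - f p)) \<longlonglongrightarrow> 0"
    by (rule tendsto_sandwich[OF _ _ tendsto_const lim, rotated]) simp
  then show ?thesis using F f unfolding X_space_def by blast
qed

lemma X_space_approx:
  assumes "f \<in> X_space s b" "0 < e"
  shows "\<exists>F. F \<in> Y_space \<and> xt_integrable F \<and> Xnorm_sq s b (xt_fourier F) < \<infinity>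
        \<and> Xnorm_sq s b (\<lambda>p. xt_fourier F p - f p) \<le> ennreal e"
proof -
  obtain F where F: "\<And>k::nat. F k \<in> Y_space \<and> xt_integrable (F k) \<and> Xnorm_sq s b (xt_fourier (F k)) < \<infinity>"
    and lim: "(\<lambda>k. Xnorm_sq s b (\<lambda>p. xt_fourier (F k) p - f p)) \<longlonglongrightarrow> 0"
    using assms(1) unfolding X_space_def by blast
  have "\<forall>\<^sub>F k in sequentially. Xnorm_sq s b (\<lambda>p. xt_fourier (F k) p - f p) < ennreal e"
    using lim assms(2) by (intro order_tendstoD(2)) auto
  then obtain k where "Xnorm_sq s b (\<lambda>p. xt_fourier (F k) p - f p) < ennreal e"
    by (auto simp: eventually_sequentially)
  then show ?thesis using F[of k] by (intro exI[of _ "F k"]) auto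
qed

lemma X_space_finite_norm:
  assumes "f \<in> X_space s b"
  shows "Xnorm_sq s b f < \<infinity>"
proof -
  have [measurable]: "f \<in> borel_measurable freq" by (rule X_space_measurable[OF assms])
  obtain F where F: "xt_integrable F" "Xnorm_sq s b (xt_fourier F) < \<infinity>"
     "Xnorm_sq s b (\<lambda>p. xt_fourier F p - f p) \<le> ennreal 1"
    using X_space_approx[OF assms, of 1] by auto
  have [measurable]: "xt_fourier F \<in> borel_measurable freq" using F by measurable
  have "Xnorm_sq s b f = Xnorm_sq s b (\<lambda>p. xt_fourier F p + (-1) * (xt_fourier F p - f p))"
    by simp
  also have "\<dots> \<le> 2 * (Xnorm_sq s b (xt_fourier F) + Xnorm_sq s b (\<lambda>p. (-1) * (xt_fourier F p - f p)))"
    by (intro Xnorm_sq_add_le) measurable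
  also have "Xnorm_sq s b (\<lambda>p. (-1) * (xt_fourier F p - f p)) = Xnorm_sq s b (\<lambda>p. xt_fourier F p - f p)"
    by (subst Xnorm_sq_cmult) auto
  also have "2 * (Xnorm_sq s b (xt_fourier F) + Xnorm_sq s b (\<lambda>p. xt_fourier F p - f p)) < \<infinity>"
    using F by (auto simp: ennreal_mult_less_top intro: le_less_trans)
  finally show ?thesis .
qed

lemma X_space_closed:
  assumes f: "f \<in> borel_measurable freq"
    and g: "\<And>k. g k \<in> X_space s b"
    and lim: "(\<lambda>k::nat. Xnorm_sq s b (\<lambda>p. g k p - f p)) \<longlonglongrightarrow> 0"
  shows "f \<in> X_space s b"
proof (rule X_spaceI[OF f])
  fix e :: real assume e: "0 < e"
  have "\<forall>\<^sub>F k in sequentially. Xnorm_sq s b (\<lambda>p. g k p - f p) < ennreal (e / 4)"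
    using lim e by (intro order_tendstoD(2)) auto
  then obtain k where k: "Xnorm_sq s b (\<lambda>p. g k p - f p) < ennreal (e / 4)"
    by (auto simp: eventually_sequentially)
  obtain F where F: "F \<in> Y_space" "xt_integrable F" "Xnorm_sq s b (xt_fourier F) < \<infinity>"
     "Xnorm_sq s b (\<lambda>p. xt_fourier F p - g k p) \<le> ennreal (e / 4)"
    using X_space_approx[OF g, of "e / 4"] e by auto
  have [measurable]: "xt_fourier F \<in> borel_measurable freq" "g k \<in> borel_measurable freq"
    "f \<in> borel_measurable freq"
    using F X_space_measurable[OF g] f by measurable
  have "Xnorm_sq s b (\<lambda>p. xt_fourier F p - f p) = Xnorm_sq s b (\<lambda>p. (xt_fourier F p - g k p) + (g k p - f p))"
    by simp
  also have "\<dots> \<le> 2 * (Xnorm_sq s b (\<lambda>p. xt_fourier F p - g k p) + Xnorm_sq s b (\<lambda>p. g k p - f p))"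
    by (intro Xnorm_sq_add_le) measurable
  also have "\<dots> \<le> 2 * (ennreal (e / 4) + ennreal (e / 4))"
    using k F by (intro mult_left_mono add_mono) auto
  also have "\<dots> = ennreal e"
    using e by (simp flip: ennreal_plus ennreal_numeral ennreal_mult)
  finally show "\<exists>F. F \<in> Y_space \<and> xt_integrable F \<and> Xnorm_sq s b (xt_fourier F) < \<infinity>
        \<and> Xnorm_sq s b (\<lambda>p. xt_fourier F p - f p) \<le> ennreal e"
    using F by blast
qed

lemma X_space_of_fourier:
  assumes "F \<in> Y_space" "xt_integrable F" "Xnorm_sq s b (xt_fourier F) < \<infinity>"
  shows "xt_fourier F \<in> X_space s b"
proof (rule X_spaceI)
  show "xt_fourier F \<in> borel_measurable freq" using assms by measurable
  show "\<exists>F'. F' \<in> Y_space \<and> xt_integrable F' \<and> Xnorm_sq s b (xt_fourier F') < \<infinity>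
        \<and> Xnorm_sq s b (\<lambda>p. xt_fourier F' p - xt_fourier F p) \<le> ennreal e" for e
    using assms by (intro exI[of _ F]) (simp add: Xnorm_sq_weight)
qed

lemma smooth_differentiable: "smooth f \<Longrightarrow> vderiv_iter k f differentiable (at t)"
  by (simp add: smooth_def)

lemma vderiv_iter_Suc: "vderiv_iter (Suc k) f = (\<lambda>t. vector_derivative (vderiv_iter k f) (at t))"
  by (simp add: vderiv_iter_def)

lemma vderiv_iter_0: "vderiv_iter 0 f = f"
  by (simp add: vderiv_iter_def)

lemma vderiv_iter_add:
  assumes "smooth f" "smooth g"
  shows "vderiv_iter k (\<lambda>t. f t + g t) = (\<lambda>t. vderiv_iter k f t + vderiv_iter k g t)"
proof (induction k)
  case (Suc k)
  then show ?case
    using smooth_differentiable[OF assms(1)] smooth_differentiable[OF assms(2)]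
    unfolding vderiv_iter_Suc by (simp add: vector_derivative_add_at)
qed (simp add: vderiv_iter_0)

lemma vderiv_iter_cmult:
  assumes "smooth f"
  shows "vderiv_iter k (\<lambda>t. c * f t) = (\<lambda>t. c * vderiv_iter k f t)"
proof (induction k)
  case (Suc k)
  then show ?case
    using smooth_differentiable[OF assms]
    unfolding vderiv_iter_Suc by (simp add: vector_derivative_mult_at)
qed (simp add: vderiv_iter_0)

lemma smooth_add: "smooth f \<Longrightarrow> smooth g \<Longrightarrow> smooth (\<lambda>t. f t + g t)"
  unfolding smooth_def[of "\<lambda>t. f t + g t"]
  by (simp add: vderiv_iter_add smooth_differentiable differentiable_add)

lemma smooth_cmult: "smooth f \<Longrightarrow> smooth (\<lambda>t. c * f t)"
  unfolding smooth_def[of "\<lambda>t. c * f t"]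
  by (simp add: vderiv_iter_cmult smooth_differentiable differentiable_mult)

lemma schwartz_add:
  assumes f: "schwartz f" and g: "schwartz g"
  shows "schwartz (\<lambda>t. f t + g t)"
proof -
  have sm: "smooth f" "smooth g" using f g by (auto simp: schwartz_def)
  have "\<exists>C. \<forall>t. \<bar>t\<bar> ^ j * norm (vderiv_iter k f t + vderiv_iter k g t) \<le> C" for j k
  proof -
    obtain C D where C: "\<And>t. \<bar>t\<bar> ^ j * norm (vderiv_iter k f t) \<le> C"
      and D: "\<And>t. \<bar>t\<bar> ^ j * norm (vderiv_iter k g t) \<le> D"
      using f g unfolding schwartz_def by meson
    have "\<bar>t\<bar> ^ j * norm (vderiv_iter k f t + vderiv_iter k g t) \<le> C + D" for t
      using mult_left_mono[OF norm_triangle_ineq[of "vderiv_iter k f t" "vderiv_iter k g t"], of "\<bar>t\<bar> ^ j"] C[of t] D[of t]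
      by (simp add: distrib_left)
    then show ?thesis by blast
  qed
  then show ?thesis using sm by (simp add: schwartz_def smooth_add vderiv_iter_add)
qed

lemma schwartz_cmult:
  assumes f: "schwartz f"
  shows "schwartz (\<lambda>t. c * f t)"
proof -
  have sm: "smooth f" using f by (auto simp: schwartz_def)
  have "\<exists>C. \<forall>t. \<bar>t\<bar> ^ j * norm (c * vderiv_iter k f t) \<le> C" for j k
  proof -
    obtain C where C: "\<And>t. \<bar>t\<bar> ^ j * norm (vderiv_iter k f t) \<le> C"
      using f unfolding schwartz_def by meson
    have "\<bar>t\<bar> ^ j * norm (c * vderiv_iter k f t) \<le> norm c * C" for t
      using mult_left_mono[OF C, of "norm c"] by (simp add: norm_mult mult_ac)
    then show ?thesis by blast
  qed
  then show ?thesis using sm by (simp add: schwartz_def smooth_cmult vderiv_iter_cmult)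
qed

lemma Y_space_add: "F \<in> Y_space \<Longrightarrow> G \<in> Y_space \<Longrightarrow> (\<lambda>x t. F x t + G x t) \<in> Y_space"
  by (simp add: Y_space_def smooth_add schwartz_add)

lemma Y_space_cmult: "F \<in> Y_space \<Longrightarrow> (\<lambda>x t. c * F x t) \<in> Y_space"
  by (simp add: Y_space_def smooth_cmult schwartz_cmult)

lemma xt_integrable_add: "xt_integrable F \<Longrightarrow> xt_integrable G \<Longrightarrow> xt_integrable (\<lambda>x t. F x t + G x t)"
  unfolding xt_integrable_def using set_integral_add(1)[of lborel "{0..2 * pi} \<times> UNIV" "\<lambda>(x, t). F x t" "\<lambda>(x, t). G x t"]
  by (simp add: case_prod_beta')

lemma xt_integrable_cmult: "xt_integrable F \<Longrightarrow> xt_integrable (\<lambda>x t. c * F x t)"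
  unfolding xt_integrable_def
  using set_integrable_mult_right[of c lborel "{0..2 * pi} \<times> UNIV" "\<lambda>(x, t). F x t"]
  by (simp add: case_prod_beta')

text \<open>The Fourier phase has modulus one, so it does not affect integrability; this is what linearity of the transform requires.\<close>
lemma xt_integrable_modulated:
  assumes "xt_integrable F"
  shows "set_integrable lborel ({0..2 * pi} \<times> UNIV) (\<lambda>(x, t). cis (- (t * \<tau> + x * of_int n)) * F x t)"
proof -
  define h where "h q = indicator ({0..2 * pi} \<times> UNIV) q *\<^sub>R (case q of (x, t) \<Rightarrow> F x t)" for q :: "real \<times> real"
  have int: "integrable lborel h"
    using assms unfolding xt_integrable_def set_integrable_def h_def[abs_def] .
  have "(\<lambda>q :: real \<times> real. cis (- (snd q * \<tau> + fst q * of_int n))) \<in> borel_measurable borel"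
    by (intro borel_measurable_continuous_onI continuous_intros)
  moreover have "h \<in> borel_measurable borel"
    using borel_measurable_integrable[OF int] by simp
  ultimately have "(\<lambda>q :: real \<times> real. cis (- (snd q * \<tau> + fst q * of_int n)) * h q) \<in> borel_measurable borel"
    by (rule borel_measurable_times)
  then have m: "(\<lambda>q :: real \<times> real. cis (- (snd q * \<tau> + fst q * of_int n)) * h q) \<in> borel_measurable lborel"
    by simp
  have "integrable lborel (\<lambda>q. cis (- (snd q * \<tau> + fst q * of_int n)) * h q)"
    by (rule Bochner_Integration.integrable_bound[OF int m]) (auto simp: norm_mult)
  also have "(\<lambda>q. cis (- (snd q * \<tau> + fst q * of_int n)) * h q) = (\<lambda>q. indicator ({0..2 * pi} \<times> UNIV) q *\<^sub>R (case q of (x, t) \<Rightarrow> cis (- (t * \<tau> + x * of_int n)) * F x t))"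
    by (auto simp: h_def case_prod_beta')
  finally show ?thesis unfolding set_integrable_def .
qed

lemma xt_fourier_add:
  assumes "xt_integrable F" "xt_integrable G"
  shows "xt_fourier (\<lambda>x t. F x t + G x t) = (\<lambda>p. xt_fourier F p + xt_fourier G p)"
proof
  fix p :: "real \<times> int"
  obtain \<tau> n where p: "p = (\<tau>, n)" by (cases p)
  show "xt_fourier (\<lambda>x t. F x t + G x t) p = xt_fourier F p + xt_fourier G p"
    using set_integral_add(2)[OF xt_integrable_modulated[OF assms(1), of \<tau> n] xt_integrable_modulated[OF assms(2), of \<tau> n]]
    by (simp add: xt_fourier_def p case_prod_beta' distrib_left)
qed

lemma xt_fourier_cmult: "xt_fourier (\<lambda>x t. c * F x t) = (\<lambda>p. c * xt_fourier F p)"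
proof
  fix p :: "real \<times> int"
  obtain \<tau> n where p: "p = (\<tau>, n)" by (cases p)
  show "xt_fourier (\<lambda>x t. c * F x t) p = c * xt_fourier F p"
    using set_integral_mult_right[of lborel "{0..2 * pi} \<times> UNIV" c "\<lambda>(x, t). cis (- (t * \<tau> + x * of_int n)) * F x t"]
    by (simp add: xt_fourier_def p case_prod_beta' mult_ac)
qed

lemma X_space_add:
  assumes "f \<in> X_space s b" "g \<in> X_space s b"
  shows "(\<lambda>p. f p + g p) \<in> X_space s b"
proof (rule X_spaceI)
  have [measurable]: "f \<in> borel_measurable freq" "g \<in> borel_measurable freq"
    using assms by (auto intro: X_space_measurable)
  show "(\<lambda>p. f p + g p) \<in> borel_measurable freq" by measurable
  fix e :: real assume e: "0 < e"
  obtain F where F: "F \<in> Y_space" "xt_integrable F" "Xnorm_sq s b (xt_fourier F) < \<infinity>"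
     "Xnorm_sq s b (\<lambda>p. xt_fourier F p - f p) \<le> ennreal (e / 4)"
    using X_space_approx[OF assms(1), of "e / 4"] e by auto
  obtain G where G: "G \<in> Y_space" "xt_integrable G" "Xnorm_sq s b (xt_fourier G) < \<infinity>"
     "Xnorm_sq s b (\<lambda>p. xt_fourier G p - g p) \<le> ennreal (e / 4)"
    using X_space_approx[OF assms(2), of "e / 4"] e by auto
  have [measurable]: "xt_fourier F \<in> borel_measurable freq" "xt_fourier G \<in> borel_measurable freq"
    using F G by measurable
  have "Xnorm_sq s b (\<lambda>p. (xt_fourier F p - f p) + (xt_fourier G p - g p))
     \<le> 2 * (Xnorm_sq s b (\<lambda>p. xt_fourier F p - f p) + Xnorm_sq s b (\<lambda>p. xt_fourier G p - g p))"
    by (intro Xnorm_sq_add_le) measurable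
  also have "\<dots> \<le> 2 * (ennreal (e / 4) + ennreal (e / 4))"
    using F G by (intro mult_left_mono add_mono) auto
  also have "\<dots> = ennreal e"
    using e by (simp flip: ennreal_plus ennreal_numeral ennreal_mult)
  finally have "Xnorm_sq s b (\<lambda>p. (xt_fourier F p + xt_fourier G p) - (f p + g p)) \<le> ennreal e"
    by (simp add: algebra_simps)
  moreover have "Xnorm_sq s b (\<lambda>p. xt_fourier F p + xt_fourier G p) < \<infinity>"
    using F G by (intro le_less_trans[OF Xnorm_sq_add_le]) (auto simp: ennreal_mult_less_top)
  ultimately show "\<exists>F. F \<in> Y_space \<and> xt_integrable F \<and> Xnorm_sq s b (xt_fourier F) < \<infinity>
        \<and> Xnorm_sq s b (\<lambda>p. xt_fourier F p - (f p + g p)) \<le> ennreal e"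
    using F G by (intro exI[of _ "\<lambda>x t. F x t + G x t"]) (simp add: Y_space_add xt_integrable_add xt_fourier_add)
qed

lemma X_space_cmult:
  assumes "f \<in> X_space s b"
  shows "(\<lambda>p. c * f p) \<in> X_space s b"
proof (rule X_spaceI)
  have [measurable]: "f \<in> borel_measurable freq"
    using assms by (auto intro: X_space_measurable)
  show "(\<lambda>p. c * f p) \<in> borel_measurable freq" by measurable
  fix e :: real assume e: "0 < e"
  define d where "d = e / (1 + (norm c)\<^sup>2)"
  have d: "0 < d" "(norm c)\<^sup>2 * d \<le> e"
    using e by (auto simp: d_def field_simps add_pos_nonneg)
  obtain F where F: "F \<in> Y_space" "xt_integrable F" "Xnorm_sq s b (xt_fourier F) < \<infinity>"
     "Xnorm_sq s b (\<lambda>p. xt_fourier F p - f p) \<le> ennreal d"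
    using X_space_approx[OF assms(1) d(1)] by auto
  have [measurable]: "xt_fourier F \<in> borel_measurable freq"
    using F by measurable
  have "Xnorm_sq s b (\<lambda>p. c * (xt_fourier F p - f p)) = (ennreal (norm c))\<^sup>2 * Xnorm_sq s b (\<lambda>p. xt_fourier F p - f p)"
    by (rule Xnorm_sq_cmult) measurable
  also have "\<dots> \<le> (ennreal (norm c))\<^sup>2 * ennreal d" using F by (intro mult_left_mono) auto
  also have "\<dots> \<le> ennreal e" using d by (simp add: ennreal_power ennreal_leI flip: ennreal_mult)
  finally have "Xnorm_sq s b (\<lambda>p. c * xt_fourier F p - c * f p) \<le> ennreal e"
    by (simp add: algebra_simps)
  moreover have "Xnorm_sq s b (\<lambda>p. c * xt_fourier F p) < \<infinity>"
    using F by (subst Xnorm_sq_cmult) (auto simp: ennreal_mult_less_top ennreal_power)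
  ultimately show "\<exists>F. F \<in> Y_space \<and> xt_integrable F \<and> Xnorm_sq s b (xt_fourier F) < \<infinity>
        \<and> Xnorm_sq s b (\<lambda>p. xt_fourier F p - c * f p) \<le> ennreal e"
    using F by (intro exI[of _ "\<lambda>x t. c * F x t"]) (simp add: Y_space_cmult xt_integrable_cmult xt_fourier_cmult)
qed

lemma X_space_zero: "(\<lambda>p. 0) \<in> X_space s b"
proof -
  have "smooth (\<lambda>t. 0)"
  proof -
    have "vderiv_iter k (\<lambda>t. 0) = (\<lambda>t. 0)" for k
      by (induction k) (simp_all add: vderiv_iter_0 vderiv_iter_Suc)
    then show ?thesis by (simp add: smooth_def)
  qed
  moreover from this have "schwartz (\<lambda>t. 0)"
    using vderiv_iter_cmult[of "\<lambda>t. 0" _ 0] by (auto simp: schwartz_def)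
  ultimately have "(\<lambda>x t. 0) \<in> Y_space" by (simp add: Y_space_def)
  moreover have "xt_integrable (\<lambda>x t. 0)" by (simp add: xt_integrable_def set_integrable_def case_prod_beta')
  moreover have "xt_fourier (\<lambda>x t. 0) = (\<lambda>p. 0)" by (auto simp: xt_fourier_def set_lebesgue_integral_def case_prod_beta')
  ultimately show ?thesis
    using X_space_of_fourier[of "\<lambda>x t. 0" s b] by (simp add: Xnorm_sq_weight)
qed

lemma X_space_sum:
  assumes "\<And>i. i \<in> I \<Longrightarrow> f i \<in> X_space s b"
  shows "(\<lambda>p. \<Sum>i\<in>I. f i p) \<in> X_space s b"
  using assms by (induction I rule: infinite_finite_induct) (auto simp: X_space_zero X_space_add)

section \<open>Wave packets and their Fourier transforms\<close>

text \<open>A monomial of even degree is dominated by a single term of the exponential series at \<open>u\<^sup>2/2\<close>.\<close>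
lemma poly_times_gaussian_bounded: "\<exists>C. \<forall>u::real. \<bar>poly q u\<bar> * exp (- u\<^sup>2 / 2) \<le> C"
proof -
  have mono: "\<bar>u\<bar> ^ n * exp (- u\<^sup>2 / 2) \<le> 1 + 2 ^ n * fact n" for u :: real and n :: nat
  proof -
    have "(u\<^sup>2 / 2) ^ n / fact n \<le> exp (u\<^sup>2 / 2)"
    proof -
      have "(\<Sum>k\<in>{n}. (u\<^sup>2 / 2) ^ k /\<^sub>R fact k) \<le> (\<Sum>k. (u\<^sup>2 / 2) ^ k /\<^sub>R fact k)"
        by (intro sum_le_suminf summable_exp_generic) auto
      then show ?thesis unfolding exp_def by (simp add: divide_inverse_commute[of _ "fact n"])
    qed
    then have e: "(u\<^sup>2) ^ n \<le> 2 ^ n * fact n * exp (u\<^sup>2 / 2)"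
      by (simp add: power_divide field_simps)
    have "\<bar>u\<bar> ^ n \<le> 1 + (\<bar>u\<bar> ^ n)\<^sup>2"
    proof (cases "\<bar>u\<bar> ^ n \<le> 1")
      case False
      then have "\<bar>u\<bar> ^ n * 1 \<le> \<bar>u\<bar> ^ n * \<bar>u\<bar> ^ n" by (intro mult_left_mono) auto
      then show ?thesis by (simp add: power2_eq_square)
    qed (simp add: add_increasing2)
    also have "(\<bar>u\<bar> ^ n)\<^sup>2 = (u\<^sup>2) ^ n" by (simp flip: power_mult add: mult.commute power_even_abs)
    also have "1 + (u\<^sup>2) ^ n \<le> exp (u\<^sup>2 / 2) + 2 ^ n * fact n * exp (u\<^sup>2 / 2)"
      using e by (intro add_mono) auto
    finally have "\<bar>u\<bar> ^ n \<le> (1 + 2 ^ n * fact n) * exp (u\<^sup>2 / 2)" by (simp add: algebra_simps)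
    then have "\<bar>u\<bar> ^ n * exp (- u\<^sup>2 / 2) \<le> (1 + 2 ^ n * fact n) * exp (u\<^sup>2 / 2) * exp (- u\<^sup>2 / 2)"
      by (intro mult_right_mono) auto
    then show ?thesis by (simp add: mult.assoc flip: exp_add)
  qed
  have "\<bar>poly q u\<bar> * exp (- u\<^sup>2 / 2) \<le> (\<Sum>i\<le>degree q. \<bar>coeff q i\<bar> * (1 + 2 ^ i * fact i))" for u :: real
  proof -
    have "\<bar>poly q u\<bar> \<le> (\<Sum>i\<le>degree q. \<bar>coeff q i\<bar> * \<bar>u\<bar> ^ i)"
      unfolding poly_altdef by (rule order_trans[OF sum_abs]) (simp add: abs_mult power_abs)
    then have "\<bar>poly q u\<bar> * exp (- u\<^sup>2 / 2) \<le> (\<Sum>i\<le>degree q. \<bar>coeff q i\<bar> * \<bar>u\<bar> ^ i) * exp (- u\<^sup>2 / 2)"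
      by (intro mult_right_mono) auto
    also have "\<dots> = (\<Sum>i\<le>degree q. \<bar>coeff q i\<bar> * (\<bar>u\<bar> ^ i * exp (- u\<^sup>2 / 2)))"
      by (simp add: sum_distrib_right mult.assoc)
    also have "\<dots> \<le> (\<Sum>i\<le>degree q. \<bar>coeff q i\<bar> * (1 + 2 ^ i * fact i))"
      by (intro sum_mono mult_left_mono mono) auto
    finally show ?thesis .
  qed
  then show ?thesis by blast
qed

text \<open>The class of polynomials times a fixed Gaussian is stable under differentiation, so all derivatives of a Gaussian can be bounded at once.\<close>
definition poly_gaussian :: "real poly \<Rightarrow> real \<Rightarrow> real \<Rightarrow> complex" where
  "poly_gaussian p c t = complex_of_real (poly p (t - c) * exp (- (t - c)\<^sup>2 / 2))"

lemma poly_gaussian_deriv: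
  "(poly_gaussian p c has_vector_derivative poly_gaussian (pderiv p - [:0, 1:] * p) c t) (at t)"
proof -
  have "((\<lambda>t. poly p (t - c) * exp (- (t - c)\<^sup>2 / 2)) has_real_derivative
      poly (pderiv p - [:0, 1:] * p) (t - c) * exp (- (t - c)\<^sup>2 / 2)) (at t)"
  proof -
    have d1: "((\<lambda>t. poly p (t - c)) has_real_derivative poly (pderiv p) (t - c)) (at t)"
      by (auto intro!: derivative_eq_intros)
    have d2: "((\<lambda>t. exp (- (t - c)\<^sup>2 / 2)) has_real_derivative - (t - c) * exp (- (t - c)\<^sup>2 / 2)) (at t)"
      by (auto intro!: derivative_eq_intros simp: left_diff_distrib right_diff_distrib diff_divide_distrib)
    from DERIV_mult[OF d1 d2] show ?thesis
      by (simp add: algebra_simps)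
  qed
  then have "((\<lambda>t. poly p (t - c) * exp (- (t - c)\<^sup>2 / 2)) has_vector_derivative
      poly (pderiv p - [:0, 1:] * p) (t - c) * exp (- (t - c)\<^sup>2 / 2)) (at t)"
    by (simp add: has_real_derivative_iff_has_vector_derivative)
  then show ?thesis
    unfolding poly_gaussian_def[abs_def]
    by (rule bounded_linear.has_vector_derivative[OF bounded_linear_of_real])
qed

lemma vderiv_iter_poly_gaussian: "\<exists>q. vderiv_iter k (poly_gaussian p c) = poly_gaussian q c"
proof (induction k)
  case 0
  then show ?case by (auto simp: vderiv_iter_0)
next
  case (Suc k)
  then obtain q where "vderiv_iter k (poly_gaussian p c) = poly_gaussian q c" by blast
  then have "vderiv_iter (Suc k) (poly_gaussian p c) = poly_gaussian (pderiv q - [:0, 1:] * q) c"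
    using vector_derivative_at[OF poly_gaussian_deriv[of q c]] by (simp add: vderiv_iter_Suc)
  then show ?case by blast
qed

lemma schwartz_poly_gaussian: "schwartz (poly_gaussian p c)"
  unfolding schwartz_def
proof (intro conjI allI)
  show "smooth (poly_gaussian p c)"
    unfolding smooth_def
  proof (intro allI)
    fix k t
    obtain q where "vderiv_iter k (poly_gaussian p c) = poly_gaussian q c"
      using vderiv_iter_poly_gaussian by blast
    then show "vderiv_iter k (poly_gaussian p c) differentiable at t"
      using differentiableI_vector[OF poly_gaussian_deriv[of q c t]] by simp
  qed
  fix j k
  obtain q where q: "vderiv_iter k (poly_gaussian p c) = poly_gaussian q c"
    using vderiv_iter_poly_gaussian by blast
  obtain C where C: "\<And>u. \<bar>poly ([:c, 1:] ^ j * q) u\<bar> * exp (- u\<^sup>2 / 2) \<le> C"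
    using poly_times_gaussian_bounded by blast
  have "\<bar>t\<bar> ^ j * norm (poly_gaussian q c t) \<le> C" for t
    using C[of "t - c"] by (simp add: poly_gaussian_def abs_mult power_abs mult_ac norm_mult)
  then show "\<exists>C. \<forall>t. \<bar>t\<bar> ^ j * norm (vderiv_iter k (poly_gaussian p c) t) \<le> C"
    unfolding q by blast
qed

lemma smooth_character: "smooth (\<lambda>x. z * cis (m * x))"
proof -
  have d: "((\<lambda>x. w * cis (m * x)) has_vector_derivative (w * (\<i> * of_real m)) * cis (m * x)) (at x)" for w x
  proof -
    have "((\<lambda>x. cis (m * x)) has_vector_derivative m *\<^sub>R (\<i> * cis (m * x))) (at x)"
      unfolding has_vector_derivative_def
      by (rule derivative_eq_intros refl | simp add: scaleR_conv_of_real mult_ac)+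
    then have "((\<lambda>x. w * cis (m * x)) has_vector_derivative w * (m *\<^sub>R (\<i> * cis (m * x)))) (at x)"
      by (rule has_vector_derivative_mult_right)
    then show ?thesis by (simp add: scaleR_conv_of_real mult_ac)
  qed
  have "vderiv_iter k (\<lambda>x. z * cis (m * x)) = (\<lambda>x. (z * (\<i> * of_real m) ^ k) * cis (m * x))" for k
  proof (induction k)
    case (Suc k)
    then show ?case
      using vector_derivative_at[OF d[of "z * (\<i> * of_real m) ^ k"]]
      by (simp add: vderiv_iter_Suc mult_ac)
  qed (simp add: vderiv_iter_0)
  then show ?thesis
    using differentiableI_vector[OF d] by (simp only: smooth_def simp_thms)
qed

definition wave_packet :: "int \<Rightarrow> real \<Rightarrow> real \<Rightarrow> real \<Rightarrow> complex" where
  "wave_packet m c x t = poly_gaussian 1 c t * cis (of_int m * x)"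

lemma wave_packet_Y_space: "wave_packet m c \<in> Y_space"
proof -
  have "wave_packet m c (x + 2 * pi) t = wave_packet m c x t" for x t
  proof -
    have "cis (of_int m * (x + 2 * pi)) = cis (of_int m * x) * cis (2 * pi * of_int m)"
      by (simp add: cis_mult algebra_simps)
    then show ?thesis unfolding wave_packet_def by simp
  qed
  moreover have "schwartz (\<lambda>t. wave_packet m c x t)" for x
    using schwartz_cmult[OF schwartz_poly_gaussian[of 1 c], of "cis (of_int m * x)"]
    by (simp add: wave_packet_def mult.commute)
  moreover have "smooth (\<lambda>x. wave_packet m c x t)" for t
    unfolding wave_packet_def by (rule smooth_character)
  ultimately show ?thesis unfolding Y_space_def by blast
qed

lemma integrable_product:
  fixes f g :: "real \<Rightarrow> complex"
  assumes f: "integrable lborel f" and g: "integrable lborel g"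
  shows "integrable lborel (\<lambda>q. f (fst q) * g (snd q))"
    and "(LINT q|lborel. f (fst q) * g (snd q)) = (LINT x|lborel. f x) * (LINT t|lborel. g t)"
proof -
  have mf: "f \<in> borel_measurable lborel" and mg: "g \<in> borel_measurable lborel"
    using f g by (auto dest: borel_measurable_integrable)
  have m: "(\<lambda>q. f (fst q) * g (snd q)) \<in> borel_measurable (lborel \<Otimes>\<^sub>M lborel)"
    by (intro borel_measurable_times measurable_compose[OF measurable_fst mf] measurable_compose[OF measurable_snd mg])
  have int: "integrable (lborel \<Otimes>\<^sub>M lborel) (\<lambda>q. f (fst q) * g (snd q))"
  proof (rule lborel_pair.Fubini_integrable[OF m])
    show "integrable lborel (\<lambda>x. LINT y|lborel. norm (f (fst (x, y)) * g (snd (x, y))))"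
      using f g by (simp add: norm_mult)
    show "AE x in lborel. integrable lborel (\<lambda>y. f (fst (x, y)) * g (snd (x, y)))"
      using g by simp
  qed
  then show "integrable lborel (\<lambda>q. f (fst q) * g (snd q))" by (simp only: lborel_prod)
  have "(LINT q|lborel. f (fst q) * g (snd q)) = (LINT x|lborel. LINT t|lborel. f (fst (x, t)) * g (snd (x, t)))"
    using lborel_pair.integral_fst'[OF int] by (simp only: lborel_prod)
  also have "\<dots> = (LINT x|lborel. f x) * (LINT t|lborel. g t)" using f g by simp
  finally show "(LINT q|lborel. f (fst q) * g (snd q)) = (LINT x|lborel. f x) * (LINT t|lborel. g t)" .
qed

lemma character_integral:
  "integrable lborel (\<lambda>x. indicator {0..2 * pi} x *\<^sub>R cis (of_int k * x))"
  "(LINT x|lborel. indicator {0..2 * pi} x *\<^sub>R cis (of_int k * x)) = (if k = 0 then of_real (2 * pi) else 0)"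
proof -
  show "integrable lborel (\<lambda>x. indicator {0..2 * pi} x *\<^sub>R cis (of_int k * x))"
    by (intro borel_integrable_compact continuous_intros) auto
  show "(LINT x|lborel. indicator {0..2 * pi} x *\<^sub>R cis (of_int k * x)) = (if k = 0 then of_real (2 * pi) else 0)"
  proof (cases "k = 0")
    case True
    have "(LINT x|lborel. indicator {0..2 * pi} x *\<^sub>R (1::complex)) = of_real (2 * pi) - of_real 0"
      by (rule integral_FTC_Icc) (auto intro!: derivative_eq_intros continuous_intros simp: has_vector_derivative_def scaleR_conv_of_real)
    then show ?thesis using True by simp
  next
    case False
    define F where "F x = cis (of_int k * x) / (\<i> * of_int k)" for x
    have "(F has_vector_derivative cis (of_int k * x)) (at x within S)" for x S
    proof -
      have "((\<lambda>x. cis (of_int k * x)) has_vector_derivative of_int k *\<^sub>R (\<i> * cis (of_int k * x))) (at x within S)"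
        unfolding has_vector_derivative_def
        by (rule derivative_eq_intros refl | simp add: scaleR_conv_of_real mult_ac)+
      from has_vector_derivative_divide[OF this, of "\<i> * of_int k"] False
      show ?thesis unfolding F_def[abs_def] by (simp add: scaleR_conv_of_real)
    qed
    then have "(LINT x|lborel. indicator {0..2 * pi} x *\<^sub>R cis (of_int k * x)) = F (2 * pi) - F 0"
      by (intro integral_FTC_Icc continuous_intros) auto
    also have "F (2 * pi) = F 0"
      using cis_multiple_2pi[of "of_int k"] by (simp add: F_def mult_ac)
    finally show ?thesis using False by simp
  qed
qed

text \<open>Up to translation and normalization this is the characteristic function of the standard normal distribution.\<close>
lemma gaussian_fourier:
  "integrable lborel (\<lambda>t. cis (- (t * \<tau>)) * poly_gaussian 1 c t)"
  "(LINT t|lborel. cis (- (t * \<tau>)) * poly_gaussian 1 c t) = of_real (sqrt (2 * pi)) * (of_real (exp (- \<tau>\<^sup>2 / 2)) * cis (- (c * \<tau>)))"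
proof -
  define g where "g t = of_real (sqrt (2 * pi)) * (std_normal_density t *\<^sub>R cis (- (t * \<tau>)))" for t
  have mg: "(\<lambda>t. cis (- (t * \<tau>))) \<in> borel_measurable borel"
    by (intro borel_measurable_continuous_onI continuous_intros)
  have ig: "integrable lborel (\<lambda>t. std_normal_density t *\<^sub>R cis (- (t * \<tau>)))"
  proof (rule Bochner_Integration.integrable_bound[OF integrable_normal_density[of 1 0]])
    show "(\<lambda>t. std_normal_density t *\<^sub>R cis (- (t * \<tau>))) \<in> borel_measurable lborel"
      using mg by simp
  qed auto
  have "(LINT t|lborel. std_normal_density t *\<^sub>R cis (- (t * \<tau>))) = (LINT t|std_normal_distribution. cis (- (t * \<tau>)))"
    using mg by (subst integral_density) auto
  also have "\<dots> = char std_normal_distribution (- \<tau>)"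
    by (simp add: char_def cis_conv_exp mult_ac)
  also have "\<dots> = of_real (exp (- \<tau>\<^sup>2 / 2))" by (simp add: char_std_normal_distribution)
  finally have eg: "(LINT t|lborel. g t) = of_real (sqrt (2 * pi)) * of_real (exp (- \<tau>\<^sup>2 / 2))"
    unfolding g_def integral_mult_right_zero by (simp only:)
  have ig: "integrable lborel g" unfolding g_def by (intro integrable_mult_right ig)
  have shift: "cis (- (t * \<tau>)) * poly_gaussian 1 c t = cis (- (c * \<tau>)) * g (- c + 1 * t)" for t
  proof -
    have "cis (- (t * \<tau>)) = cis (- (c * \<tau>)) * cis (- ((t - c) * \<tau>))"
      by (simp add: cis_mult algebra_simps)
    then show ?thesis
      by (simp add: g_def poly_gaussian_def std_normal_density_def scaleR_conv_of_real)
  qed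
  show "integrable lborel (\<lambda>t. cis (- (t * \<tau>)) * poly_gaussian 1 c t)"
    unfolding shift using lborel_integrable_real_affine[OF ig, of 1 "- c"] by simp
  have "(LINT t|lborel. cis (- (t * \<tau>)) * poly_gaussian 1 c t) = cis (- (c * \<tau>)) * (LINT t|lborel. g (- c + 1 * t))"
    unfolding shift by simp
  also have "(LINT t|lborel. g (- c + 1 * t)) = (LINT t|lborel. g t)"
    using lborel_integral_real_affine[of 1 g "- c"] by simp
  finally show "(LINT t|lborel. cis (- (t * \<tau>)) * poly_gaussian 1 c t) = of_real (sqrt (2 * pi)) * (of_real (exp (- \<tau>\<^sup>2 / 2)) * cis (- (c * \<tau>)))"
    unfolding eg by (simp add: mult_ac)
qed

lemma wave_packet_integrable: "xt_integrable (wave_packet m c)"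
proof -
  have "integrable lborel (\<lambda>q. (indicator {0..2 * pi} (fst q) *\<^sub>R cis (of_int m * fst q)) * (cis (- (snd q * 0)) * poly_gaussian 1 c (snd q)))"
    by (rule integrable_product(1)[OF character_integral(1) gaussian_fourier(1)])
  also have "(\<lambda>q. (indicator {0..2 * pi} (fst q) *\<^sub>R cis (of_int m * fst q)) * (cis (- (snd q * 0)) * poly_gaussian 1 c (snd q)))
      = (\<lambda>q. indicator ({0..2 * pi} \<times> UNIV) q *\<^sub>R (case q of (x, t) \<Rightarrow> wave_packet m c x t))"
    by (auto simp: wave_packet_def indicator_def)
  finally show ?thesis unfolding xt_integrable_def set_integrable_def .
qed

lemma xt_fourier_wave_packet:
  "xt_fourier (wave_packet m c) (\<tau>, n) = (if n = m then of_real (2 * pi * sqrt (2 * pi)) * (of_real (exp (- \<tau>\<^sup>2 / 2)) * cis (- (c * \<tau>))) else 0)"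
proof -
  have "xt_fourier (wave_packet m c) (\<tau>, n) = (LINT q|lborel. indicator ({0..2 * pi} \<times> UNIV) q *\<^sub>R
      (case q of (x, t) \<Rightarrow> cis (- (t * \<tau> + x * of_int n)) * wave_packet m c x t))"
    unfolding xt_fourier_def set_lebesgue_integral_def by simp
  also have "\<dots> = (LINT q|lborel. (indicator {0..2 * pi} (fst q) *\<^sub>R cis (of_int (m - n) * fst q)) * (cis (- (snd q * \<tau>)) * poly_gaussian 1 c (snd q)))"
  proof (intro Bochner_Integration.integral_cong refl)
    fix q :: "real \<times> real"
    have "cis (- (snd q * \<tau> + fst q * of_int n)) * cis (of_int m * fst q) = cis (of_int (m - n) * fst q) * cis (- (snd q * \<tau>))"
      by (simp add: cis_mult algebra_simps)
    then show "indicator ({0..2 * pi} \<times> UNIV) q *\<^sub>R (case q of (x, t) \<Rightarrow> cis (- (t * \<tau> + x * of_int n)) * wave_packet m c x t)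
      = (indicator {0..2 * pi} (fst q) *\<^sub>R cis (of_int (m - n) * fst q)) * (cis (- (snd q * \<tau>)) * poly_gaussian 1 c (snd q))"
      by (cases q) (simp add: wave_packet_def indicator_def mult_ac)
  qed
  also have "\<dots> = (if m - n = 0 then of_real (2 * pi) else 0) * (of_real (sqrt (2 * pi)) * (of_real (exp (- \<tau>\<^sup>2 / 2)) * cis (- (c * \<tau>))))"
    by (simp only: integrable_product(2)[OF character_integral(1) gaussian_fourier(1)] character_integral(2) gaussian_fourier(2))
  finally show ?thesis by auto
qed

section \<open>Density of the wave packets\<close>

text \<open>Functions carried by the single spatial mode \<open>m\<close>, with the Gaussian factor of the wave packets split off.\<close>
definition gaussian_mode :: "int \<Rightarrow> (real \<Rightarrow> complex) \<Rightarrow> real \<times> int \<Rightarrow> complex" where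
  "gaussian_mode m h = (\<lambda>(\<tau>, n). if n = m then of_real (exp (- \<tau>\<^sup>2 / 2)) * h \<tau> else 0)"

lemma gaussian_mode_measurable:
  assumes "h \<in> borel_measurable borel"
  shows "gaussian_mode m h \<in> borel_measurable freq"
proof (rule freq_measurable_split)
  fix k
  have "(\<lambda>\<tau>. complex_of_real (exp (- \<tau>\<^sup>2 / 2))) \<in> borel_measurable borel"
    by (intro borel_measurable_continuous_onI continuous_intros) auto
  from borel_measurable_times[OF this assms]
  have "(\<lambda>\<tau>. complex_of_real (exp (- \<tau>\<^sup>2 / 2)) * h \<tau>) \<in> borel_measurable borel" .
  then show "(\<lambda>\<tau>. gaussian_mode m h (\<tau>, k)) \<in> borel_measurable borel"
    by (cases "k = m") (simp_all only: gaussian_mode_def case_prod_conv refl if_True if_False borel_measurable_const)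
qed

lemma nn_integral_freq_single_mode:
  assumes "f \<in> borel_measurable freq" "\<And>t k. k \<noteq> m \<Longrightarrow> f (t, k) = 0"
  shows "(\<integral>\<^sup>+p. f p \<partial>freq) = (\<integral>\<^sup>+t. f (t, m) \<partial>lborel)"
proof -
  have "(\<integral>\<^sup>+p. f p \<partial>freq) = (\<integral>\<^sup>+k. (\<integral>\<^sup>+t. f (t, m) \<partial>lborel) * indicator {m} k \<partial>count_space UNIV)"
    unfolding nn_integral_freq[OF assms(1)]
    by (intro nn_integral_cong) (auto simp: indicator_def assms(2))
  also have "\<dots> = (\<integral>\<^sup>+t. f (t, m) \<partial>lborel)"
    by (simp add: nn_integral_cmult_indicator)
  finally show ?thesis .
qed

text \<open>As \<open>b \<le> 0\<close>, the modulation weight is at most one, and on a single mode the norm is controlled by an unweighted integral in \<open>\<tau>\<close>.\<close>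
lemma Xnorm_sq_gaussian_mode_le:
  assumes b: "b \<le> 0" and h: "h \<in> borel_measurable borel"
  shows "Xnorm_sq s b (gaussian_mode m h)
     \<le> ennreal ((jbr (of_int m) powr s)\<^sup>2) * (\<integral>\<^sup>+t. ennreal ((exp (- t\<^sup>2 / 2) * norm (h t))\<^sup>2) \<partial>lborel)"
proof -
  note [measurable] = gaussian_mode_measurable[OF h, of m]
  note [measurable] = h
  have "Xnorm_sq s b (gaussian_mode m h) = (\<integral>\<^sup>+t. (ennreal (Xweight s b (t, m) * norm (gaussian_mode m h (t, m))))\<^sup>2 \<partial>lborel)"
    unfolding Xnorm_sq_weight by (rule nn_integral_freq_single_mode) (measurable, simp add: gaussian_mode_def)
  also have "\<dots> \<le> (\<integral>\<^sup>+t. ennreal ((jbr (of_int m) powr s)\<^sup>2) * ennreal ((exp (- t\<^sup>2 / 2) * norm (h t))\<^sup>2) \<partial>lborel)"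
  proof (intro nn_integral_mono)
    fix t :: real
    have "Xweight s b (t, m) * norm (gaussian_mode m h (t, m)) \<le> (1 * jbr (of_int m) powr s) * (exp (- t\<^sup>2 / 2) * norm (h t))"
      unfolding Xweight_def using b
      by (intro mult_mono powr_le_1 modul_ge_1) (auto simp: gaussian_mode_def norm_mult freqsize_def)
    then have "(Xweight s b (t, m) * norm (gaussian_mode m h (t, m)))\<^sup>2 \<le> (jbr (of_int m) powr s * (exp (- t\<^sup>2 / 2) * norm (h t)))\<^sup>2"
      by (intro power_mono) auto
    then have "ennreal ((Xweight s b (t, m) * norm (gaussian_mode m h (t, m)))\<^sup>2) \<le> ennreal ((jbr (of_int m) powr s * (exp (- t\<^sup>2 / 2) * norm (h t)))\<^sup>2)"
      by (rule ennreal_leI)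
    then show "(ennreal (Xweight s b (t, m) * norm (gaussian_mode m h (t, m))))\<^sup>2 \<le> ennreal ((jbr (of_int m) powr s)\<^sup>2) * ennreal ((exp (- t\<^sup>2 / 2) * norm (h t))\<^sup>2)"
      by (simp add: ennreal_power power_mult_distrib flip: ennreal_mult)
  qed
  also have "\<dots> = ennreal ((jbr (of_int m) powr s)\<^sup>2) * (\<integral>\<^sup>+t. ennreal ((exp (- t\<^sup>2 / 2) * norm (h t))\<^sup>2) \<partial>lborel)"
    by (rule nn_integral_cmult) measurable
  finally show ?thesis .
qed

lemma gaussian_nn_integral_finite: "(\<integral>\<^sup>+t. ennreal (c * (exp (- t\<^sup>2 / 2))\<^sup>2) \<partial>lborel) < \<infinity>"
proof -
  have "(\<integral>\<^sup>+t. ennreal (c * (exp (- t\<^sup>2 / 2))\<^sup>2) \<partial>lborel)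
     \<le> (\<integral>\<^sup>+t. ennreal \<bar>c\<bar> * (ennreal (sqrt (2 * pi)) * ennreal (std_normal_density t)) \<partial>lborel)"
  proof (intro nn_integral_mono)
    fix t :: real
    have "(exp (- t\<^sup>2 / 2))\<^sup>2 \<le> exp (- t\<^sup>2 / 2) * 1"
      unfolding power2_eq_square by (intro mult_left_mono) auto
    then have "c * (exp (- t\<^sup>2 / 2))\<^sup>2 \<le> \<bar>c\<bar> * exp (- t\<^sup>2 / 2)"
      by (intro mult_mono) auto
    also have "\<dots> = \<bar>c\<bar> * (sqrt (2 * pi) * std_normal_density t)" by (simp add: std_normal_density_def)
    finally have "ennreal (c * (exp (- t\<^sup>2 / 2))\<^sup>2) \<le> ennreal (\<bar>c\<bar> * (sqrt (2 * pi) * std_normal_density t))"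
      by (rule ennreal_leI)
    then show "ennreal (c * (exp (- t\<^sup>2 / 2))\<^sup>2) \<le> ennreal \<bar>c\<bar> * (ennreal (sqrt (2 * pi)) * ennreal (std_normal_density t))"
      by (simp add: ennreal_mult)
  qed
  also have "\<dots> = ennreal \<bar>c\<bar> * (ennreal (sqrt (2 * pi)) * (\<integral>\<^sup>+t. ennreal (std_normal_density t) \<partial>lborel))"
    by (simp add: nn_integral_cmult)
  also have "(\<integral>\<^sup>+t. ennreal (std_normal_density t) \<partial>lborel) = 1"
    by (subst nn_integral_eq_integral) auto
  finally show ?thesis by (rule le_less_trans) (simp add: ennreal_mult_less_top)
qed

definition approximable_on_mode :: "real \<Rightarrow> real \<Rightarrow> int \<Rightarrow> (real \<Rightarrow> complex) set" where
  "approximable_on_mode s b m = {h \<in> borel_measurable borel. gaussian_mode m h \<in> X_space s b}"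

lemma approximable_on_mode_measurable: "h \<in> approximable_on_mode s b m \<Longrightarrow> h \<in> borel_measurable borel"
  by (simp add: approximable_on_mode_def)

lemma approximable_on_mode_add: "f \<in> approximable_on_mode s b m \<Longrightarrow> g \<in> approximable_on_mode s b m \<Longrightarrow> (\<lambda>t. f t + g t) \<in> approximable_on_mode s b m"
proof -
  assume fg: "f \<in> approximable_on_mode s b m" "g \<in> approximable_on_mode s b m"
  have "gaussian_mode m (\<lambda>t. f t + g t) = (\<lambda>p. gaussian_mode m f p + gaussian_mode m g p)"
    by (auto simp: gaussian_mode_def algebra_simps)
  moreover have "(\<lambda>t. f t + g t) \<in> borel_measurable borel"
    using fg by (intro borel_measurable_add approximable_on_mode_measurable)
  ultimately show ?thesis using fg X_space_add[of "gaussian_mode m f" s b "gaussian_mode m g"]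
    by (simp only: approximable_on_mode_def mem_Collect_eq simp_thms)
qed

lemma approximable_on_mode_cmult: "f \<in> approximable_on_mode s b m \<Longrightarrow> (\<lambda>t. c * f t) \<in> approximable_on_mode s b m"
proof -
  assume f: "f \<in> approximable_on_mode s b m"
  have "gaussian_mode m (\<lambda>t. c * f t) = (\<lambda>p. c * gaussian_mode m f p)"
    by (auto simp: gaussian_mode_def algebra_simps)
  moreover have "(\<lambda>t. c * f t) \<in> borel_measurable borel"
    using f by (intro borel_measurable_times borel_measurable_const approximable_on_mode_measurable)
  ultimately show ?thesis using f X_space_cmult[of "gaussian_mode m f" s b c]
    by (simp only: approximable_on_mode_def mem_Collect_eq simp_thms)
qed

lemma approximable_on_mode_zero: "(\<lambda>t. 0) \<in> approximable_on_mode s b m"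
proof -
  have "gaussian_mode m (\<lambda>t. 0) = (\<lambda>p. 0)" by (auto simp: gaussian_mode_def)
  then show ?thesis using X_space_zero[of s b] by (simp add: approximable_on_mode_def)
qed

lemma approximable_on_mode_sum: "(\<And>i. i \<in> I \<Longrightarrow> f i \<in> approximable_on_mode s b m) \<Longrightarrow> (\<lambda>t. \<Sum>i\<in>I. f i t) \<in> approximable_on_mode s b m"
  by (induction I rule: infinite_finite_induct) (auto simp: approximable_on_mode_zero approximable_on_mode_add)

text \<open>The wave packet centred at time \<open>-c\<close> has this transform up to a nonzero constant.\<close>
lemma approximable_on_mode_character:
  assumes b: "b \<le> 0"
  shows "(\<lambda>\<tau>. cis (c * \<tau>)) \<in> approximable_on_mode s b m"
proof -
  have m: "(\<lambda>\<tau>. cis (c * \<tau>)) \<in> borel_measurable borel"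
    by (intro borel_measurable_continuous_onI continuous_intros)
  \<comment> \<open>length of the torus times the total mass of the Gaussian\<close>
  define K where "K = complex_of_real (2 * pi * sqrt (2 * pi))"
  have K: "K \<noteq> 0" by (simp add: K_def)
  have eq: "xt_fourier (wave_packet m (- c)) = (\<lambda>p. K * gaussian_mode m (\<lambda>\<tau>. cis (c * \<tau>)) p)"
    by (auto simp: xt_fourier_wave_packet gaussian_mode_def K_def)
  have "Xnorm_sq s b (gaussian_mode m (\<lambda>\<tau>. cis (c * \<tau>))) < \<infinity>"
    using gaussian_nn_integral_finite[of 1]
    by (intro le_less_trans[OF Xnorm_sq_gaussian_mode_le[OF b m]]) (simp add: ennreal_mult_less_top)
  then have "Xnorm_sq s b (xt_fourier (wave_packet m (- c))) < \<infinity>"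
    unfolding eq Xnorm_sq_cmult[OF gaussian_mode_measurable[OF m]] by (simp add: ennreal_mult_less_top ennreal_power)
  from X_space_cmult[OF X_space_of_fourier[OF wave_packet_Y_space wave_packet_integrable this], of "inverse K"]
  have "gaussian_mode m (\<lambda>\<tau>. cis (c * \<tau>)) \<in> X_space s b"
    using K by (simp add: eq mult.assoc[symmetric])
  then show ?thesis using m by (simp add: approximable_on_mode_def)
qed

text \<open>Dominated convergence, with the Gaussian as majorant.\<close>
lemma approximable_on_mode_limit:
  assumes b: "b \<le> 0" and f: "\<And>k. f k \<in> approximable_on_mode s b m"
    and h: "h \<in> borel_measurable borel"
    and bound: "\<And>k t. norm (f k t) \<le> B"
    and lim: "AE t in lborel. (\<lambda>k::nat. f k t) \<longlonglongrightarrow> h t"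
  shows "h \<in> approximable_on_mode s b m"
proof -
  have fm: "f k \<in> borel_measurable borel" for k by (rule approximable_on_mode_measurable[OF f])
  note [measurable] = fm h
  have hB: "AE t in lborel. norm (h t) \<le> B"
    using lim
  proof eventually_elim
    case (elim t)
    show ?case by (rule tendsto_upperbound[OF tendsto_norm[OF elim]]) (simp_all add: bound)
  qed
  have "(\<lambda>k. \<integral>\<^sup>+t. ennreal ((exp (- t\<^sup>2 / 2) * norm (f k t - h t))\<^sup>2) \<partial>lborel) \<longlonglongrightarrow> (\<integral>\<^sup>+t. 0 \<partial>(lborel :: real measure))"
  proof (rule nn_integral_dominated_convergence[where w = "\<lambda>t. ennreal ((2 * B)\<^sup>2 * (exp (- t\<^sup>2 / 2))\<^sup>2)"])
    fix k
    show "AE t in lborel. ennreal ((exp (- t\<^sup>2 / 2) * norm (f k t - h t))\<^sup>2) \<le> ennreal ((2 * B)\<^sup>2 * (exp (- t\<^sup>2 / 2))\<^sup>2)"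
      using hB
    proof eventually_elim
      case (elim t)
      have "norm (f k t - h t) \<le> 2 * B"
        using norm_triangle_ineq4[of "f k t" "h t"] bound[of k t] elim by linarith
      then have "(norm (f k t - h t))\<^sup>2 \<le> (2 * B)\<^sup>2" by (intro power_mono) auto
      then have "(exp (- t\<^sup>2 / 2))\<^sup>2 * (norm (f k t - h t))\<^sup>2 \<le> (exp (- t\<^sup>2 / 2))\<^sup>2 * (2 * B)\<^sup>2"
        by (intro mult_left_mono) auto
      then show ?case by (intro ennreal_leI) (simp add: power_mult_distrib mult_ac)
    qed
  next
    show "(\<integral>\<^sup>+t. ennreal ((2 * B)\<^sup>2 * (exp (- t\<^sup>2 / 2))\<^sup>2) \<partial>lborel) < \<infinity>" by (rule gaussian_nn_integral_finite)
  next
    show "AE t in lborel. (\<lambda>k. ennreal ((exp (- t\<^sup>2 / 2) * norm (f k t - h t))\<^sup>2)) \<longlonglongrightarrow> 0"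
      using lim
    proof eventually_elim
      case (elim t)
      have "(\<lambda>k. (exp (- t\<^sup>2 / 2) * norm (f k t - h t))\<^sup>2) \<longlonglongrightarrow> (exp (- t\<^sup>2 / 2) * norm (h t - h t))\<^sup>2"
        by (intro tendsto_intros elim)
      then show ?case by (metis (no_types) diff_self ennreal_0 mult_zero_right norm_zero power_zero_numeral tendsto_ennrealI)
    qed
  qed measurable
  then have "(\<lambda>k. ennreal ((jbr (of_int m) powr s)\<^sup>2) * (\<integral>\<^sup>+t. ennreal ((exp (- t\<^sup>2 / 2) * norm (f k t - h t))\<^sup>2) \<partial>lborel)) \<longlonglongrightarrow> ennreal ((jbr (of_int m) powr s)\<^sup>2) * 0"
    by (intro ennreal_tendsto_cmult) auto
  then have lim0: "(\<lambda>k. ennreal ((jbr (of_int m) powr s)\<^sup>2) * (\<integral>\<^sup>+t. ennreal ((exp (- t\<^sup>2 / 2) * norm (f k t - h t))\<^sup>2) \<partial>lborel)) \<longlonglongrightarrow> 0"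
    by simp
  have "gaussian_mode m h \<in> X_space s b"
  proof (rule X_space_closed[OF gaussian_mode_measurable[OF h]])
    show "gaussian_mode m (f k) \<in> X_space s b" for k using f[of k] by (simp add: approximable_on_mode_def)
    have "Xnorm_sq s b (\<lambda>p. gaussian_mode m (f k) p - gaussian_mode m h p)
       \<le> ennreal ((jbr (of_int m) powr s)\<^sup>2) * (\<integral>\<^sup>+t. ennreal ((exp (- t\<^sup>2 / 2) * norm (f k t - h t))\<^sup>2) \<partial>lborel)" for k
    proof -
      have "(\<lambda>p. gaussian_mode m (f k) p - gaussian_mode m h p) = gaussian_mode m (\<lambda>t. f k t - h t)"
        by (auto simp: gaussian_mode_def algebra_simps)
      moreover have "(\<lambda>t. f k t - h t) \<in> borel_measurable borel" by measurable
      ultimately show ?thesis using Xnorm_sq_gaussian_mode_le[OF b, of "\<lambda>t. f k t - h t" s m] by simp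
    qed
    then show "(\<lambda>k. Xnorm_sq s b (\<lambda>p. gaussian_mode m (f k) p - gaussian_mode m h p)) \<longlonglongrightarrow> 0"
      by (intro tendsto_sandwich[OF _ _ tendsto_const lim0]) (auto intro: always_eventually)
  qed
  then show ?thesis using h by (simp add: approximable_on_mode_def)
qed

text \<open>Trigonometric polynomials, closed by construction under linear combinations and shown below to form an algebra.\<close>
inductive_set trig_poly :: "(real \<Rightarrow> complex) set" where
  character: "(\<lambda>\<tau>. cis (c * \<tau>)) \<in> trig_poly"
| add: "f \<in> trig_poly \<Longrightarrow> g \<in> trig_poly \<Longrightarrow> (\<lambda>\<tau>. f \<tau> + g \<tau>) \<in> trig_poly"
| cmult: "f \<in> trig_poly \<Longrightarrow> (\<lambda>\<tau>. c * f \<tau>) \<in> trig_poly"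

lemma trig_poly_const: "(\<lambda>\<tau>. c) \<in> trig_poly"
  using trig_poly.cmult[OF trig_poly.character[of 0], of c] by simp

lemma trig_poly_character_mult: "f \<in> trig_poly \<Longrightarrow> (\<lambda>\<tau>. cis (c * \<tau>) * f \<tau>) \<in> trig_poly"
proof (induction rule: trig_poly.induct)
  case (character d)
  show ?case using trig_poly.character[of "c + d"] by (simp add: cis_mult distrib_right)
next
  case (add f g)
  then show ?case using trig_poly.add by (fastforce simp: distrib_left)
next
  case (cmult f d)
  then show ?case using trig_poly.cmult[of _ d] by (fastforce simp: mult.left_commute)
qed

lemma trig_poly_mult: "f \<in> trig_poly \<Longrightarrow> g \<in> trig_poly \<Longrightarrow> (\<lambda>\<tau>. f \<tau> * g \<tau>) \<in> trig_poly"
proof (induction rule: trig_poly.induct)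
  case (character c)
  then show ?case by (rule trig_poly_character_mult)
next
  case (add f h)
  then show ?case using trig_poly.add by (fastforce simp: distrib_right)
next
  case (cmult f d)
  then show ?case using trig_poly.cmult[of _ d] by (fastforce simp: mult.assoc)
qed

lemma trig_poly_power: "f \<in> trig_poly \<Longrightarrow> (\<lambda>\<tau>. f \<tau> ^ k) \<in> trig_poly"
  by (induction k) (auto simp: trig_poly_const trig_poly_mult)

lemma trig_poly_approximable_on_mode:
  assumes "b \<le> 0"
  shows "f \<in> trig_poly \<Longrightarrow> f \<in> approximable_on_mode s b m"
  by (induction rule: trig_poly.induct) (auto intro: approximable_on_mode_character approximable_on_mode_add approximable_on_mode_cmult assms)

lemma trig_poly_sin: "(\<lambda>\<tau>. of_real (sin (a * (\<tau> - c)))) \<in> trig_poly"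
proof -
  have eq: "complex_of_real (sin (a * (\<tau> - c))) = (cis (- (a * c)) / (2 * \<i>)) * cis (a * \<tau>) + (- cis (a * c) / (2 * \<i>)) * cis (- a * \<tau>)" for \<tau>
  proof -
    have "cis (- (a * c)) * cis (a * \<tau>) = cis (a * (\<tau> - c))" "cis (a * c) * cis (- a * \<tau>) = cis (- (a * (\<tau> - c)))"
      by (simp_all add: cis_mult algebra_simps)
    moreover have "(x / d) * u + (- y / d) * v = (x * u - y * v) / d" for x y u v d :: complex
      by (simp add: diff_divide_distrib)
    ultimately have "(cis (- (a * c)) / (2 * \<i>)) * cis (a * \<tau>) + (- cis (a * c) / (2 * \<i>)) * cis (- a * \<tau>)
      = (cis (a * (\<tau> - c)) - cis (- (a * (\<tau> - c)))) / (2 * \<i>)"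
      by (simp only:)
    also have "\<dots> = of_real (sin (a * (\<tau> - c)))"
      by (simp add: complex_eq_iff Re_divide Im_divide)
    finally show ?thesis by simp
  qed
  show ?thesis unfolding eq by (intro trig_poly.add trig_poly.cmult trig_poly.character)
qed

text \<open>The polynomials \<open>(1 - y\<^sup>n)\<^bsup>2^n\<^esup>\<close> on \<open>[0, 1]\<close> converge boundedly to a step function that jumps at
  \<open>1/2\<close>: the product \<open>2\<^sup>n y\<^sup>n\<close> tends to 0 below the threshold, where Bernoulli's inequality applies, and to infinity
  above it, where the power is at most \<open>exp(-(2y)\<^sup>n)\<close>.\<close>
lemma power_threshold_low:
  assumes "0 \<le> y" "y < 1/2"
  shows "(\<lambda>n. (1 - y ^ n) ^ (2 ^ n)) \<longlonglongrightarrow> (1::real)"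
proof (rule tendsto_sandwich[of "\<lambda>n. 1 - (2 * y) ^ n" _ _ "\<lambda>n. 1"])
  have y1: "y ^ n \<le> 1" for n using assms by (intro power_le_one) auto
  have "1 - (2 * y) ^ n \<le> (1 - y ^ n) ^ (2 ^ n)" for n
    using Bernoulli_inequality[of "- (y ^ n)" "2 ^ n"] y1[of n] by (simp add: power_mult_distrib)
  then show "\<forall>\<^sub>F n in sequentially. 1 - (2 * y) ^ n \<le> (1 - y ^ n) ^ (2 ^ n)" by simp
  have "(1 - y ^ n) ^ (2 ^ n) \<le> 1" for n
    using y1[of n] assms by (intro power_le_one) auto
  then show "\<forall>\<^sub>F n in sequentially. (1 - y ^ n) ^ (2 ^ n) \<le> 1" by simp
  have "(\<lambda>n. 1 - (2 * y) ^ n) \<longlonglongrightarrow> 1 - 0"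
    using assms by (intro tendsto_intros LIMSEQ_power_zero) auto
  then show "(\<lambda>n. 1 - (2 * y) ^ n) \<longlonglongrightarrow> 1" by simp
qed simp

lemma power_threshold_high:
  assumes "1/2 < y" "y \<le> 1"
  shows "(\<lambda>n. (1 - y ^ n) ^ (2 ^ n)) \<longlonglongrightarrow> (0::real)"
proof (rule tendsto_sandwich[of "\<lambda>n. 0" _ _ "\<lambda>n. (1 / (2 * y)) ^ n"])
  have y1: "y ^ n \<le> 1" for n using assms by (intro power_le_one) auto
  have "(1 - y ^ n) ^ (2 ^ n) \<le> (1 / (2 * y)) ^ n" for n
  proof -
    have pos: "0 < (2 * y) ^ n" using assms by simp
    have "(1 - y ^ n) ^ (2 ^ n) \<le> (exp (- (y ^ n))) ^ (2 ^ n)"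
      using y1[of n] exp_ge_add_one_self[of "- (y ^ n)"] by (intro power_mono) auto
    also have "\<dots> = exp (of_nat (2 ^ n) * (- (y ^ n)))" by (rule exp_of_nat_mult[symmetric])
    also have "\<dots> = inverse (exp ((2 * y) ^ n))"
      by (simp add: power_mult_distrib exp_minus)
    also have "\<dots> \<le> inverse ((2 * y) ^ n)"
    proof (rule le_imp_inverse_le[OF _ pos])
      show "(2 * y) ^ n \<le> exp ((2 * y) ^ n)" using exp_ge_add_one_self[of "(2 * y) ^ n"] by linarith
    qed
    finally show ?thesis by (simp add: power_divide inverse_eq_divide)
  qed
  then show "\<forall>\<^sub>F n in sequentially. (1 - y ^ n) ^ (2 ^ n) \<le> (1 / (2 * y)) ^ n" by simp
  show "\<forall>\<^sub>F n in sequentially. 0 \<le> (1 - y ^ n) ^ (2 ^ n)" using y1 by (intro always_eventually) simp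
  show "(\<lambda>n. (1 / (2 * y)) ^ n) \<longlonglongrightarrow> 0"
    using assms by (intro LIMSEQ_power_zero) auto
qed simp

text \<open>The step polynomials are evaluated at the trigonometric polynomial \<open>(1 + sin(a(\<tau> - c)))/2\<close>, which crosses the threshold
  \<open>1/2\<close> exactly where the sine changes sign. The zeros of the sine, where the limit is wrong, are countable.\<close>
lemma indicator_sin_pos_approximable_on_mode:
  assumes b: "b \<le> 0" and a: "a \<noteq> 0"
  shows "(\<lambda>\<tau>. of_bool (sin (a * (\<tau> - c)) > 0)) \<in> approximable_on_mode s b m"
proof -
  define y :: "real \<Rightarrow> real" where "y \<tau> = (1 + sin (a * (\<tau> - c))) / 2" for \<tau>
  have y: "0 \<le> y \<tau>" "y \<tau> \<le> 1" for \<tau>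
  proof -
    have "0 \<le> (1 + x) / 2 \<and> (1 + x) / 2 \<le> 1" if "-1 \<le> x" "x \<le> 1" for x :: real
      using that by simp
    from this[OF sin_ge_minus_one sin_le_one] show "0 \<le> y \<tau>" "y \<tau> \<le> 1"
      unfolding y_def by blast+
  qed
  define f :: "nat \<Rightarrow> real \<Rightarrow> complex" where "f k \<tau> = 1 + (- 1) * (1 + (- 1) * (of_real (y \<tau>)) ^ k) ^ (2 ^ k)" for k \<tau>
  have "(\<lambda>\<tau>. complex_of_real (y \<tau>)) \<in> trig_poly"
  proof -
    have "complex_of_real (y \<tau>) = 1 / 2 + 1 / 2 * complex_of_real (sin (a * (\<tau> - c)))" for \<tau>
      by (simp add: y_def add_divide_distrib)
    then show ?thesis
      using trig_poly.add[OF trig_poly_const trig_poly.cmult[OF trig_poly_sin], of "1/2" "1/2" a c] by simp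
  qed
  then have tp: "f k \<in> trig_poly" for k
    unfolding f_def by (intro trig_poly.add trig_poly.cmult trig_poly_const trig_poly_power)
  have fr: "f k \<tau> = of_real (1 - (1 - y \<tau> ^ k) ^ (2 ^ k))" for k \<tau> by (simp add: f_def)
  show ?thesis
  proof (rule approximable_on_mode_limit[OF b, where f = f and B = 1])
    show "f k \<in> approximable_on_mode s b m" for k by (rule trig_poly_approximable_on_mode[OF b tp])
    show "(\<lambda>\<tau>. of_bool (sin (a * (\<tau> - c)) > 0) :: complex) \<in> borel_measurable borel" by measurable
    show "norm (f k \<tau>) \<le> 1" for k \<tau>
    proof -
      have "y \<tau> ^ k \<le> 1" "0 \<le> y \<tau> ^ k" using y by (auto intro: power_le_one)
      then have "(1 - y \<tau> ^ k) ^ (2 ^ k) \<le> 1" "0 \<le> (1 - y \<tau> ^ k) ^ (2 ^ k)" by (auto intro: power_le_one)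
      then show ?thesis unfolding fr norm_of_real by simp
    qed
    have "{\<tau>. sin (a * (\<tau> - c)) = 0} \<subseteq> range (\<lambda>i::int. c + of_int i * pi / a)"
    proof
      fix \<tau> assume "\<tau> \<in> {\<tau>. sin (a * (\<tau> - c)) = 0}"
      then obtain i :: int where "a * (\<tau> - c) = of_int i * pi" by (auto simp: sin_zero_iff_int2)
      then have "\<tau> = c + of_int i * pi / a" using a by (simp add: field_simps)
      then show "\<tau> \<in> range (\<lambda>i::int. c + of_int i * pi / a)" by blast
    qed
    then have "countable {\<tau>. sin (a * (\<tau> - c)) = 0}" by (rule countable_subset) auto
    then have "AE \<tau> in lborel. \<tau> \<notin> {\<tau>. sin (a * (\<tau> - c)) = 0}"
      by (intro AE_not_in countable_imp_null_set_lborel)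
    then show "AE \<tau> in lborel. (\<lambda>k. f k \<tau>) \<longlonglongrightarrow> of_bool (sin (a * (\<tau> - c)) > 0)"
    proof eventually_elim
      case (elim \<tau>)
      have "(\<lambda>k. 1 - (1 - y \<tau> ^ k) ^ (2 ^ k)) \<longlonglongrightarrow> of_bool (sin (a * (\<tau> - c)) > 0)"
      proof (cases "sin (a * (\<tau> - c)) > 0")
        case True
        then have "1/2 < y \<tau>" by (simp add: y_def)
        from tendsto_diff[OF tendsto_const[of 1] power_threshold_high[OF this y(2)]] True
        show ?thesis by simp
      next
        case False
        with elim have "y \<tau> < 1/2" by (auto simp: y_def)
        from tendsto_diff[OF tendsto_const[of 1] power_threshold_low[OF y(1) this]] False
        show ?thesis by simp
      qed
      from tendsto_of_real[OF this, where 'a = complex]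
      show ?case unfolding fr by (cases "0 < sin (a * (\<tau> - c))") simp_all
    qed
  qed
qed

text \<open>As the period grows, the sign of \<open>sin(a(\<tau> - c))\<close> becomes the sign of \<open>\<tau> - c\<close> at every point.\<close>
lemma indicator_ray_approximable_on_mode:
  assumes b: "b \<le> 0"
  shows "(\<lambda>\<tau>. of_bool (\<tau> > c)) \<in> approximable_on_mode s b m"
proof (rule approximable_on_mode_limit[OF b, where B = 1])
  show "(\<lambda>\<tau>. of_bool (sin (inverse (real (Suc k)) * (\<tau> - c)) > 0)) \<in> approximable_on_mode s b m" for k
    by (rule indicator_sin_pos_approximable_on_mode[OF b]) simp
  show "(\<lambda>\<tau>. of_bool (\<tau> > c) :: complex) \<in> borel_measurable borel" by measurable
  show "norm (of_bool (sin (inverse (real (Suc k)) * (\<tau> - c)) > 0) :: complex) \<le> 1" for k \<tau> by simp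
  show "AE \<tau> in lborel. (\<lambda>k. of_bool (sin (inverse (real (Suc k)) * (\<tau> - c)) > 0) :: complex) \<longlonglongrightarrow> of_bool (\<tau> > c)"
  proof (intro AE_I2)
    fix \<tau> :: real
    have "(\<lambda>k. inverse (real (Suc k)) * \<bar>\<tau> - c\<bar>) \<longlonglongrightarrow> 0 * \<bar>\<tau> - c\<bar>"
      by (intro tendsto_mult LIMSEQ_inverse_real_of_nat tendsto_const)
    then have "\<forall>\<^sub>F k in sequentially. inverse (real (Suc k)) * \<bar>\<tau> - c\<bar> < pi"
      by (intro order_tendstoD(2)) auto
    then have "\<forall>\<^sub>F k in sequentially. of_bool (sin (inverse (real (Suc k)) * (\<tau> - c)) > 0) = (of_bool (\<tau> > c) :: complex)"
    proof eventually_elim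
      case (elim k)
      define z where "z = inverse (real (Suc k)) * (\<tau> - c)"
      have z: "\<bar>z\<bar> < pi" using elim by (simp add: z_def abs_mult)
      have "z > 0 \<longleftrightarrow> \<tau> > c" by (simp add: z_def zero_less_mult_iff)
      moreover have "sin z > 0 \<longleftrightarrow> z > 0"
      proof
        show "sin z > 0" if "z > 0" using that z by (intro sin_gt_zero) auto
        show "z > 0" if "sin z > 0"
        proof (rule ccontr)
          assume "\<not> z > 0"
          then have "sin (- z) \<ge> 0" using z by (intro sin_ge_zero) auto
          then show False using that by simp
        qed
      qed
      ultimately show ?case by (simp add: z_def)
    qed
    then show "(\<lambda>k. of_bool (sin (inverse (real (Suc k)) * (\<tau> - c)) > 0) :: complex) \<longlonglongrightarrow> of_bool (\<tau> > c)"
      by (rule tendsto_eventually)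
  qed
qed

text \<open>Dynkin's lemma: half-lines are stable under intersection and generate the Borel sets, and a disjoint union is a bounded limit of finite sums.\<close>
lemma indicator_approximable_on_mode:
  assumes b: "b \<le> 0" and A: "A \<in> sets borel"
  shows "indicator A \<in> approximable_on_mode s b m"
proof -
  have gen: "A \<in> sigma_sets UNIV (range greaterThan :: real set set)"
    using A unfolding borel_Ioi by simp
  have stable: "Int_stable (range greaterThan :: real set set)"
  proof (rule Int_stableI)
    fix X Y :: "real set" assume "X \<in> range greaterThan" "Y \<in> range greaterThan"
    then obtain x y where "X = {x<..}" "Y = {y<..}" by auto
    then have "X \<inter> Y = {max x y<..}" by auto
    then show "X \<inter> Y \<in> range greaterThan" by blast
  qed
  have meas: "B \<in> sets borel" if "B \<in> sigma_sets UNIV (range greaterThan :: real set set)" for B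
    using that unfolding borel_Ioi by simp
  have closed: "range greaterThan \<subseteq> Pow (UNIV :: real set)" by simp
  show ?thesis
    using stable closed gen
  proof (induction A rule: sigma_sets_induct_disjoint)
    case (basic A)
    then obtain c where "A = {c<..}" by auto
    then have "indicator A = (\<lambda>\<tau>. of_bool (\<tau> > c) :: complex)" by (auto simp: indicator_def)
    then show ?case using indicator_ray_approximable_on_mode[OF b] by simp
  next
    case empty
    have "indicator {} = (\<lambda>\<tau>::real. 0 :: complex)" by auto
    then show ?case using approximable_on_mode_zero by simp
  next
    case (compl A)
    have "indicator (UNIV - A) = (\<lambda>\<tau>. 1 + (- 1) * indicator A \<tau> :: complex)" by (auto simp: indicator_def)
    moreover have "(\<lambda>\<tau>. 1) \<in> approximable_on_mode s b m" by (rule trig_poly_approximable_on_mode[OF b trig_poly_const])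
    ultimately show ?case using approximable_on_mode_add approximable_on_mode_cmult[OF compl(2), of "- 1"] by fastforce
  next
    case (union A)
    show ?case
    proof (rule approximable_on_mode_limit[OF b, where B = 1])
      show "indicator (\<Union>i<k. A i) \<in> approximable_on_mode s b m" for k
      proof -
        have "indicator (\<Union>i<k. A i) = (\<lambda>\<tau>. \<Sum>i<k. indicator (A i) \<tau> :: complex)"
          using union(1) by (intro ext indicator_UN_disjoint) (auto simp: disjoint_family_on_def)
        then show ?thesis using approximable_on_mode_sum[of "{..<k}" "\<lambda>i. indicator (A i)" s b m] union(3) by simp
      qed
      show "indicator (\<Union>i. A i) \<in> borel_measurable borel"
        using union(2) meas by (intro borel_measurable_indicator sets.countable_UN) auto
      show "norm (indicator (\<Union>i<k. A i) \<tau> :: complex) \<le> 1" for k \<tau> by (simp add: indicator_def)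
      show "AE \<tau> in lborel. (\<lambda>k. indicator (\<Union>i<k. A i) \<tau> :: complex) \<longlonglongrightarrow> indicator (\<Union>i. A i) \<tau>"
        by (intro AE_I2 LIMSEQ_indicator_UN)
    qed
  qed
qed

lemma bounded_approximable_on_mode:
  assumes b: "b \<le> 0" and h: "h \<in> borel_measurable borel" and B: "\<And>t. norm (h t) \<le> B"
  shows "h \<in> approximable_on_mode s b m"
proof -
  obtain F where F: "\<And>i. simple_function (borel :: real measure) (F i)" "\<And>t. (\<lambda>i. F i t) \<longlonglongrightarrow> h t"
     "\<And>i t. dist (F i t) 0 \<le> 2 * dist (h t) 0"
    using borel_measurable_implies_sequence_metric[OF h, of 0] by auto
  have simple: "F i \<in> approximable_on_mode s b m" for i
  proof -
    have "F i = (\<lambda>t. \<Sum>y\<in>range (F i). y * indicator (F i -` {y}) t)"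
    proof
      fix t
      have "F i t = (\<Sum>y\<in>range (F i). indicator (F i -` {y}) t *\<^sub>R y)"
        by (rule simple_function_indicator_representation_banach[OF F(1)[of i], of t, unfolded space_borel Int_UNIV_right, OF UNIV_I])
      also have "\<dots> = (\<Sum>y\<in>range (F i). y * indicator (F i -` {y}) t)"
        by (intro sum.cong refl) (auto simp: indicator_def)
      finally show "F i t = (\<Sum>y\<in>range (F i). y * indicator (F i -` {y}) t)" .
    qed
    moreover have "(\<lambda>t. \<Sum>y\<in>range (F i). y * indicator (F i -` {y}) t) \<in> approximable_on_mode s b m"
      using simple_functionD(2)[OF F(1)[of i]]
      by (intro approximable_on_mode_sum approximable_on_mode_cmult indicator_approximable_on_mode b) simp
    ultimately show ?thesis by simp
  qed
  show ?thesis
  proof (rule approximable_on_mode_limit[OF b simple h, where B = "2 * B"])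
    show "norm (F i t) \<le> 2 * B" for i t using F(3)[of i t] B[of t] by simp
    show "AE t in lborel. (\<lambda>k. F k t) \<longlonglongrightarrow> h t" using F(2) by simp
  qed
qed

text \<open>The truncations to \<open>|n| \<le> k\<close> and \<open>|f| \<le> k exp(-\<tau>\<^sup>2/2)\<close> converge to \<open>f\<close> in norm by dominated convergence. Each
  of them is a finite sum of single modes whose quotient by the Gaussian is bounded by \<open>k\<close>.\<close>
theorem X_space_of_finite_norm:
  assumes b: "b \<le> 0" and f: "f \<in> borel_measurable freq" and fin: "Xnorm_sq s b f < \<infinity>"
  shows "f \<in> X_space s b"
proof -
  define good where "good k p \<longleftrightarrow> \<bar>snd p\<bar> \<le> int k \<and> norm (f p) \<le> real k * exp (- (fst p)\<^sup>2 / 2)" for k :: nat and p :: "real \<times> int"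
  define g where "g k p = (if good k p then f p else 0)" for k p
  have slice: "(\<lambda>\<tau>. f (\<tau>, n)) \<in> borel_measurable borel" for n
  proof -
    have "(\<lambda>t::real. (t, n)) \<in> borel \<rightarrow>\<^sub>M freq"
      by (simp add: measurable_cong_sets[OF refl sets_freq])
    from measurable_compose[OF this f] show ?thesis .
  qed
  have hmeas: "(\<lambda>\<tau>. if norm (f (\<tau>, n)) \<le> real k * exp (- \<tau>\<^sup>2 / 2) then f (\<tau>, n) / of_real (exp (- \<tau>\<^sup>2 / 2)) else 0) \<in> borel_measurable borel" for k n
    using slice[of n] by measurable
  define h where "h k n = (\<lambda>\<tau>. if norm (f (\<tau>, n)) \<le> real k * exp (- \<tau>\<^sup>2 / 2) then f (\<tau>, n) / of_real (exp (- \<tau>\<^sup>2 / 2)) else 0)" for k n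
  have hB: "norm (h k n \<tau>) \<le> real k" for k n \<tau>
    by (simp add: h_def norm_divide field_simps)
  have gsum: "g k = (\<lambda>p. \<Sum>n\<in>{- int k..int k}. gaussian_mode n (h k n) p)" for k
  proof
    fix p :: "real \<times> int"
    obtain \<tau> l where p: "p = (\<tau>, l)" by (cases p)
    have "(\<Sum>n\<in>{- int k..int k}. gaussian_mode n (h k n) p) = (\<Sum>n\<in>{- int k..int k}. if n = l then of_real (exp (- \<tau>\<^sup>2 / 2)) * h k n \<tau> else 0)"
      by (intro sum.cong) (auto simp: p gaussian_mode_def)
    also have "\<dots> = g k p"
      by (auto simp: sum.delta' p g_def good_def h_def)
    finally show "g k p = (\<Sum>n\<in>{- int k..int k}. gaussian_mode n (h k n) p)" ..
  qed
  have g: "g k \<in> X_space s b" for k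
    unfolding gsum
  proof (rule X_space_sum)
    fix n
    have "h k n \<in> approximable_on_mode s b n"
      by (rule bounded_approximable_on_mode[OF b _ hB]) (unfold h_def, rule hmeas)
    then show "gaussian_mode n (h k n) \<in> X_space s b" by (simp add: approximable_on_mode_def)
  qed
  have gm: "g k \<in> borel_measurable freq" for k by (rule X_space_measurable[OF g])
  note [measurable] = gm f
  have "(\<lambda>k. \<integral>\<^sup>+p. (ennreal (Xweight s b p * norm (g k p - f p)))\<^sup>2 \<partial>freq) \<longlonglongrightarrow> (\<integral>\<^sup>+p. 0 \<partial>freq)"
  proof (rule nn_integral_dominated_convergence[where w = "\<lambda>p. (ennreal (Xweight s b p * norm (f p)))\<^sup>2"])
    show "AE p in freq. (ennreal (Xweight s b p * norm (g k p - f p)))\<^sup>2 \<le> (ennreal (Xweight s b p * norm (f p)))\<^sup>2" for k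
      by (intro AE_I2 power_mono ennreal_leI mult_left_mono) (auto simp: g_def)
    show "(\<integral>\<^sup>+p. (ennreal (Xweight s b p * norm (f p)))\<^sup>2 \<partial>freq) < \<infinity>"
      using fin unfolding Xnorm_sq_weight .
    show "AE p in freq. (\<lambda>k. (ennreal (Xweight s b p * norm (g k p - f p)))\<^sup>2) \<longlonglongrightarrow> 0"
    proof (intro AE_I2 tendsto_eventually)
      fix p
      obtain K :: nat where K: "max (real_of_int \<bar>snd p\<bar>) (norm (f p) / exp (- (fst p)\<^sup>2 / 2)) \<le> real K"
        using real_arch_simple by blast
      have "good k p" if "K \<le> k" for k
      proof -
        have "real K \<le> real k" using that by simp
        then have "real_of_int \<bar>snd p\<bar> \<le> real k" "norm (f p) / exp (- (fst p)\<^sup>2 / 2) \<le> real k"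
          using K by linarith+
        then show ?thesis by (simp add: good_def pos_divide_le_eq)
      qed
      then show "\<forall>\<^sub>F k in sequentially. (ennreal (Xweight s b p * norm (g k p - f p)))\<^sup>2 = 0"
        unfolding eventually_sequentially by (intro exI[of _ K]) (simp add: g_def)
    qed
  qed measurable
  then have "(\<lambda>k. Xnorm_sq s b (\<lambda>p. g k p - f p)) \<longlonglongrightarrow> 0"
    unfolding Xnorm_sq_weight by simp
  then show ?thesis by (rule X_space_closed[OF f g])
qed

section \<open>The bilinear estimate\<close>

lemma norm_conv_integrand:
  "norm (conv_integrand u v p q) = norm (u (p - q)) * norm (v q)"
  by (cases p; cases q) (simp add: conv_integrand_def norm_mult)

lemma conv_integrand_measurable:
  assumes [measurable]: "u \<in> borel_measurable freq" "v \<in> borel_measurable freq"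
  shows "(\<lambda>(p, q). conv_integrand u v p q) \<in> borel_measurable (freq \<Otimes>\<^sub>M freq)"
proof -
  have "(\<lambda>x. u (fst x - snd x) * v (snd x)) \<in> borel_measurable (freq \<Otimes>\<^sub>M freq)"
    by measurable
  also have "(\<lambda>x. u (fst x - snd x) * v (snd x)) = (\<lambda>(p, q). conv_integrand u v p q)"
    by (auto simp: conv_integrand_def)
  finally show ?thesis .
qed

text \<open>The convolution is estimated through the integral of the absolute value of its integrand, so that
  finiteness of the norm also yields absolute convergence for almost every output of nonzero spatial frequency.\<close>
theorem theorem1p1:
  fixes s a b :: real
  assumes "s > -1/4"
    and "(s \<ge> 0 \<and> b > 1/2 \<and> 1/4 < a \<and> a < 1/2) \<or>
         (-1/4 < s \<and> s < 0 \<and> b > 1/2 \<and> 1/4 < a \<and> a < 1/2 \<and> \<bar>s\<bar> < a/2)"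
  shows "\<exists>c>0. \<forall>u \<in> X_space s b. \<forall>v \<in> X_space s b.
           (AE p in freq. snd p \<noteq> 0 \<longrightarrow> integrable freq (conv_integrand u v p)) \<and>
           bilin u v \<in> X_space s (-a) \<and>
           Xnorm s (-a) (bilin u v) \<le> c * Xnorm s b u * Xnorm s b v"
proof -
  have sab: "0 \<le> a" "1/2 < b" "0 \<le> s \<or> (-1/4 < s \<and> s < 0 \<and> 2 * \<bar>s\<bar> \<le> a)"
    using assms by auto
  obtain C where Cfin: "C < \<infinity>" and C: "\<And>F G :: real \<times> int \<Rightarrow> ennreal. F \<in> borel_measurable freq \<Longrightarrow> G \<in> borel_measurable freq \<Longrightarrow>
      (\<integral>\<^sup>+p. (indicator {p. snd p \<noteq> 0} p * (\<integral>\<^sup>+q. ennreal (interaction_kernel s a b p q) * (F (p - q) * G q) \<partial>freq))\<^sup>2 \<partial>freq)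
      \<le> C * ((\<integral>\<^sup>+p. (F p)\<^sup>2 \<partial>freq) * (\<integral>\<^sup>+p. (G p)\<^sup>2 \<partial>freq))"
    using bilinear_L2_bound[OF sab] by blast
  \<comment> \<open>adding 1 keeps the constant positive even if the operator bound vanishes\<close>
  define c where "c = sqrt (enn2real C) + 1"
  have c: "0 < c" by (simp add: c_def add_nonneg_pos)
  show ?thesis
  proof (intro exI[of _ c] conjI c ballI)
    fix u v assume u: "u \<in> X_space s b" and v: "v \<in> X_space s b"
    have um: "u \<in> borel_measurable freq" and vm: "v \<in> borel_measurable freq"
      using u v by (auto intro: X_space_measurable)
    note [measurable] = um vm
    define F where "F p = ennreal (Xweight s b p * norm (u p))" for p
    define G where "G p = ennreal (Xweight s b p * norm (v p))" for p
    have [measurable]: "F \<in> borel_measurable freq" "G \<in> borel_measurable freq"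
      unfolding F_def[abs_def] G_def[abs_def] by measurable
    have FG: "(\<integral>\<^sup>+p. (F p)\<^sup>2 \<partial>freq) = Xnorm_sq s b u" "(\<integral>\<^sup>+p. (G p)\<^sup>2 \<partial>freq) = Xnorm_sq s b v"
      by (simp_all add: F_def G_def Xnorm_sq_weight)
    define T where "T p = (\<integral>\<^sup>+q. ennreal (norm (conv_integrand u v p q)) \<partial>freq)" for p
    have kernel: "ennreal (interaction_kernel s a b p q) * (F (p - q) * G q)
        = ennreal (Xweight s (-a) p) * ennreal (norm (conv_integrand u v p q))" for p q
    proof -
      have "interaction_kernel s a b p q * ((Xweight s b (p - q) * norm (u (p - q))) * (Xweight s b q * norm (v q)))
         = Xweight s (-a) p * norm (conv_integrand u v p q)"
        by (simp add: interaction_kernel_def Xweight_def norm_conv_integrand powr_minus field_simps)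
      moreover have "0 \<le> interaction_kernel s a b p q" by (simp add: interaction_kernel_def)
      ultimately show ?thesis by (simp add: F_def G_def flip: ennreal_mult)
    qed
    have Tm: "T \<in> borel_measurable freq"
      unfolding T_def norm_conv_integrand by measurable
    note [measurable] = Tm
    define I :: "real \<times> int \<Rightarrow> ennreal" where "I = indicator {p. snd p \<noteq> 0}"
    have [measurable]: "I \<in> borel_measurable freq" unfolding I_def by measurable
    have est: "(\<integral>\<^sup>+p. (I p * (ennreal (Xweight s (-a) p) * T p))\<^sup>2 \<partial>freq) \<le> C * (Xnorm_sq s b u * Xnorm_sq s b v)"
    proof -
      have "(\<integral>\<^sup>+q. ennreal (interaction_kernel s a b p q) * (F (p - q) * G q) \<partial>freq) = ennreal (Xweight s (-a) p) * T p" for p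
        unfolding kernel T_def norm_conv_integrand by (rule nn_integral_cmult) measurable
      then show ?thesis using C[of F G] unfolding FG I_def by simp
    qed
    also have bnd_fin: "C * (Xnorm_sq s b u * Xnorm_sq s b v) < \<infinity>"
      using Cfin X_space_finite_norm[OF u] X_space_finite_norm[OF v] by (simp add: ennreal_mult_less_top)
    finally have "(\<integral>\<^sup>+p. (I p * (ennreal (Xweight s (-a) p) * T p))\<^sup>2 \<partial>freq) \<noteq> \<infinity>" by simp
    then have "AE p in freq. (I p * (ennreal (Xweight s (-a) p) * T p))\<^sup>2 \<noteq> \<infinity>"
      by (intro nn_integral_noteq_infinite) measurable
    then have Tfin: "AE p in freq. snd p \<noteq> 0 \<longrightarrow> T p < \<infinity>"
    proof eventually_elim
      case (elim p)
      show ?case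
      proof (intro impI, rule ccontr)
        assume "snd p \<noteq> 0" "\<not> T p < \<infinity>"
        then have "I p = 1" "T p = top" by (auto simp: I_def less_top[symmetric])
        moreover have "Xweight s (-a) p \<noteq> 0" using Xweight_pos[of s "-a" p] by linarith
        ultimately show False using elim by (simp add: ennreal_mult_top power2_eq_square)
      qed
    qed
    have cm: "conv_integrand u v p \<in> borel_measurable freq" for p
      using measurable_compose[OF measurable_Pair1' conv_integrand_measurable[OF um vm], of p] by simp
    from Tfin show "AE p in freq. snd p \<noteq> 0 \<longrightarrow> integrable freq (conv_integrand u v p)"
      by eventually_elim (auto simp: integrable_iff_bounded cm T_def)
    have convm: "conv u v \<in> borel_measurable freq"
      unfolding conv_def[abs_def] using conv_integrand_measurable[OF um vm]
      by (rule sigma_finite_measure.borel_measurable_lebesgue_integral[OF sigma_finite_freq])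
    have conv_le: "ennreal (norm (conv u v p)) \<le> T p" for p
    proof (cases "integrable freq (conv_integrand u v p)")
      case True
      then show ?thesis unfolding conv_def T_def by (rule integral_norm_bound_ennreal)
    next
      case False
      then show ?thesis by (simp add: conv_def not_integrable_integral_eq)
    qed
    have bil: "bilin u v p = (of_real (\<bar>of_int (snd p)\<bar>\<^sup>2) / (2 * \<i> * of_real (gam (snd p)))) * conv u v p" for p
      by (cases p) (simp add: bilin_def)
    have bilm: "bilin u v \<in> borel_measurable freq"
    proof -
      have "(\<lambda>p. of_real (\<bar>of_int (snd p)\<bar>\<^sup>2) / (2 * \<i> * of_real (gam (snd p))) :: complex) \<in> borel_measurable freq"
        by (rule freq_measurable_split) simp
      from borel_measurable_times[OF this convm] show ?thesis unfolding bil[abs_def] .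
    qed
    \<comment> \<open>the multiplier is bounded by one and vanishes on the zero mode, which the kernel estimate excludes\<close>
    have bil_le: "ennreal (Xweight s (-a) p * norm (bilin u v p)) \<le> I p * (ennreal (Xweight s (-a) p) * T p)" for p
    proof (cases "snd p = 0")
      case True
      then show ?thesis by (simp add: bil)
    next
      case False
      have "norm (of_real (\<bar>of_int (snd p)\<bar>\<^sup>2) / (2 * \<i> * of_real (gam (snd p))) :: complex) \<le> 1"
      proof -
        have g: "(of_int (snd p))\<^sup>2 \<le> gam (snd p)" by (rule gam_bounds)
        have "0 < (real_of_int (snd p))\<^sup>2" using False by simp
        then have "0 < gam (snd p)" using g by linarith
        then show ?thesis using g by (simp add: norm_divide norm_mult norm_power divide_le_eq)
      qed
      then have "norm (bilin u v p) \<le> 1 * norm (conv u v p)"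
        unfolding bil norm_mult by (intro mult_right_mono) auto
      then have "ennreal (Xweight s (-a) p * norm (bilin u v p)) \<le> ennreal (Xweight s (-a) p * norm (conv u v p))"
        by (intro ennreal_leI mult_left_mono) auto
      also have "\<dots> = ennreal (Xweight s (-a) p) * ennreal (norm (conv u v p))" by (simp add: ennreal_mult)
      also have "\<dots> \<le> ennreal (Xweight s (-a) p) * T p" by (intro mult_left_mono conv_le) simp
      finally show ?thesis using False by (simp add: I_def)
    qed
    have main: "Xnorm_sq s (-a) (bilin u v) \<le> C * (Xnorm_sq s b u * Xnorm_sq s b v)"
      using est unfolding Xnorm_sq_weight[of s "-a"]
      by (rule order_trans[rotated]) (intro nn_integral_mono power_mono bil_le zero_le)
    show "bilin u v \<in> X_space s (-a)"
      using sab bilm le_less_trans[OF main bnd_fin] by (intro X_space_of_finite_norm) auto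
    have "enn2real (Xnorm_sq s (-a) (bilin u v)) \<le> enn2real (C * (Xnorm_sq s b u * Xnorm_sq s b v))"
      using main bnd_fin by (intro enn2real_mono) auto
    then have "Xnorm s (-a) (bilin u v) \<le> sqrt (enn2real C) * (Xnorm s b u * Xnorm s b v)"
      unfolding Xnorm_def by (simp add: enn2real_mult flip: real_sqrt_mult)
    also have "\<dots> \<le> c * (Xnorm s b u * Xnorm s b v)"
      by (intro mult_right_mono) (auto simp: c_def Xnorm_def)
    finally show "Xnorm s (-a) (bilin u v) \<le> c * Xnorm s b u * Xnorm s b v" by (simp add: mult.assoc)
  qed
qed

end
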